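(* Let $\Omega,p,q,\mu$ be as in the context, and suppose that $f:\Omega\times\mathbb{R}\times\mathbb{R}^N\to\mathbb{R}$ satisfies the following three hypotheses. 1. $f$ is a Carathéodory function, that is, $x\mapsto f(x,t,\eta)$ is measurable for all $(t,\eta)\in\mathbb{R}\times\mathbb{R}^N$ and $(t,\eta)\mapsto f(x,t,\eta)$ is continuous for a.a. $x\in\Omega$; and $f(\cdot,0,0)\neq 0$ (i.e. it is not a.e. equal to zero in $\Omega$). 2. There exist $r\in C_+(\overline\Omega)$ with $r(x)<p^*(x)$ for all $x\in\overline\Omega$, a function $g\in L^{r'(x)}(\Omega)$ with $r'(x)=\frac{r(x)}{r(x)-1}$, and constants $a_1,a_2>0$ such that $$|f(x,t,\eta)|\le g(x)+a_1|t|^{r(x)-1}+a_2|\eta|^{\frac{p(x)}{r'(x)}}$$ for all $(t,\eta)\in\mathbb{R}\times\mathbb{R}^N$ and a.a. $x\in\Omega$. 3. There exist $\alpha\in C_+(\overline\Omega)$ with $\alpha^+<p^-$, functions $h\in L^{p'(x)}(\Omega)$, where $p'(x)=\frac{p(x)}{p(x)-1}$, $\beta_1\in L^{\frac{q(x)}{q(x)-\alpha^-}}(\Omega)$ and $\beta_2\in L^{\frac{q(x)}{q(x)-\alpha(x)}}(\Omega)$, and a parameter $\lambda>0$ such that $$\limsup_{|\eta|\to+\infty}\frac{f(x,t,\eta)}{h(x)+\beta_1(x)|t|^{\alpha^--1}+\beta_2(x)|\eta|^{\alpha(x)-1}}\le\lambda$$ for all $t\in\mathbb{R}$ and a.a.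 $x\in\Omega$. Let $\mathcal{T}',\mathcal{F}':W_0^{1,\mathcal{H}}(\Omega)\to W_0^{1,\mathcal{H}}(\Omega)^*$ be the operators defined in the context. Assume additionally that: (i) $\mathcal{T}'$ is a homeomorphism; (ii) $\mathcal{F}'$ is compact; (iii) the mapping $\mathcal{T}'-\mathcal{F}'$ is coercive. Then the operator equation $\mathcal{T}'u=\mathcal{F}'u$ has a nontrivial solution $u\in W_0^{1,\mathcal{H}}(\Omega)$ (that is, $u\ne0$), and this $u$ is a weak solution of the Dirichlet problem $$\begin{cases}-\mathrm{div}\left(|\nabla u|^{p(x)-2}\nabla u+\mu(x)|\nabla u|^{q(x)-2}\nabla u\right)+|x|^{-p(x)}|u|^{p(x)-2}u+|x|^{-q(x)}\mu(x)|u|^{q(x)-2}u=f(x,u,\nabla u)&\text{in }\Omega,\\ u=0&\text{on }\partial\Omega.\end{cases}$$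
   Context: Standing assumptions: $\Omega\subset\mathbb{R}^N$ ($N\ge3$) is a bounded domain with Lipschitz boundary; $p,q\in C(\overline\Omega)$ with $1<p(x),q(x)<N$ and $p(x)<q(x)<p^*(x)$ for all $x\in\overline\Omega$, where $p^*(x)=\frac{Np(x)}{N-p(x)}$; $\mu\in L^\infty(\Omega)$ with $\mu\ge0$. Notation: $C_+(\overline\Omega)=\{h\in C(\overline\Omega): h(x)>1 \text{ for all } x\in\overline\Omega\}$; $h^-=\min_{\overline\Omega}h$ and $h^+=\max_{\overline\Omega}h$. For $h\in C_+(\overline\Omega)$, $L^{h(x)}(\Omega)$ is the variable exponent Lebesgue space of measurable $u:\Omega\to\mathbb{R}$ with $\int_\Omega|u(x)|^{h(x)}dx<\infty$, with the Luxemburg norm. Musielak-Orlicz Sobolev space: let $\mathcal{H}(x,t)=t^{p(x)}+\mu(x)t^{q(x)}$ and $\rho_{\mathcal{H}}(u)=\int_\Omega\left(|u|^{p(x)}+\mu(x)|u|^{q(x)}\right)dx$. $L^{\mathcal{H}}(\Omega)$ is the space of measurable $u:\Omega\to\mathbb{R}$ with $\rho_{\mathcal{H}}(u)<\infty$, normed by $\|u\|_{\mathcal{H}}=\inf\{\zeta>0:\rho_{\mathcal{H}}(u/\zeta)\le1\}$. $W^{1,\mathcal{H}}(\Omega)=\{u\in L^{\mathcal{H}}(\Omega):|\nabla u|\in L^{\mathcal{H}}(\Omega)\}$ with norm $\|u\|_{1,\mathcal{H}}=\|u\|_{\mathcal{H}}+\|\,|\nabla u|\,\|_{\mathcal{H}}$,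 and $W_0^{1,\mathcal{H}}(\Omega)$ is the closure of $C_0^\infty(\Omega)$ in $W^{1,\mathcal{H}}(\Omega)$, equipped with the equivalent norm $\|u\|_{1,\mathcal{H},0}=\|\,|\nabla u|\,\|_{\mathcal{H}}$. $W_0^{1,\mathcal{H}}(\Omega)^*$ is its dual and $\langle\cdot,\cdot\rangle$ the duality pairing. Operators: $\mathcal{T}'$ is the derivative of the functional $$\mathcal{T}(u)=\int_\Omega\left(\frac{|\nabla u|^{p(x)}}{p(x)}+\mu(x)\frac{|\nabla u|^{q(x)}}{q(x)}\right)dx+\int_\Omega\left(\frac{|u|^{p(x)}}{p(x)|x|^{p(x)}}+\mu(x)\frac{|u|^{q(x)}}{q(x)|x|^{q(x)}}\right)dx,$$ that is, for $u,\varphi\in W_0^{1,\mathcal{H}}(\Omega)$, $$\langle\mathcal{T}'(u),\varphi\rangle=\int_\Omega\left(|\nabla u|^{p(x)-2}\nabla u+\mu(x)|\nabla u|^{q(x)-2}\nabla u\right)\cdot\nabla\varphi\,dx+\int_\Omega\left(|x|^{-p(x)}|u|^{p(x)-2}u+|x|^{-q(x)}\mu(x)|u|^{q(x)-2}u\right)\varphi\,dx,$$ and $$\langle\mathcal{F}'(u),\varphi\rangle=\int_\Omega f(x,u,\nabla u)\,\varphi\,dx.$$ A function $u\in W_0^{1,\mathcal{H}}(\Omega)$ is a weak solution of the Dirichlet problem if $\langle\mathcal{T}'(u),\varphi\rangle=\langle\mathcal{F}'(u),\varphi\rangle$ for all $\varphi\in W_0^{1,\mathcal{H}}(\Omega)$,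 with these explicit formulas. An operator is compact if it is continuous and maps bounded sets to relatively compact sets. An operator $A:W_0^{1,\mathcal{H}}(\Omega)\to W_0^{1,\mathcal{H}}(\Omega)^*$ is coercive if $\frac{\langle A(u),u\rangle}{\|u\|_{1,\mathcal{H},0}}\to+\infty$ as $\|u\|_{1,\mathcal{H},0}\to\infty$. *)

theory Defs
  imports "HOL-Analysis.Analysis"
begin

text \<open>
  Functions on \<open>\<Omega>\<close> are represented by total functions of which only the values on \<open>\<Omega>\<close> matter;
  measurability, integrals and null sets refer to \<open>lebesgue_on \<Omega>\<close>. Function spaces are sets of
  representatives, and equality of their elements is equality a.e. in \<open>\<Omega>\<close>. The dimension \<open>N\<close> is
  \<open>DIM('a)\<close>.
\<close>

section \<open>Domain and exponents\<close>

text \<open>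
  Near each boundary point, in suitable orthonormal coordinates, \<open>\<Omega>\<close> is the region above the
  graph of a Lipschitz function. The unit vector \<open>e\<close> is the last coordinate direction, and
  \<open>y - (y \<bullet> e) *\<^sub>R e\<close> stands for the first \<open>N - 1\<close> coordinates of \<open>y\<close>.
\<close>

definition lipschitz_boundary :: "'a::euclidean_space set \<Rightarrow> bool" where
  "lipschitz_boundary \<Omega> \<longleftrightarrow>
     (\<forall>z\<in>frontier \<Omega>. \<exists>e \<gamma> L \<delta>. norm e = 1 \<and> L-lipschitz_on {v. v \<bullet> e = 0} \<gamma> \<and> \<delta> > 0 \<and>
        (\<forall>y\<in>ball z \<delta>. y \<in> \<Omega> \<longleftrightarrow> y \<bullet> e > \<gamma> (y - (y \<bullet> e) *\<^sub>R e)))"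

definition lipschitz_domain :: "'a::euclidean_space set \<Rightarrow> bool" where
  "lipschitz_domain \<Omega> \<longleftrightarrow>
     open \<Omega> \<and> connected \<Omega> \<and> \<Omega> \<noteq> {} \<and> bounded \<Omega> \<and> lipschitz_boundary \<Omega>"

definition C_plus :: "'a::euclidean_space set \<Rightarrow> ('a \<Rightarrow> real) set" where
  "C_plus \<Omega> = {h. continuous_on (closure \<Omega>) h \<and> (\<forall>x\<in>closure \<Omega>. h x > 1)}"

definition exp_min :: "'a::euclidean_space set \<Rightarrow> ('a \<Rightarrow> real) \<Rightarrow> real" where
  "exp_min \<Omega> h = (INF x\<in>closure \<Omega>. h x)"

definition exp_max :: "'a::euclidean_space set \<Rightarrow> ('a \<Rightarrow> real) \<Rightarrow> real" where
  "exp_max \<Omega> h = (SUP x\<in>closure \<Omega>. h x)"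

definition critical_exp :: "('a::euclidean_space \<Rightarrow> real) \<Rightarrow> 'a \<Rightarrow> real" where
  "critical_exp p x = real DIM('a) * p x / (real DIM('a) - p x)"

definition conjugate_exp :: "('a \<Rightarrow> real) \<Rightarrow> 'a \<Rightarrow> real" where
  "conjugate_exp h x = h x / (h x - 1)"

definition L_infty_nonneg :: "'a::euclidean_space set \<Rightarrow> ('a \<Rightarrow> real) set" where
  "L_infty_nonneg \<Omega> = {\<mu> \<in> borel_measurable (lebesgue_on \<Omega>).
     (\<exists>C. AE x in lebesgue_on \<Omega>. \<bar>\<mu> x\<bar> \<le> C) \<and> (AE x in lebesgue_on \<Omega>. \<mu> x \<ge> 0)}"

definition L_var :: "'a::euclidean_space set \<Rightarrow> ('a \<Rightarrow> real) \<Rightarrow> ('a \<Rightarrow> real) set" where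
  "L_var \<Omega> h = {u \<in> borel_measurable (lebesgue_on \<Omega>).
     (\<integral>\<^sup>+x. ennreal (\<bar>u x\<bar> powr h x) \<partial>lebesgue_on \<Omega>) < \<infinity>}"


section \<open>Weak gradients\<close>

primrec Ck :: "nat \<Rightarrow> ('a::euclidean_space \<Rightarrow> real) \<Rightarrow> bool" where
  "Ck 0 \<phi> \<longleftrightarrow> continuous_on UNIV \<phi>"
| "Ck (Suc k) \<phi> \<longleftrightarrow>
     (\<forall>x. \<phi> differentiable (at x)) \<and> (\<forall>b\<in>Basis. Ck k (\<lambda>x. frechet_derivative \<phi> (at x) b))"

definition test_functions :: "'a::euclidean_space set \<Rightarrow> ('a \<Rightarrow> real) set" where
  "test_functions \<Omega> = {\<phi>. (\<forall>k. Ck k \<phi>) \<and>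
     compact (closure {x. \<phi> x \<noteq> 0}) \<and> closure {x. \<phi> x \<noteq> 0} \<subseteq> \<Omega>}"

definition locally_integrable ::
    "'a::euclidean_space set \<Rightarrow> ('a \<Rightarrow> 'b::euclidean_space) \<Rightarrow> bool" where
  "locally_integrable \<Omega> u \<longleftrightarrow> u \<in> borel_measurable (lebesgue_on \<Omega>) \<and>
     (\<forall>K. compact K \<and> K \<subseteq> \<Omega> \<longrightarrow> set_integrable lebesgue K u)"

definition is_weak_gradient ::
    "'a::euclidean_space set \<Rightarrow> ('a \<Rightarrow> real) \<Rightarrow> ('a \<Rightarrow> 'a) \<Rightarrow> bool" where
  "is_weak_gradient \<Omega> u v \<longleftrightarrow> locally_integrable \<Omega> u \<and> locally_integrable \<Omega> v \<and>
     (\<forall>\<phi>\<in>test_functions \<Omega>. \<forall>b\<in>Basis.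
        (\<integral>x. u x * frechet_derivative \<phi> (at x) b \<partial>lebesgue_on \<Omega>) =
        - (\<integral>x. (v x \<bullet> b) * \<phi> x \<partial>lebesgue_on \<Omega>))"

text \<open>A weak gradient is unique up to null sets, so the choice is immaterial.\<close>

definition wgrad :: "'a::euclidean_space set \<Rightarrow> ('a \<Rightarrow> real) \<Rightarrow> 'a \<Rightarrow> 'a" where
  "wgrad \<Omega> u = (SOME v. is_weak_gradient \<Omega> u v)"


section \<open>Musielak-Orlicz Sobolev spaces\<close>

definition rho_H :: "'a::euclidean_space set \<Rightarrow> ('a \<Rightarrow> real) \<Rightarrow> ('a \<Rightarrow> real) \<Rightarrow> ('a \<Rightarrow> real) \<Rightarrow>
    ('a \<Rightarrow> real) \<Rightarrow> ennreal" where
  "rho_H \<Omega> p q \<mu> u =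
     (\<integral>\<^sup>+x. ennreal (\<bar>u x\<bar> powr p x + \<mu> x * \<bar>u x\<bar> powr q x) \<partial>lebesgue_on \<Omega>)"

definition L_H :: "'a::euclidean_space set \<Rightarrow> ('a \<Rightarrow> real) \<Rightarrow> ('a \<Rightarrow> real) \<Rightarrow> ('a \<Rightarrow> real) \<Rightarrow>
    ('a \<Rightarrow> real) set" where
  "L_H \<Omega> p q \<mu> = {u \<in> borel_measurable (lebesgue_on \<Omega>). rho_H \<Omega> p q \<mu> u < \<infinity>}"

definition norm_H :: "'a::euclidean_space set \<Rightarrow> ('a \<Rightarrow> real) \<Rightarrow> ('a \<Rightarrow> real) \<Rightarrow> ('a \<Rightarrow> real) \<Rightarrow>
    ('a \<Rightarrow> real) \<Rightarrow> real" where
  "norm_H \<Omega> p q \<mu> u = Inf {\<zeta>. \<zeta> > 0 \<and> rho_H \<Omega> p q \<mu> (\<lambda>x. u x / \<zeta>) \<le> 1}"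

definition W1H :: "'a::euclidean_space set \<Rightarrow> ('a \<Rightarrow> real) \<Rightarrow> ('a \<Rightarrow> real) \<Rightarrow> ('a \<Rightarrow> real) \<Rightarrow>
    ('a \<Rightarrow> real) set" where
  "W1H \<Omega> p q \<mu> = {u \<in> L_H \<Omega> p q \<mu>. (\<exists>v. is_weak_gradient \<Omega> u v) \<and>
     (\<lambda>x. norm (wgrad \<Omega> u x)) \<in> L_H \<Omega> p q \<mu>}"

definition norm_1H0 :: "'a::euclidean_space set \<Rightarrow> ('a \<Rightarrow> real) \<Rightarrow> ('a \<Rightarrow> real) \<Rightarrow> ('a \<Rightarrow> real) \<Rightarrow>
    ('a \<Rightarrow> real) \<Rightarrow> real" where
  "norm_1H0 \<Omega> p q \<mu> u = norm_H \<Omega> p q \<mu> (\<lambda>x. norm (wgrad \<Omega> u x))"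

definition norm_1H :: "'a::euclidean_space set \<Rightarrow> ('a \<Rightarrow> real) \<Rightarrow> ('a \<Rightarrow> real) \<Rightarrow> ('a \<Rightarrow> real) \<Rightarrow>
    ('a \<Rightarrow> real) \<Rightarrow> real" where
  "norm_1H \<Omega> p q \<mu> u = norm_H \<Omega> p q \<mu> u + norm_1H0 \<Omega> p q \<mu> u"

text \<open>
  The topology that \<open>\<nu>\<close> induces on a set \<open>S\<close> of functions. On representatives a norm is only a
  seminorm, so the topology need not be Hausdorff.
\<close>

definition norm_topology :: "('b \<Rightarrow> real) set \<Rightarrow> (('b \<Rightarrow> real) \<Rightarrow> real) \<Rightarrow> ('b \<Rightarrow> real) topology" where
  "norm_topology S \<nu> = topology (\<lambda>U. U \<subseteq> S \<and>
     (\<forall>u\<in>U. \<exists>\<epsilon>>0. \<forall>v\<in>S. \<nu> (\<lambda>x. v x - u x) < \<epsilon> \<longrightarrow> v \<in> U))"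

lemma openin_norm_topology:
  "openin (norm_topology S \<nu>) U \<longleftrightarrow>
     U \<subseteq> S \<and> (\<forall>u\<in>U. \<exists>\<epsilon>>0. \<forall>v\<in>S. \<nu> (\<lambda>x. v x - u x) < \<epsilon> \<longrightarrow> v \<in> U)"
proof -
  let ?P = "\<lambda>U. U \<subseteq> S \<and> (\<forall>u\<in>U. \<exists>\<epsilon>>0. \<forall>v\<in>S. \<nu> (\<lambda>x. v x - u x) < \<epsilon> \<longrightarrow> v \<in> U)"
  have "?P (A \<inter> B)" if ab: "?P A" "?P B" for A B
  proof (intro conjI ballI)
    fix u assume u: "u \<in> A \<inter> B"
    obtain d where d: "d > 0" "\<And>v. v \<in> S \<Longrightarrow> \<nu> (\<lambda>x. v x - u x) < d \<Longrightarrow> v \<in> A"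
      using ab(1) u by blast
    obtain e where e: "e > 0" "\<And>v. v \<in> S \<Longrightarrow> \<nu> (\<lambda>x. v x - u x) < e \<Longrightarrow> v \<in> B"
      using ab(2) u by blast
    show "\<exists>\<epsilon>>0. \<forall>v\<in>S. \<nu> (\<lambda>x. v x - u x) < \<epsilon> \<longrightarrow> v \<in> A \<inter> B"
      using d e by (intro exI[of _ "min d e"]) auto
  qed (use ab in blast)
  moreover have "?P (\<Union>K)" if K: "\<forall>A\<in>K. ?P A" for K
  proof (intro conjI ballI)
    fix u assume "u \<in> \<Union>K"
    then obtain A where A: "A \<in> K" "u \<in> A" by blast
    then obtain d where "d > 0" "\<forall>v\<in>S. \<nu> (\<lambda>x. v x - u x) < d \<longrightarrow> v \<in> A"
      using K by blast
    then show "\<exists>\<epsilon>>0. \<forall>v\<in>S. \<nu> (\<lambda>x. v x - u x) < \<epsilon> \<longrightarrow> v \<in> \<Union>K"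
      using A(1) by blast
  qed (use K in blast)
  ultimately have "istopology ?P"
    unfolding istopology_def by blast
  then show ?thesis
    unfolding norm_topology_def by (simp add: topology_inverse')
qed

lemma topspace_norm_topology [simp]: "topspace (norm_topology S \<nu>) = S"
proof
  show "topspace (norm_topology S \<nu>) \<subseteq> S"
    using openin_norm_topology[of S \<nu> "topspace (norm_topology S \<nu>)"] by simp
  have "openin (norm_topology S \<nu>) S"
    unfolding openin_norm_topology using zero_less_one by blast
  then show "S \<subseteq> topspace (norm_topology S \<nu>)"
    by (rule openin_subset)
qed

definition W01H :: "'a::euclidean_space set \<Rightarrow> ('a \<Rightarrow> real) \<Rightarrow> ('a \<Rightarrow> real) \<Rightarrow> ('a \<Rightarrow> real) \<Rightarrow>
    ('a \<Rightarrow> real) set" where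
  "W01H \<Omega> p q \<mu> =
     norm_topology (W1H \<Omega> p q \<mu>) (norm_1H \<Omega> p q \<mu>) closure_of test_functions \<Omega>"

abbreviation W01H_topology :: "'a::euclidean_space set \<Rightarrow> ('a \<Rightarrow> real) \<Rightarrow> ('a \<Rightarrow> real) \<Rightarrow>
    ('a \<Rightarrow> real) \<Rightarrow> ('a \<Rightarrow> real) topology" where
  "W01H_topology \<Omega> p q \<mu> \<equiv> norm_topology (W01H \<Omega> p q \<mu>) (norm_1H0 \<Omega> p q \<mu>)"


section \<open>The dual space\<close>

text \<open>
  Functionals are extensional, so that equality of functionals on the space is equality in HOL.
  Boundedness forces a functional to agree on representatives that are equal a.e.
\<close>

definition dual_W01H :: "'a::euclidean_space set \<Rightarrow> ('a \<Rightarrow> real) \<Rightarrow> ('a \<Rightarrow> real) \<Rightarrow> ('a \<Rightarrow> real) \<Rightarrow>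
    (('a \<Rightarrow> real) \<Rightarrow> real) set" where
  "dual_W01H \<Omega> p q \<mu> = {l \<in> extensional (W01H \<Omega> p q \<mu>).
     (\<forall>\<phi>\<in>W01H \<Omega> p q \<mu>. \<forall>\<psi>\<in>W01H \<Omega> p q \<mu>. l (\<lambda>x. \<phi> x + \<psi> x) = l \<phi> + l \<psi>) \<and>
     (\<forall>\<phi>\<in>W01H \<Omega> p q \<mu>. \<forall>c. l (\<lambda>x. c * \<phi> x) = c * l \<phi>) \<and>
     (\<exists>C. \<forall>\<phi>\<in>W01H \<Omega> p q \<mu>. \<bar>l \<phi>\<bar> \<le> C * norm_1H0 \<Omega> p q \<mu> \<phi>)}"

definition dual_norm :: "'a::euclidean_space set \<Rightarrow> ('a \<Rightarrow> real) \<Rightarrow> ('a \<Rightarrow> real) \<Rightarrow> ('a \<Rightarrow> real) \<Rightarrow>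
    (('a \<Rightarrow> real) \<Rightarrow> real) \<Rightarrow> real" where
  "dual_norm \<Omega> p q \<mu> l = Sup {\<bar>l \<phi>\<bar> | \<phi>. \<phi> \<in> W01H \<Omega> p q \<mu> \<and> norm_1H0 \<Omega> p q \<mu> \<phi> \<le> 1}"

abbreviation dual_topology :: "'a::euclidean_space set \<Rightarrow> ('a \<Rightarrow> real) \<Rightarrow> ('a \<Rightarrow> real) \<Rightarrow>
    ('a \<Rightarrow> real) \<Rightarrow> (('a \<Rightarrow> real) \<Rightarrow> real) topology" where
  "dual_topology \<Omega> p q \<mu> \<equiv> norm_topology (dual_W01H \<Omega> p q \<mu>) (dual_norm \<Omega> p q \<mu>)"

text \<open>
  This is \<^const>\<open>homeomorphic_maps\<close> with equality in the Sobolev space read as equality a.e.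
\<close>

definition homeomorphism_onto_dual :: "'a::euclidean_space set \<Rightarrow> ('a \<Rightarrow> real) \<Rightarrow> ('a \<Rightarrow> real) \<Rightarrow>
    ('a \<Rightarrow> real) \<Rightarrow> (('a \<Rightarrow> real) \<Rightarrow> ('a \<Rightarrow> real) \<Rightarrow> real) \<Rightarrow> bool" where
  "homeomorphism_onto_dual \<Omega> p q \<mu> A \<longleftrightarrow> (\<exists>B.
     continuous_map (W01H_topology \<Omega> p q \<mu>) (dual_topology \<Omega> p q \<mu>) A \<and>
     continuous_map (dual_topology \<Omega> p q \<mu>) (W01H_topology \<Omega> p q \<mu>) B \<and>
     (\<forall>u\<in>W01H \<Omega> p q \<mu>. AE x in lebesgue_on \<Omega>. B (A u) x = u x) \<and>
     (\<forall>l\<in>dual_W01H \<Omega> p q \<mu>. A (B l) = l))"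

definition compact_into_dual :: "'a::euclidean_space set \<Rightarrow> ('a \<Rightarrow> real) \<Rightarrow> ('a \<Rightarrow> real) \<Rightarrow>
    ('a \<Rightarrow> real) \<Rightarrow> (('a \<Rightarrow> real) \<Rightarrow> ('a \<Rightarrow> real) \<Rightarrow> real) \<Rightarrow> bool" where
  "compact_into_dual \<Omega> p q \<mu> A \<longleftrightarrow>
     continuous_map (W01H_topology \<Omega> p q \<mu>) (dual_topology \<Omega> p q \<mu>) A \<and>
     (\<forall>S \<subseteq> W01H \<Omega> p q \<mu>. (\<exists>C. \<forall>u\<in>S. norm_1H0 \<Omega> p q \<mu> u \<le> C) \<longrightarrow>
        compactin (dual_topology \<Omega> p q \<mu>) (dual_topology \<Omega> p q \<mu> closure_of (A ` S)))"

definition coercive :: "'a::euclidean_space set \<Rightarrow> ('a \<Rightarrow> real) \<Rightarrow> ('a \<Rightarrow> real) \<Rightarrow>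
    ('a \<Rightarrow> real) \<Rightarrow> (('a \<Rightarrow> real) \<Rightarrow> ('a \<Rightarrow> real) \<Rightarrow> real) \<Rightarrow> bool" where
  "coercive \<Omega> p q \<mu> A \<longleftrightarrow>
     (\<forall>M. \<exists>R. \<forall>u\<in>W01H \<Omega> p q \<mu>. norm_1H0 \<Omega> p q \<mu> u \<ge> R \<longrightarrow> A u u / norm_1H0 \<Omega> p q \<mu> u \<ge> M)"


section \<open>The operators and weak solutions\<close>

definition T_grad_integrand :: "'a::euclidean_space set \<Rightarrow> ('a \<Rightarrow> real) \<Rightarrow> ('a \<Rightarrow> real) \<Rightarrow>
    ('a \<Rightarrow> real) \<Rightarrow> ('a \<Rightarrow> real) \<Rightarrow> ('a \<Rightarrow> real) \<Rightarrow> 'a \<Rightarrow> real" where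
  "T_grad_integrand \<Omega> p q \<mu> u \<phi> x =
     (norm (wgrad \<Omega> u x) powr (p x - 2) *\<^sub>R wgrad \<Omega> u x
      + (\<mu> x * norm (wgrad \<Omega> u x) powr (q x - 2)) *\<^sub>R wgrad \<Omega> u x) \<bullet> wgrad \<Omega> \<phi> x"

definition T_pot_integrand :: "('a::euclidean_space \<Rightarrow> real) \<Rightarrow> ('a \<Rightarrow> real) \<Rightarrow>
    ('a \<Rightarrow> real) \<Rightarrow> ('a \<Rightarrow> real) \<Rightarrow> ('a \<Rightarrow> real) \<Rightarrow> 'a \<Rightarrow> real" where
  "T_pot_integrand p q \<mu> u \<phi> x =
     (norm x powr (- p x) * \<bar>u x\<bar> powr (p x - 2) * u x
      + norm x powr (- q x) * \<mu> x * \<bar>u x\<bar> powr (q x - 2) * u x) * \<phi> x"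

definition F_integrand :: "'a::euclidean_space set \<Rightarrow> ('a \<Rightarrow> real \<Rightarrow> 'a \<Rightarrow> real) \<Rightarrow>
    ('a \<Rightarrow> real) \<Rightarrow> ('a \<Rightarrow> real) \<Rightarrow> 'a \<Rightarrow> real" where
  "F_integrand \<Omega> f u \<phi> x = f x (u x) (wgrad \<Omega> u x) * \<phi> x"

text \<open>
  The Bochner integral of a non-integrable function is \<open>0\<close>; existence of the integrals in the
  explicit formulas is therefore expressed separately.
\<close>

definition T_integrals_exist :: "'a::euclidean_space set \<Rightarrow> ('a \<Rightarrow> real) \<Rightarrow> ('a \<Rightarrow> real) \<Rightarrow>
    ('a \<Rightarrow> real) \<Rightarrow> ('a \<Rightarrow> real) \<Rightarrow> ('a \<Rightarrow> real) \<Rightarrow> bool" where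
  "T_integrals_exist \<Omega> p q \<mu> u \<phi> \<longleftrightarrow>
     integrable (lebesgue_on \<Omega>) (T_grad_integrand \<Omega> p q \<mu> u \<phi>) \<and>
     integrable (lebesgue_on \<Omega>) (T_pot_integrand p q \<mu> u \<phi>)"

definition F_integral_exists :: "'a::euclidean_space set \<Rightarrow> ('a \<Rightarrow> real \<Rightarrow> 'a \<Rightarrow> real) \<Rightarrow>
    ('a \<Rightarrow> real) \<Rightarrow> ('a \<Rightarrow> real) \<Rightarrow> bool" where
  "F_integral_exists \<Omega> f u \<phi> \<longleftrightarrow> integrable (lebesgue_on \<Omega>) (F_integrand \<Omega> f u \<phi>)"

definition T_form :: "'a::euclidean_space set \<Rightarrow> ('a \<Rightarrow> real) \<Rightarrow> ('a \<Rightarrow> real) \<Rightarrow>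
    ('a \<Rightarrow> real) \<Rightarrow> ('a \<Rightarrow> real) \<Rightarrow> ('a \<Rightarrow> real) \<Rightarrow> real" where
  "T_form \<Omega> p q \<mu> u \<phi> =
     (\<integral>x. T_grad_integrand \<Omega> p q \<mu> u \<phi> x \<partial>lebesgue_on \<Omega>)
     + (\<integral>x. T_pot_integrand p q \<mu> u \<phi> x \<partial>lebesgue_on \<Omega>)"

definition F_form :: "'a::euclidean_space set \<Rightarrow> ('a \<Rightarrow> real \<Rightarrow> 'a \<Rightarrow> real) \<Rightarrow>
    ('a \<Rightarrow> real) \<Rightarrow> ('a \<Rightarrow> real) \<Rightarrow> real" where
  "F_form \<Omega> f u \<phi> = (\<integral>x. F_integrand \<Omega> f u \<phi> x \<partial>lebesgue_on \<Omega>)"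

definition T_op :: "'a::euclidean_space set \<Rightarrow> ('a \<Rightarrow> real) \<Rightarrow> ('a \<Rightarrow> real) \<Rightarrow>
    ('a \<Rightarrow> real) \<Rightarrow> ('a \<Rightarrow> real) \<Rightarrow> ('a \<Rightarrow> real) \<Rightarrow> real" where
  "T_op \<Omega> p q \<mu> u = (\<lambda>\<phi>\<in>W01H \<Omega> p q \<mu>. T_form \<Omega> p q \<mu> u \<phi>)"

definition F_op :: "'a::euclidean_space set \<Rightarrow> ('a \<Rightarrow> real) \<Rightarrow> ('a \<Rightarrow> real) \<Rightarrow>
    ('a \<Rightarrow> real) \<Rightarrow> ('a \<Rightarrow> real \<Rightarrow> 'a \<Rightarrow> real) \<Rightarrow> ('a \<Rightarrow> real) \<Rightarrow> ('a \<Rightarrow> real) \<Rightarrow> real" where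
  "F_op \<Omega> p q \<mu> f u = (\<lambda>\<phi>\<in>W01H \<Omega> p q \<mu>. F_form \<Omega> f u \<phi>)"

definition weak_solution :: "'a::euclidean_space set \<Rightarrow> ('a \<Rightarrow> real) \<Rightarrow> ('a \<Rightarrow> real) \<Rightarrow>
    ('a \<Rightarrow> real) \<Rightarrow> ('a \<Rightarrow> real \<Rightarrow> 'a \<Rightarrow> real) \<Rightarrow> ('a \<Rightarrow> real) \<Rightarrow> bool" where
  "weak_solution \<Omega> p q \<mu> f u \<longleftrightarrow> u \<in> W01H \<Omega> p q \<mu> \<and>
     (\<forall>\<phi>\<in>W01H \<Omega> p q \<mu>. T_integrals_exist \<Omega> p q \<mu> u \<phi> \<and> F_integral_exists \<Omega> f u \<phi> \<and>
        T_form \<Omega> p q \<mu> u \<phi> = F_form \<Omega> f u \<phi>)"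

definition caratheodory :: "'a::euclidean_space set \<Rightarrow> ('a \<Rightarrow> real \<Rightarrow> 'a \<Rightarrow> real) \<Rightarrow> bool" where
  "caratheodory \<Omega> f \<longleftrightarrow> (\<forall>t \<eta>. (\<lambda>x. f x t \<eta>) \<in> borel_measurable (lebesgue_on \<Omega>)) \<and>
     (AE x in lebesgue_on \<Omega>. continuous_on UNIV (\<lambda>(t, \<eta>). f x t \<eta>))"

end

theory Submission
  imports Defs
begin

text \<open>
  Let \<open>P\<close> be the radial retraction of the Sobolev space onto a large ball. The map \<open>T\<inverse> \<circ> F \<circ> P\<close> takes
  its values in a compact set, so Schauder's theorem yields \<open>u\<close> with \<open>T u = F (P u)\<close>. If \<open>u\<close> were
  outside the ball, then \<open>v = P u = s u\<close> with \<open>0 < s < 1\<close>; since \<open>T\<close> is a sum of terms that are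
  homogeneous of positive degree, \<open>\<langle>T v, v\<rangle> \<le> \<langle>T u, v\<rangle> = \<langle>F v, v\<rangle>\<close>, against coercivity. Hence \<open>P u = u\<close>.
  If \<open>u\<close> vanished a.e., then \<open>f(\<sqdot>, 0, 0)\<close> would be orthogonal to all test functions and vanish a.e.
\<close>

section \<open>Schauder's fixed point theorem in seminormed function spaces\<close>

text \<open>The elements of the spaces are representatives, so the norms are only seminorms, the
  topologies need not be Hausdorff, and the spaces are sets of functions rather than types.
  Schauder's theorem is therefore proved for a vector space of functions with a seminorm, starting
  from Brouwer on a cube of coefficients, and it yields only that the image of \<open>u\<close> is
  at distance zero from \<open>u\<close>. Exactness returns on the other side: evaluations separate
  functionals, so a continuous map into the dual takes equal values at points at distance zero.
  \<open>T\<close> has no single degree of homogeneity, since the exponents vary with the point; the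
  estimate along a ray holds because every exponent \<open>c\<close> exceeds 1, so that
  \<open>s powr (c - 1)\<close> is at most 1 for \<open>s\<close> below 1. For nontriviality, the
  growth bound at \<open>t = 0\<close> and \<open>\<eta> = 0\<close> makes \<open>f x 0 0\<close>
  integrable in \<open>x\<close>, which brings it within reach of the fundamental lemma.\<close>

lemma cube_convergent_subsequence:
  fixes X :: "nat \<Rightarrow> nat \<Rightarrow> real"
  assumes "\<And>k i. i < n \<Longrightarrow> X k i \<in> {0..1}"
  shows "\<exists>s x. strict_mono (s :: nat \<Rightarrow> nat) \<and> (\<forall>i<n. (\<lambda>k. X (s k) i) \<longlonglongrightarrow> x i)"
  using assms
proof (induction n)
  case 0
  show ?case using strict_mono_id by blast
next
  case (Suc n)
  then obtain s x where s: "strict_mono (s :: nat \<Rightarrow> nat)" "\<And>i. i < n \<Longrightarrow> (\<lambda>k. X (s k) i) \<longlonglongrightarrow> x i"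
    by (metis less_SucI)
  have "\<forall>k. X (s k) n \<in> {0..1}" using Suc.prems by blast
  then obtain l r where r: "strict_mono (r :: nat \<Rightarrow> nat)" "((\<lambda>k. X (s k) n) \<circ> r) \<longlonglongrightarrow> l"
    using compact_Icc[of "0::real" 1] unfolding compact_def by metis
  show ?case
  proof (intro exI conjI allI impI)
    show "strict_mono (s \<circ> r)" using s r strict_mono_o by blast
    fix i assume "i < Suc n"
    then show "(\<lambda>k. X ((s \<circ> r) k) i) \<longlonglongrightarrow> (x(n := l)) i"
      using r(2) LIMSEQ_subseq_LIMSEQ[OF s(2) r(1), of i] by (auto simp: o_def less_Suc_eq)
  qed
qed

text \<open>
  Brouwer's theorem with the dimension as a number, which the library version, where it is the
  dimension of a type, does not give. Kuhn's lemma yields sequences of pairs of points with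
  opposite labels that converge to a fixed point.
\<close>

lemma brouwer_cube_nat:
  fixes g :: "(nat \<Rightarrow> real) \<Rightarrow> nat \<Rightarrow> real"
  assumes maps: "\<And>x i. (\<And>i. i < n \<Longrightarrow> x i \<in> {0..1}) \<Longrightarrow> i < n \<Longrightarrow> g x i \<in> {0..1}"
    and cont: "\<And>X x i. (\<And>k i. i < n \<Longrightarrow> X k i \<in> {0..1}) \<Longrightarrow>
      (\<And>i. i < n \<Longrightarrow> (\<lambda>k. X k i) \<longlonglongrightarrow> x i) \<Longrightarrow> i < n \<Longrightarrow> (\<lambda>k. g (X k) i) \<longlonglongrightarrow> g x i"
  shows "\<exists>x. \<forall>i<n. x i \<in> {0..1} \<and> g x i = x i"
proof -
  \<comment> \<open>Kuhn's labelling: label 0 promises that \<open>g\<close> does not decrease the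
    coordinate, label 1 that it does not increase it. The faces \<open>x i = 0\<close> and
    \<open>x i = 1\<close> get the labels that the combinatorial lemma demands; there the promises
    hold because \<open>g\<close> stays in the cube.\<close>
  define l where "l x i = (if x i = 0 \<or> x i \<le> g x i \<and> x i \<noteq> 1 then 0 else 1::nat)" for x i
  have l0: "x i \<le> g x i" if "l x i = 0" "\<And>i. i < n \<Longrightarrow> x i \<in> {0..1}" "i < n" for x i
    using maps[OF that(2,3)] that(1) by (auto simp: l_def split: if_splits)
  have l1: "g x i \<le> x i" if "l x i \<noteq> 0" "\<And>i. i < n \<Longrightarrow> x i \<in> {0..1}" "i < n" for x i
    using maps[OF that(2,3)] that(1) by (auto simp: l_def split: if_splits)
  \<comment> \<open>Points of the grid of mesh \<open>1 / (k + 1)\<close>; the successor keeps the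
    mesh meaningful for \<open>k = 0\<close>.\<close>
  define sc where "sc k r i = real (r i) / real (Suc k)" for k and r :: "nat \<Rightarrow> nat" and i :: nat
  have sc01: "sc k r i \<in> {0..1}" if "r i \<le> Suc k" for k r i
    using that by (simp add: sc_def)
  have "\<forall>k. \<exists>q. (\<forall>i<n. q i < Suc k) \<and> (\<forall>i<n. \<exists>r s. (\<forall>j<n. q j \<le> r j \<and> r j \<le> q j + 1) \<and>
      (\<forall>j<n. q j \<le> s j \<and> s j \<le> q j + 1) \<and> l (sc k r) i \<noteq> l (sc k s) i)"
  proof (rule allI, rule kuhn_lemma)
    fix k
    show "0 < Suc k" by simp
    show "\<forall>x. (\<forall>i<n. x i \<le> Suc k) \<longrightarrow> (\<forall>i<n. l (sc k x) i = 0 \<or> l (sc k x) i = 1)"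
      by (simp add: l_def)
    show "\<forall>x. (\<forall>i<n. x i \<le> Suc k) \<longrightarrow> (\<forall>i<n. x i = 0 \<longrightarrow> l (sc k x) i = 0)"
      by (simp add: l_def sc_def)
    show "\<forall>x. (\<forall>i<n. x i \<le> Suc k) \<longrightarrow> (\<forall>i<n. x i = Suc k \<longrightarrow> l (sc k x) i = 1)"
      by (simp add: l_def sc_def)
  qed blast
  then obtain q where q: "\<And>k i. i < n \<Longrightarrow> q k i < Suc k"
    and qq: "\<And>k i. i < n \<Longrightarrow> \<exists>r s. (\<forall>j<n. q k j \<le> r j \<and> r j \<le> q k j + 1) \<and>
      (\<forall>j<n. q k j \<le> s j \<and> s j \<le> q k j + 1) \<and> l (sc k r) i \<noteq> l (sc k s) i"
    unfolding choice_iff by blast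
  \<comment> \<open>The cell has two vertices with different labels in direction \<open>i\<close>;
    after exchanging them if necessary, \<open>r\<close> is the one with label 0.\<close>
  have "\<exists>r s. (\<forall>j<n. q k j \<le> r j \<and> r j \<le> q k j + 1) \<and>
      (\<forall>j<n. q k j \<le> s j \<and> s j \<le> q k j + 1) \<and> l (sc k r) i = 0 \<and> l (sc k s) i \<noteq> 0" if i: "i < n" for k i
  proof -
    obtain r s where rs: "\<forall>j<n. q k j \<le> r j \<and> r j \<le> q k j + 1"
        "\<forall>j<n. q k j \<le> s j \<and> s j \<le> q k j + 1" "l (sc k r) i \<noteq> l (sc k s) i"
      using qq[OF i, of k] by blast
    show ?thesis
    proof (cases "l (sc k r) i = 0")
      case True
      then show ?thesis using rs by (intro exI[of _ r] exI[of _ s]) simp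
    next
      case False
      then have "l (sc k s) i = 0" using rs(3) by (simp add: l_def split: if_splits)
      then show ?thesis using rs False by (intro exI[of _ s] exI[of _ r]) simp
    qed
  qed
  then have "\<forall>i k. \<exists>r s. i < n \<longrightarrow> (\<forall>j<n. q k j \<le> r j \<and> r j \<le> q k j + 1) \<and>
      (\<forall>j<n. q k j \<le> s j \<and> s j \<le> q k j + 1) \<and> l (sc k r) i = 0 \<and> l (sc k s) i \<noteq> 0"
    by blast
  then obtain r s where
    r: "\<And>i k j. i < n \<Longrightarrow> j < n \<Longrightarrow> q k j \<le> r i k j \<and> r i k j \<le> q k j + 1" and
    s: "\<And>i k j. i < n \<Longrightarrow> j < n \<Longrightarrow> q k j \<le> s i k j \<and> s i k j \<le> q k j + 1" and
    lrs: "\<And>i k. i < n \<Longrightarrow> l (sc k (r i k)) i = 0 \<and> l (sc k (s i k)) i \<noteq> 0"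
    unfolding choice_iff by blast
  have "sc k (q k) i \<in> {0..1}" if "i < n" for k i
    using q[OF that, of k] by (intro sc01) simp
  then obtain u x where u: "strict_mono (u :: nat \<Rightarrow> nat)"
    and x: "\<And>i. i < n \<Longrightarrow> (\<lambda>k. sc (u k) (q (u k)) i) \<longlonglongrightarrow> x i"
    using cube_convergent_subsequence[of n "\<lambda>k. sc k (q k)"] by blast
  have x01: "x i \<in> {0..1}" if "i < n" for i
    using closed_sequentially[OF closed_atLeastAtMost _ x[OF that], of 0 1] q[OF that] sc01
    by (meson less_imp_le)
  \<comment> \<open>Every vertex of a cell is within one mesh width of its corner \<open>q k\<close>
    in each coordinate, so all of them share the limit \<open>x\<close> along the
    subsequence.\<close>
  have near: "(\<lambda>k. sc (u k) (R (u k)) j) \<longlonglongrightarrow> x j"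
    if "\<And>k. q k j \<le> R k j \<and> R k j \<le> q k j + 1" "j < n" for R j
  proof -
    have z: "(\<lambda>k. inverse (real (Suc (u k)))) \<longlonglongrightarrow> 0"
      using LIMSEQ_subseq_LIMSEQ[OF LIMSEQ_inverse_real_of_nat u] by (simp add: o_def)
    have "sc k (q k) j \<le> sc k (R k) j" "sc k (R k) j \<le> sc k (q k) j + inverse (real (Suc k))" for k
    proof -
      have "real (q k j) \<le> real (R k j)" "real (R k j) \<le> real (q k j) + 1"
        using that(1)[of k] by linarith+
      then show "sc k (q k) j \<le> sc k (R k) j" "sc k (R k) j \<le> sc k (q k) j + inverse (real (Suc k))"
        unfolding sc_def inverse_eq_divide add_divide_distrib[symmetric]
        by (auto intro!: divide_right_mono)
    qed
    then show ?thesis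
      using tendsto_sandwich[OF _ _ x[OF that(2)], of "\<lambda>k. sc (u k) (R (u k)) j"
          "\<lambda>k. sc (u k) (q (u k)) j + inverse (real (Suc (u k)))"]
        tendsto_add[OF x[OF that(2)] z] by simp
  qed
  have "g x i = x i" if i: "i < n" for i
  proof (rule antisym)
    have r01: "sc k (r i k) j \<in> {0..1}" and s01: "sc k (s i k) j \<in> {0..1}" if "j < n" for k j
      using q[OF that, of k] r[OF i that, of k] s[OF i that, of k]
      by (intro sc01; linarith)+
    have c: "(\<lambda>k. g (sc (u k) (r i (u k))) i) \<longlonglongrightarrow> g x i" "(\<lambda>k. g (sc (u k) (s i (u k))) i) \<longlonglongrightarrow> g x i"
      using r s i r01 s01 near by (auto intro!: cont[where i=i])
    \<comment> \<open>In the limit the vertices with label 0 give \<open>x i \<le> g x i\<close> and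
      those with label 1 the reverse, both at the same point \<open>x\<close>.\<close>
    have lo: "sc k (r i k) i \<le> g (sc k (r i k)) i" for k
      by (rule l0[OF conjunct1[OF lrs[OF i]] r01 i])
    have hi: "g (sc k (s i k)) i \<le> sc k (s i k) i" for k
      by (rule l1[OF conjunct2[OF lrs[OF i]] s01 i])
    show "x i \<le> g x i"
      using LIMSEQ_le[OF near[where R="r i" and j=i, OF r[OF i i] i] c(1)] lo by blast
    show "g x i \<le> x i"
      using LIMSEQ_le[OF c(2) near[where R="s i" and j=i, OF s[OF i i] i]] hi by blast
  qed
  then show ?thesis using x01 by blast
qed

section \<open>Seminormed spaces of functions and Schauder's theorem\<close>

locale seminormed_functions =
  fixes V :: "('b \<Rightarrow> real) set" and \<nu> :: "('b \<Rightarrow> real) \<Rightarrow> real"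
  assumes zero_mem: "(\<lambda>_. 0) \<in> V"
    and add_mem: "u \<in> V \<Longrightarrow> v \<in> V \<Longrightarrow> (\<lambda>x. u x + v x) \<in> V"
    and scale_mem: "u \<in> V \<Longrightarrow> (\<lambda>x. c * u x) \<in> V"
    and nonneg: "u \<in> V \<Longrightarrow> 0 \<le> \<nu> u"
    and triangle: "u \<in> V \<Longrightarrow> v \<in> V \<Longrightarrow> \<nu> (\<lambda>x. u x + v x) \<le> \<nu> u + \<nu> v"
    and homogeneous: "u \<in> V \<Longrightarrow> \<nu> (\<lambda>x. c * u x) = \<bar>c\<bar> * \<nu> u"
begin

lemma diff_mem: "u \<in> V \<Longrightarrow> v \<in> V \<Longrightarrow> (\<lambda>x. u x - v x) \<in> V"
  using add_mem[OF _ scale_mem, of u v "-1"] by simp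

lemma zero: "\<nu> (\<lambda>_. 0) = 0"
  using homogeneous[OF zero_mem, of 0] by simp

lemma diff_commute: "u \<in> V \<Longrightarrow> v \<in> V \<Longrightarrow> \<nu> (\<lambda>x. u x - v x) = \<nu> (\<lambda>x. v x - u x)"
  using homogeneous[OF diff_mem, of u v "-1"] by simp

lemma diff_triangle:
  "u \<in> V \<Longrightarrow> v \<in> V \<Longrightarrow> w \<in> V \<Longrightarrow> \<nu> (\<lambda>x. u x - w x) \<le> \<nu> (\<lambda>x. u x - v x) + \<nu> (\<lambda>x. v x - w x)"
  using triangle[OF diff_mem diff_mem, of u v v w] by simp

lemma le_diff: "u \<in> V \<Longrightarrow> v \<in> V \<Longrightarrow> \<bar>\<nu> u - \<nu> v\<bar> \<le> \<nu> (\<lambda>x. u x - v x)"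
  using triangle[OF diff_mem, of u v v] triangle[OF diff_mem, of v u u] diff_commute[of u v] by simp

lemma openin_ball:
  assumes "u \<in> V"
  shows "openin (norm_topology V \<nu>) {v \<in> V. \<nu> (\<lambda>x. v x - u x) < e}"
  unfolding openin_norm_topology
proof (intro conjI ballI)
  fix w assume w: "w \<in> {v \<in> V. \<nu> (\<lambda>x. v x - u x) < e}"
  show "\<exists>\<epsilon>>0. \<forall>v\<in>V. \<nu> (\<lambda>x. v x - w x) < \<epsilon> \<longrightarrow> v \<in> {v \<in> V. \<nu> (\<lambda>x. v x - u x) < e}"
  proof (intro exI conjI ballI impI)
    show "0 < e - \<nu> (\<lambda>x. w x - u x)" using w by simp
    fix v assume "v \<in> V" "\<nu> (\<lambda>x. v x - w x) < e - \<nu> (\<lambda>x. w x - u x)"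
    then show "v \<in> {v \<in> V. \<nu> (\<lambda>x. v x - u x) < e}"
      using diff_triangle[of v w u] w assms by simp
  qed
qed auto

text \<open>Preimages of open balls are open, which turns topological continuity into its
  epsilon-delta form.\<close>

lemma continuous_map_imp_continuous_at:
  assumes "continuous_map (norm_topology V \<nu>) (norm_topology V \<nu>) K" "u \<in> V" "e > 0"
  shows "\<exists>d>0. \<forall>v\<in>V. \<nu> (\<lambda>x. v x - u x) < d \<longrightarrow> \<nu> (\<lambda>x. K v x - K u x) < e"
proof -
  have K: "K v \<in> V" if "v \<in> V" for v
    using assms(1) that by (auto simp: continuous_map_def)
  have "openin (norm_topology V \<nu>)
      {v \<in> topspace (norm_topology V \<nu>). K v \<in> {v \<in> V. \<nu> (\<lambda>x. v x - K u x) < e}}"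
    by (rule openin_continuous_map_preimage[OF assms(1) openin_ball[OF K[OF assms(2)]]])
  moreover have "u \<in> {v \<in> topspace (norm_topology V \<nu>). K v \<in> {v \<in> V. \<nu> (\<lambda>x. v x - K u x) < e}}"
    using assms K by (simp add: zero)
  ultimately obtain d where "d > 0" "\<And>v. v \<in> V \<Longrightarrow> \<nu> (\<lambda>x. v x - u x) < d \<Longrightarrow>
      v \<in> {v \<in> topspace (norm_topology V \<nu>). K v \<in> {v \<in> V. \<nu> (\<lambda>x. v x - K u x) < e}}"
    unfolding openin_norm_topology by blast
  then show ?thesis by auto
qed

lemma combination:
  assumes "\<And>i. i < m \<Longrightarrow> y i \<in> V"
  shows "(\<lambda>x. \<Sum>i<m. a i * y i x) \<in> V \<and> \<nu> (\<lambda>x. \<Sum>i<(m::nat). a i * y i x) \<le> (\<Sum>i<m. \<bar>a i\<bar> * \<nu> (y i))"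
  using assms
proof (induction m)
  case 0
  show ?case by (simp add: zero_mem zero)
next
  case (Suc m)
  then have IH: "(\<lambda>x. \<Sum>i<m. a i * y i x) \<in> V"
      "\<nu> (\<lambda>x. \<Sum>i<m. a i * y i x) \<le> (\<Sum>i<m. \<bar>a i\<bar> * \<nu> (y i))" and y: "y m \<in> V"
    by auto
  show ?case
    using add_mem[OF IH(1) scale_mem[OF y]] IH(2) triangle[OF IH(1) scale_mem[OF y], of "a m"]
    by (simp add: homogeneous[OF y])
qed

text \<open>The Schauder projection: a partition of unity subordinate to finitely many small balls
  covering \<open>C\<close> replaces a point of \<open>C\<close> by a convex combination of the
  centres, at a cost of at most the radius. Brouwer's theorem is applied to the coefficients, on the
  whole cube; normalising the weights puts the fixed coefficient vector into the simplex.\<close>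

lemma schauder_approximate:
  assumes cont: "continuous_map (norm_topology V \<nu>) (norm_topology V \<nu>) K"
    and C: "compactin (norm_topology V \<nu>) C" and KC: "K ` V \<subseteq> C" and "\<epsilon> > 0"
  shows "\<exists>z\<in>V. \<nu> (\<lambda>x. K z x - z x) < \<epsilon>"
proof -
  have CV: "C \<subseteq> V" using compactin_subset_topspace[OF C] by simp
  \<comment> \<open>Half of \<epsilon> turns the bound \<open>\<le> \<eta>\<close> reached at the
    end into a strict one.\<close>
  define \<eta> where "\<eta> = \<epsilon> / 2"
  have \<eta>: "\<eta> > 0" "\<eta> < \<epsilon>" using \<open>\<epsilon> > 0\<close> by (auto simp: \<eta>_def)
  let ?B = "\<lambda>y. {v \<in> V. \<nu> (\<lambda>x. v x - y x) < \<eta>}"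
  have "\<forall>U\<in>?B ` C. openin (norm_topology V \<nu>) U"
    using CV openin_ball by blast
  moreover have "C \<subseteq> \<Union>(?B ` C)"
    using CV \<eta> by (force simp: zero)
  ultimately have "\<exists>F. finite F \<and> F \<subseteq> ?B ` C \<and> C \<subseteq> \<Union>F"
    using C unfolding compactin_def by blast
  then obtain F' where F': "finite F'" "F' \<subseteq> ?B ` C" "C \<subseteq> \<Union>F'"
    by blast
  obtain F where "finite F" "F \<subseteq> C" and F: "C \<subseteq> (\<Union>y\<in>F. ?B y)"
    using finite_subset_image[OF F'(1,2)] F'(3) by auto
  then obtain m :: nat and y where y: "F = y ` {..<m}"
    by (metis finite_imp_nat_seg_image_inj_on lessThan_def)
  then have yV: "y i \<in> V" if "i < m" for i
    using that \<open>F \<subseteq> C\<close> CV by blast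
  \<comment> \<open>A tent around \<open>y i\<close>, positive exactly on the open \<eta>-ball;
    since these balls cover \<open>C\<close>, the weights have a positive sum there.\<close>
  define t where "t u i = max 0 (\<eta> - \<nu> (\<lambda>x. u x - y i x))" for u i
  define Z where "Z l = (\<lambda>x. \<Sum>i<m. l i * y i x)" for l
  have ZV: "Z l \<in> V" for l
    unfolding Z_def using combination yV by blast
  then have KZ: "K (Z l) \<in> C" "K (Z l) \<in> V" for l
    using KC CV by auto
  \<comment> \<open>From coefficients to a point, through \<open>K\<close>, and back to the
    normalised weights of the image. As \<open>K\<close> takes its values in \<open>C\<close>, the
    denominator is positive also for coefficients outside the simplex.\<close>
  define g where "g l i = t (K (Z l)) i / (\<Sum>j<m. t (K (Z l)) j)" for l i
  have t0: "t u i \<ge> 0" for u i by (simp add: t_def)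
  have sum_pos: "(\<Sum>j<m. t u j) > 0" if u: "u \<in> C" for u
  proof -
    obtain i where "i < m" "\<nu> (\<lambda>x. u x - y i x) < \<eta>"
      using subsetD[OF F u] by (auto simp: y)
    then show ?thesis
      by (intro sum_pos2[of _ i]) (auto simp: t_def)
  qed
  have "\<exists>l. \<forall>i<m. l i \<in> {0..1} \<and> g l i = l i"
  proof (rule brouwer_cube_nat)
    fix l and i :: nat assume "i < m"
    then have "t (K (Z l)) i \<le> (\<Sum>j<m. t (K (Z l)) j)"
      using t0 by (intro member_le_sum) auto
    then show "g l i \<in> {0..1}"
      using t0[of "K (Z l)" i] sum_pos[OF KZ(1), of l] by (simp add: g_def)
  next
    fix X :: "nat \<Rightarrow> nat \<Rightarrow> real" and l and i :: nat
    assume X: "\<And>k i. i < m \<Longrightarrow> X k i \<in> {0..1}" "\<And>i. i < m \<Longrightarrow> (\<lambda>k. X k i) \<longlonglongrightarrow> l i" and "i < m"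
    have "\<nu> (\<lambda>x. Z (X k) x - Z l x) \<le> (\<Sum>i<m. \<bar>X k i - l i\<bar> * \<nu> (y i))" for k
      using combination[OF yV, where m=m and a="\<lambda>i. X k i - l i"]
      by (simp add: Z_def left_diff_distrib sum_subtractf)
    moreover have "(\<lambda>k. \<Sum>i<m. \<bar>X k i - l i\<bar> * \<nu> (y i)) \<longlonglongrightarrow> 0"
    proof -
      have "(\<lambda>k. \<Sum>i<m. \<bar>X k i - l i\<bar> * \<nu> (y i)) \<longlonglongrightarrow> (\<Sum>i<m. \<bar>l i - l i\<bar> * \<nu> (y i))"
        by (intro tendsto_intros X) auto
      then show ?thesis by simp
    qed
    ultimately have "(\<lambda>k. \<nu> (\<lambda>x. Z (X k) x - Z l x)) \<longlonglongrightarrow> 0"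
      using nonneg[OF diff_mem[OF ZV ZV]]
      by (intro tendsto_sandwich[of "\<lambda>_. 0" "\<lambda>k. \<nu> (\<lambda>x. Z (X k) x - Z l x)"]) auto
    then have Kc: "(\<lambda>k. \<nu> (\<lambda>x. K (Z (X k)) x - K (Z l) x)) \<longlonglongrightarrow> 0"
    proof -
      assume Zc: "(\<lambda>k. \<nu> (\<lambda>x. Z (X k) x - Z l x)) \<longlonglongrightarrow> 0"
      show ?thesis
      proof (rule LIMSEQ_I)
        fix e :: real assume "e > 0"
        then obtain d where d: "d > 0" "\<And>v. v \<in> V \<Longrightarrow> \<nu> (\<lambda>x. v x - Z l x) < d \<Longrightarrow> \<nu> (\<lambda>x. K v x - K (Z l) x) < e"
          using continuous_map_imp_continuous_at[OF cont ZV] by meson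
        obtain n0 where "\<And>k. k \<ge> n0 \<Longrightarrow> norm (\<nu> (\<lambda>x. Z (X k) x - Z l x) - 0) < d"
          using LIMSEQ_D[OF Zc d(1)] by blast
        then show "\<exists>n0. \<forall>k\<ge>n0. norm (\<nu> (\<lambda>x. K (Z (X k)) x - K (Z l) x) - 0) < e"
          using d(2)[OF ZV] nonneg[OF diff_mem[OF KZ(2) KZ(2)]] nonneg[OF diff_mem[OF ZV ZV]]
          by (intro exI[of _ n0]) simp
      qed
    qed
    have yc: "(\<lambda>k. \<nu> (\<lambda>x. K (Z (X k)) x - y j x)) \<longlonglongrightarrow> \<nu> (\<lambda>x. K (Z l) x - y j x)" if "j < m" for j
    proof (rule LIM_zero_cancel, rule Lim_null_comparison[OF always_eventually Kc], rule allI)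
      fix k
      show "norm (\<nu> (\<lambda>x. K (Z (X k)) x - y j x) - \<nu> (\<lambda>x. K (Z l) x - y j x))
          \<le> \<nu> (\<lambda>x. K (Z (X k)) x - K (Z l) x)"
        using le_diff[OF diff_mem diff_mem, of "K (Z (X k))" "y j" "K (Z l)" "y j"] KZ yV[OF that] by simp
    qed
    have "(\<lambda>k. t (K (Z (X k))) j) \<longlonglongrightarrow> t (K (Z l)) j" if "j < m" for j
      unfolding t_def by (intro tendsto_intros yc that)
    then show "(\<lambda>k. g (X k) i) \<longlonglongrightarrow> g l i"
      unfolding g_def using sum_pos[OF KZ(1), of l] \<open>i < m\<close> by (intro tendsto_intros) auto
  qed
  then obtain l where l: "\<And>i. i < m \<Longrightarrow> l i \<in> {0..1}" "\<And>i. i < m \<Longrightarrow> g l i = l i" by blast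
  \<comment> \<open>A fixed coefficient vector consists of normalised weights and so sums to 1; this
    allows \<open>K (Z l)\<close> to be moved under the sum.\<close>
  have "(\<Sum>i<m. l i) = (\<Sum>i<m. g l i)" using l by simp
  also have "\<dots> = 1"
    using sum_pos[OF KZ(1), of l] by (simp add: g_def flip: sum_divide_distrib)
  finally have l1: "(\<Sum>i<m. l i) = 1" .
  have "(\<lambda>x. K (Z l) x - Z l x) = (\<lambda>x. \<Sum>i<m. l i * (K (Z l) x - y i x))"
  proof
    fix x
    have "(\<Sum>i<m. l i * (K (Z l) x - y i x)) = (\<Sum>i<m. l i) * K (Z l) x - Z l x"
      by (simp add: Z_def right_diff_distrib sum_subtractf sum_distrib_right)
    then show "K (Z l) x - Z l x = (\<Sum>i<m. l i * (K (Z l) x - y i x))" using l1 by simp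
  qed
  then have "\<nu> (\<lambda>x. K (Z l) x - Z l x) \<le> (\<Sum>i<m. \<bar>l i\<bar> * \<nu> (\<lambda>x. K (Z l) x - y i x))"
    using combination[OF diff_mem[OF KZ(2) yV], where m=m and a=l] by simp
  also have "\<dots> \<le> (\<Sum>i<m. l i * \<eta>)"
  proof (rule sum_mono)
    fix i assume "i \<in> {..<m}"
    then have i: "i < m" by simp
    \<comment> \<open>A nonzero coefficient is a positive weight, which only a centre within \<eta>
      of \<open>K (Z l)\<close> can have.\<close>
    have "\<nu> (\<lambda>x. K (Z l) x - y i x) \<le> \<eta>" if "l i \<noteq> 0"
      using l(2)[OF i] that by (auto simp: g_def t_def max_def split: if_splits)
    then show "\<bar>l i\<bar> * \<nu> (\<lambda>x. K (Z l) x - y i x) \<le> l i * \<eta>"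
      using l(1)[OF i] by (cases "l i = 0") auto
  qed
  also have "\<dots> = \<eta>" using l1 by (simp flip: sum_distrib_right)
  finally show ?thesis using \<eta> ZV[of l] by (intro bexI[of _ "Z l"]) auto
qed

text \<open>Compactness enters through covers rather than through limits of approximate fixed
  points. Without a fixed point the displacement is bounded away from zero near every point, hence
  uniformly near \<open>C\<close>; an approximate fixed point is close to its image in
  \<open>C\<close> and violates this.\<close>

theorem schauder:
  assumes cont: "continuous_map (norm_topology V \<nu>) (norm_topology V \<nu>) K"
    and C: "compactin (norm_topology V \<nu>) C" and KC: "K ` V \<subseteq> C"
  shows "\<exists>u\<in>V. \<nu> (\<lambda>x. K u x - u x) = 0"
proof (rule ccontr)
  assume neg: "\<not> ?thesis"
  have CV: "C \<subseteq> V" using compactin_subset_topspace[OF C] by simp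
  have KV: "K v \<in> V" if "v \<in> V" for v using KC CV that by auto
  have "\<exists>d>0. \<forall>z\<in>V. \<nu> (\<lambda>x. z x - y x) < 2 * d \<longrightarrow> d \<le> \<nu> (\<lambda>x. K z x - z x)" if y: "y \<in> V" for y
  proof -
    \<comment> \<open>One third, because the path from \<open>K y\<close> over \<open>K z\<close>
      and \<open>z\<close> to \<open>y\<close> has three legs: the two outer ones are shorter than
      \<open>e\<close>, which leaves more than \<open>e\<close> for the displacement at
      \<open>z\<close>.\<close>
    define e where "e = \<nu> (\<lambda>x. K y x - y x) / 3"
    have e: "e > 0" using neg y nonneg[OF diff_mem[OF KV[OF y] y]] by (force simp: e_def)
    then obtain d where d: "d > 0"
      "\<And>v. v \<in> V \<Longrightarrow> \<nu> (\<lambda>x. v x - y x) < d \<Longrightarrow> \<nu> (\<lambda>x. K v x - K y x) < e"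
      using continuous_map_imp_continuous_at[OF cont y] by meson
    show ?thesis
    proof (intro exI conjI ballI impI)
      show "0 < min e d / 2" using e d by simp
      fix z assume z: "z \<in> V" "\<nu> (\<lambda>x. z x - y x) < 2 * (min e d / 2)"
      have "\<nu> (\<lambda>x. K z x - K y x) < e" using d z by simp
      then show "min e d / 2 \<le> \<nu> (\<lambda>x. K z x - z x)"
        using diff_triangle[of "K y" "K z" y] diff_triangle[of "K z" z y] diff_commute[of "K y" "K z"]
          KV[OF y] KV[OF z(1)] y z(1) z(2) e e_def by argo
    qed
  qed
  then obtain d where d: "\<And>y. y \<in> V \<Longrightarrow> d y > 0"
    "\<And>y z. y \<in> V \<Longrightarrow> z \<in> V \<Longrightarrow> \<nu> (\<lambda>x. z x - y x) < 2 * d y \<Longrightarrow> d y \<le> \<nu> (\<lambda>x. K z x - z x)"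
    by metis
  \<comment> \<open>Balls of radius \<open>d y\<close> cover \<open>C\<close>, while the lower bound
    holds out to \<open>2 * d y\<close>: it is \<open>K z\<close> that falls into a small ball, and
    \<open>z\<close> is less than a further \<open>d y\<close> away from \<open>K z\<close>.\<close>
  let ?B = "\<lambda>y. {v \<in> V. \<nu> (\<lambda>x. v x - y x) < d y}"
  have "\<forall>U\<in>?B ` C. openin (norm_topology V \<nu>) U"
    using CV openin_ball by blast
  moreover have "C \<subseteq> \<Union>(?B ` C)"
    using CV d(1) by (force simp: zero)
  ultimately have "\<exists>F. finite F \<and> F \<subseteq> ?B ` C \<and> C \<subseteq> \<Union>F"
    using C unfolding compactin_def by blast
  then obtain F' where F': "finite F'" "F' \<subseteq> ?B ` C" "C \<subseteq> \<Union>F'"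
    by blast
  obtain F where F: "finite F" "F \<subseteq> C" "C \<subseteq> (\<Union>y\<in>F. ?B y)"
    using finite_subset_image[OF F'(1,2)] F'(3) by auto
  have "C \<noteq> {}" using KC zero_mem by blast
  then have "F \<noteq> {}" using F by auto
  define \<epsilon> where "\<epsilon> = Min (d ` F)"
  have "\<epsilon> > 0" and \<epsilon>: "\<And>y. y \<in> F \<Longrightarrow> \<epsilon> \<le> d y"
    using F \<open>F \<noteq> {}\<close> CV d(1) by (auto simp: \<epsilon>_def)
  then obtain z where z: "z \<in> V" "\<nu> (\<lambda>x. K z x - z x) < \<epsilon>"
    using schauder_approximate[OF cont C KC] by blast
  then obtain y where y: "y \<in> F" "\<nu> (\<lambda>x. K z x - y x) < d y"
    using F KC by blast
  then have "y \<in> V" using F CV by auto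
  then have "\<nu> (\<lambda>x. z x - y x) < 2 * d y"
    using diff_triangle[of z "K z" y] diff_commute[of z "K z"] KV[OF z(1)] z y(2) \<epsilon>[OF y(1)]
    by argo
  then show False
    using d(2)[OF \<open>y \<in> V\<close> z(1)] z(2) \<epsilon>[OF y(1)] by argo
qed

section \<open>The radial retraction onto a ball\<close>

definition radial_retraction :: "real \<Rightarrow> ('b \<Rightarrow> real) \<Rightarrow> 'b \<Rightarrow> real" where
  "radial_retraction R u = (\<lambda>x. R / max R (\<nu> u) * u x)"

lemma radial_retraction_mem: "u \<in> V \<Longrightarrow> radial_retraction R u \<in> V"
  unfolding radial_retraction_def by (rule scale_mem)

lemma radial_retraction_le:
  assumes "R > 0" "u \<in> V"
  shows "\<nu> (radial_retraction R u) \<le> R"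
proof -
  have "\<bar>R / max R (\<nu> u)\<bar> * \<nu> u \<le> R"
    using assms nonneg[OF assms(2)] by (auto simp: max_def field_simps)
  then show ?thesis
    unfolding radial_retraction_def by (simp only: homogeneous[OF assms(2)])
qed

text \<open>The retraction has Lipschitz constant 2 for any seminorm: the change of the vector and
  the change of the factor each contribute at most the distance.\<close>

lemma continuous_map_radial_retraction:
  assumes "R > 0"
  shows "continuous_map (norm_topology V \<nu>) (norm_topology V \<nu>) (radial_retraction R)"
proof -
  let ?P = "radial_retraction R"
  have lip: "\<nu> (\<lambda>x. ?P v x - ?P u x) \<le> 2 * \<nu> (\<lambda>x. v x - u x)" if uv: "u \<in> V" "v \<in> V" for u v
  proof -
    define m k where "m = max R (\<nu> u)" and "k = max R (\<nu> v)"
    have mk: "m > 0" "k > 0" "R \<le> m" "R \<le> k" "\<nu> u \<le> m" "\<nu> u \<ge> 0"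
      using assms nonneg[OF uv(1)] by (auto simp: m_def k_def)
    have "\<bar>m - k\<bar> \<le> \<nu> (\<lambda>x. v x - u x)"
      using le_diff[of v u] uv by (auto simp: m_def k_def max_def)
    then have D: "\<bar>m - k\<bar> \<le> \<nu> (\<lambda>x. v x - u x)" .
    \<comment> \<open>The vector changes at the factor of \<open>v\<close>, then the factor changes
      at the vector \<open>u\<close>. The second part is controlled by
      \<open>\<nu> u \<le> m\<close>, \<open>R \<le> k\<close> and the bound on
      \<open>\<bar>m - k\<bar>\<close>.\<close>
    have "(\<lambda>x. ?P v x - ?P u x) = (\<lambda>x. R / k * (v x - u x) + (R / k - R / m) * u x)"
      unfolding radial_retraction_def m_def k_def by (auto simp only: algebra_simps)
    then have "\<nu> (\<lambda>x. ?P v x - ?P u x) \<le> \<bar>R / k\<bar> * \<nu> (\<lambda>x. v x - u x) + \<bar>R / k - R / m\<bar> * \<nu> u"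
      using triangle[OF scale_mem[OF diff_mem] scale_mem, of v u u "R / k" "R / k - R / m"] uv
      by (simp only: homogeneous[OF diff_mem] homogeneous)
    moreover have "\<bar>R / k\<bar> * \<nu> (\<lambda>x. v x - u x) \<le> 1 * \<nu> (\<lambda>x. v x - u x)"
      using mk assms nonneg[OF diff_mem] uv by (intro mult_right_mono) auto
    moreover have "\<bar>R / k - R / m\<bar> * \<nu> u \<le> 1 * (\<nu> (\<lambda>x. v x - u x))"
    proof -
      have "\<bar>R / k - R / m\<bar> * \<nu> u = (R / k) * (\<nu> u / m) * \<bar>m - k\<bar>"
      proof -
        have "R / k - R / m = R / k * (1 / m) * (m - k)"
          using mk by (simp add: divide_simps) (simp add: algebra_simps)
        then have "\<bar>R / k - R / m\<bar> = R / k * (1 / m) * \<bar>m - k\<bar>"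
          using mk assms by (simp add: abs_mult)
        then show ?thesis by simp
      qed
      also have "\<dots> \<le> 1 * 1 * \<nu> (\<lambda>x. v x - u x)"
        using mk assms D by (intro mult_mono) auto
      finally show ?thesis by simp
    qed
    ultimately show ?thesis by simp
  qed
  show ?thesis
    unfolding continuous_map_def
  proof (intro conjI allI impI)
    fix U assume "openin (norm_topology V \<nu>) U"
    then have U: "\<And>u. u \<in> U \<Longrightarrow> \<exists>\<epsilon>>0. \<forall>v\<in>V. \<nu> (\<lambda>x. v x - u x) < \<epsilon> \<longrightarrow> v \<in> U"
      by (auto simp: openin_norm_topology)
    show "openin (norm_topology V \<nu>) {u \<in> topspace (norm_topology V \<nu>). ?P u \<in> U}"
      unfolding openin_norm_topology
    proof (intro conjI ballI)
      fix u assume u: "u \<in> {u \<in> topspace (norm_topology V \<nu>). ?P u \<in> U}"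
      then obtain e where e: "e > 0" "\<And>v. v \<in> V \<Longrightarrow> \<nu> (\<lambda>x. v x - ?P u x) < e \<Longrightarrow> v \<in> U"
        using U by blast
      show "\<exists>\<epsilon>>0. \<forall>v\<in>V. \<nu> (\<lambda>x. v x - u x) < \<epsilon> \<longrightarrow> v \<in> {u \<in> topspace (norm_topology V \<nu>). ?P u \<in> U}"
      proof (intro exI conjI ballI impI)
        show "0 < e / 2" using e by simp
        fix v assume v: "v \<in> V" "\<nu> (\<lambda>x. v x - u x) < e / 2"
        then have "\<nu> (\<lambda>x. ?P v x - ?P u x) < e"
          using lip[of u v] u by auto
        then show "v \<in> {u \<in> topspace (norm_topology V \<nu>). ?P u \<in> U}"
          using v e(2)[OF radial_retraction_mem] by simp
      qed
    qed auto
  qed (auto intro: radial_retraction_mem)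
qed

end


section \<open>The Luxemburg norm\<close>

text \<open>For positive points this is convexity of the power; if one of them is 0 it reduces to
  \<open>t powr c \<le> t\<close> on the unit interval.\<close>

lemma powr_convex_nonneg:
  fixes a b s t c :: real
  assumes "c \<ge> 1" "a \<ge> 0" "b \<ge> 0" "s \<ge> 0" "t \<ge> 0" "s + t = 1"
  shows "(s * a + t * b) powr c \<le> s * a powr c + t * b powr c"
proof -
  have le: "(t * b) powr c \<le> t * b powr c" if "0 \<le> t" "t \<le> 1" "b \<ge> 0" for t b :: real
  proof -
    have "t powr c \<le> t"
      using powr_mono'[of 1 c t] that assms(1) by (cases "t = 0") auto
    then show ?thesis using that by (simp add: powr_mult mult_right_mono)
  qed
  consider "a = 0" | "b = 0" | "a > 0" "b > 0" using assms by fastforce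
  then show ?thesis
  proof cases
    case 3
    have "s = 1 - t" using assms by simp
    then show ?thesis
      using convex_onD[OF powr_convex[OF assms(1)], of t a b] assms 3
      by (simp add: \<open>s = 1 - t\<close>)
  qed (use le assms in auto)
qed

text \<open>\<open>N\<close> is a common upper bound of the exponents, which makes scaling constants
  uniform in \<open>x\<close>; it is later taken to be the dimension.\<close>

locale double_phase =
  fixes \<Omega> :: "'a::euclidean_space set" and p q \<mu> :: "'a \<Rightarrow> real" and N :: real
  assumes open_domain: "open \<Omega>" and bounded_domain: "bounded \<Omega>"
    and exponents_measurable [measurable]:
      "p \<in> borel_measurable (lebesgue_on \<Omega>)" "q \<in> borel_measurable (lebesgue_on \<Omega>)"
    and exponents_bounds: "\<And>x. x \<in> \<Omega> \<Longrightarrow> 1 < p x \<and> p x \<le> N \<and> 1 < q x \<and> q x \<le> N"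
    and weight: "\<mu> \<in> L_infty_nonneg \<Omega>"
begin

abbreviation "M \<equiv> lebesgue_on \<Omega>"
abbreviation "\<rho> \<equiv> rho_H \<Omega> p q \<mu>"
abbreviation "LH \<equiv> L_H \<Omega> p q \<mu>"
abbreviation "nH \<equiv> norm_H \<Omega> p q \<mu>"

lemma weight_measurable [measurable]: "\<mu> \<in> borel_measurable M"
  and weight_nonneg: "AE x in M. \<mu> x \<ge> 0"
  using weight by (auto simp: L_infty_nonneg_def)

lemma AE_M_I: "(\<And>x. x \<in> \<Omega> \<Longrightarrow> P x) \<Longrightarrow> AE x in M. P x"
  by (auto intro!: AE_I2 simp: space_restrict_space)

lemma exponents_bounds_AE: "AE x in M. 1 < p x \<and> p x \<le> N \<and> 1 < q x \<and> q x \<le> N"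
  by (rule AE_M_I) (rule exponents_bounds)

section \<open>The modular: monotonicity, convexity, scaling\<close>

lemma rho_mono:
  assumes "AE x in M. \<bar>u x\<bar> \<le> \<bar>v x\<bar>"
  shows "\<rho> u \<le> \<rho> v"
  unfolding rho_H_def
proof (rule nn_integral_mono_AE)
  show "AE x in M. ennreal (\<bar>u x\<bar> powr p x + \<mu> x * \<bar>u x\<bar> powr q x)
      \<le> ennreal (\<bar>v x\<bar> powr p x + \<mu> x * \<bar>v x\<bar> powr q x)"
    using assms weight_nonneg exponents_bounds_AE
    by eventually_elim (auto intro!: ennreal_leI add_mono mult_left_mono powr_mono2)
qed

lemma rho_zero: "\<rho> (\<lambda>_. 0) = 0"
  by (simp add: rho_H_def)

lemma rho_convex:
  assumes [measurable]: "u \<in> borel_measurable M" "v \<in> borel_measurable M"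
    and st: "s \<ge> 0" "t \<ge> 0" "s + t = 1"
  shows "\<rho> (\<lambda>x. s * u x + t * v x) \<le> ennreal s * \<rho> u + ennreal t * \<rho> v"
proof -
  have "\<rho> (\<lambda>x. s * u x + t * v x) \<le> (\<integral>\<^sup>+x. ennreal s * ennreal (\<bar>u x\<bar> powr p x + \<mu> x * \<bar>u x\<bar> powr q x)
      + ennreal t * ennreal (\<bar>v x\<bar> powr p x + \<mu> x * \<bar>v x\<bar> powr q x) \<partial>M)"
    unfolding rho_H_def
  proof (rule nn_integral_mono_AE)
    show "AE x in M. ennreal (\<bar>s * u x + t * v x\<bar> powr p x + \<mu> x * \<bar>s * u x + t * v x\<bar> powr q x)
      \<le> ennreal s * ennreal (\<bar>u x\<bar> powr p x + \<mu> x * \<bar>u x\<bar> powr q x)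
      + ennreal t * ennreal (\<bar>v x\<bar> powr p x + \<mu> x * \<bar>v x\<bar> powr q x)"
      using weight_nonneg exponents_bounds_AE
    proof eventually_elim
      case (elim x)
      have le: "\<bar>s * u x + t * v x\<bar> powr c \<le> s * \<bar>u x\<bar> powr c + t * \<bar>v x\<bar> powr c" if "c \<ge> 1" for c
      proof -
        have "\<bar>s * u x + t * v x\<bar> \<le> s * \<bar>u x\<bar> + t * \<bar>v x\<bar>"
          using st abs_triangle_ineq[of "s * u x" "t * v x"] by (simp add: abs_mult)
        then have "\<bar>s * u x + t * v x\<bar> powr c \<le> (s * \<bar>u x\<bar> + t * \<bar>v x\<bar>) powr c"
          using that by (intro powr_mono2) auto
        then show ?thesis
          using powr_convex_nonneg[OF that _ _ st, of "\<bar>u x\<bar>" "\<bar>v x\<bar>"] by simp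
      qed
      have "\<bar>s * u x + t * v x\<bar> powr p x + \<mu> x * \<bar>s * u x + t * v x\<bar> powr q x \<le>
        (s * \<bar>u x\<bar> powr p x + t * \<bar>v x\<bar> powr p x) + \<mu> x * (s * \<bar>u x\<bar> powr q x + t * \<bar>v x\<bar> powr q x)"
        using elim by (intro add_mono mult_left_mono le) auto
      also have "\<dots> = s * (\<bar>u x\<bar> powr p x + \<mu> x * \<bar>u x\<bar> powr q x) + t * (\<bar>v x\<bar> powr p x + \<mu> x * \<bar>v x\<bar> powr q x)"
        by (simp add: algebra_simps)
      finally show ?case
        using elim st by (subst (asm) ennreal_le_iff[symmetric]) (auto simp: ennreal_mult ennreal_plus)
    qed
  qed
  also have "\<dots> = ennreal s * \<rho> u + ennreal t * \<rho> v"
    by (simp add: rho_H_def nn_integral_add nn_integral_cmult)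
  finally show ?thesis .
qed

lemma rho_shrink:
  assumes "u \<in> borel_measurable M" "0 \<le> s" "s \<le> 1"
  shows "\<rho> (\<lambda>x. s * u x) \<le> ennreal s * \<rho> u"
  using rho_convex[OF assms(1), of "\<lambda>_. 0" s "1 - s"] assms by (simp add: rho_zero)

text \<open>The Delta-2 property: with bounded exponents one constant absorbs the factor
  \<open>c\<close>. It is the reason why the functions of finite modular form a vector
  space.\<close>

lemma rho_scale_finite:
  assumes [measurable]: "u \<in> borel_measurable M" and fin: "\<rho> u < \<infinity>"
  shows "\<rho> (\<lambda>x. c * u x) < \<infinity>"
proof -
  \<comment> \<open>Passing to \<open>max 1 \<bar>c\<bar>\<close> first makes the power monotone in
    the exponent, so that \<open>N\<close> is the worst case for small \<open>c\<close> as
    well.\<close>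
  define K where "K = max 1 \<bar>c\<bar> powr N"
  have "\<rho> (\<lambda>x. c * u x) \<le> (\<integral>\<^sup>+x. ennreal K * ennreal (\<bar>u x\<bar> powr p x + \<mu> x * \<bar>u x\<bar> powr q x) \<partial>M)"
    unfolding rho_H_def
  proof (rule nn_integral_mono_AE)
    show "AE x in M. ennreal (\<bar>c * u x\<bar> powr p x + \<mu> x * \<bar>c * u x\<bar> powr q x)
      \<le> ennreal K * ennreal (\<bar>u x\<bar> powr p x + \<mu> x * \<bar>u x\<bar> powr q x)"
      using weight_nonneg exponents_bounds_AE
    proof eventually_elim
      case (elim x)
      have le: "\<bar>c * u x\<bar> powr e \<le> K * \<bar>u x\<bar> powr e" if "1 < e" "e \<le> N" for e
      proof -
        have "\<bar>c\<bar> powr e \<le> max 1 \<bar>c\<bar> powr e" using that by (intro powr_mono2) auto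
        also have "\<dots> \<le> K" unfolding K_def using that by (intro powr_mono) auto
        finally show ?thesis by (simp add: abs_mult powr_mult mult_right_mono)
      qed
      have "\<bar>c * u x\<bar> powr p x + \<mu> x * \<bar>c * u x\<bar> powr q x \<le> K * \<bar>u x\<bar> powr p x + \<mu> x * (K * \<bar>u x\<bar> powr q x)"
        using elim by (intro add_mono mult_left_mono le) auto
      also have "\<dots> = K * (\<bar>u x\<bar> powr p x + \<mu> x * \<bar>u x\<bar> powr q x)" by (simp add: algebra_simps)
      finally show ?case
        by (subst ennreal_mult'[symmetric]) (auto simp: K_def intro: ennreal_leI)
    qed
  qed
  also have "\<dots> = ennreal K * \<rho> u"
    by (simp add: rho_H_def nn_integral_cmult)
  also have "\<dots> < \<infinity>" using fin by (simp add: ennreal_mult_less_top)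
  finally show ?thesis .
qed

lemma LH_measurable: "u \<in> LH \<Longrightarrow> u \<in> borel_measurable M"
  by (simp add: L_H_def)

lemma LH_scale: "u \<in> LH \<Longrightarrow> (\<lambda>x. c * u x) \<in> LH"
  using rho_scale_finite by (auto simp: L_H_def)

lemma LH_add:
  assumes "u \<in> LH" "v \<in> LH"
  shows "(\<lambda>x. u x + v x) \<in> LH"
proof -
  have [measurable]: "u \<in> borel_measurable M" "v \<in> borel_measurable M"
    using assms by (auto intro: LH_measurable)
  \<comment> \<open>Midpoint convexity at the doubled functions, whose modulars are finite by
    scaling.\<close>
  have "\<rho> (\<lambda>x. u x + v x) \<le> ennreal (1/2) * \<rho> (\<lambda>x. 2 * u x) + ennreal (1/2) * \<rho> (\<lambda>x. 2 * v x)"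
    using rho_convex[of "\<lambda>x. 2 * u x" "\<lambda>x. 2 * v x" "1/2" "1/2"] by simp
  also have "\<dots> < \<infinity>"
  proof -
    have "ennreal (1/2) * \<rho> (\<lambda>x. 2 * w x) < \<infinity>" if "w \<in> LH" for w
      using LH_scale[OF that, of 2] ennreal_less_top[of "1/2"]
      unfolding L_H_def infinity_ennreal_def ennreal_mult_less_top by simp
    then show ?thesis using assms by simp
  qed
  finally show ?thesis by (simp add: L_H_def)
qed

lemma LH_mono:
  assumes "v \<in> LH" "u \<in> borel_measurable M" "AE x in M. \<bar>u x\<bar> \<le> \<bar>v x\<bar>"
  shows "u \<in> LH"
  using assms rho_mono[OF assms(3)] by (auto simp: L_H_def intro: le_less_trans)

text \<open>Weight, exponents and the measure of the domain are all bounded. This is what places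
  test functions and the lengths of their gradients in the space.\<close>

lemma LH_bounded:
  assumes "u \<in> borel_measurable M" "AE x in M. \<bar>u x\<bar> \<le> B"
  shows "u \<in> LH"
proof -
  obtain C where C: "AE x in M. \<bar>\<mu> x\<bar> \<le> C"
    using weight by (auto simp: L_infty_nonneg_def)
  define K where "K = max 1 \<bar>B\<bar> powr N"
  have "\<rho> u \<le> (\<integral>\<^sup>+x. ennreal (K + \<bar>C\<bar> * K) \<partial>M)"
    unfolding rho_H_def
  proof (rule nn_integral_mono_AE)
    show "AE x in M. ennreal (\<bar>u x\<bar> powr p x + \<mu> x * \<bar>u x\<bar> powr q x) \<le> ennreal (K + \<bar>C\<bar> * K)"
      using weight_nonneg exponents_bounds_AE C assms(2)
    proof eventually_elim
      case (elim x)
      have le: "\<bar>u x\<bar> powr e \<le> K" if "1 < e" "e \<le> N" for e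
      proof -
        have "\<bar>u x\<bar> powr e \<le> max 1 \<bar>B\<bar> powr e" using that elim by (intro powr_mono2) auto
        also have "\<dots> \<le> K" unfolding K_def using that by (intro powr_mono) auto
        finally show ?thesis .
      qed
      show ?case
        using elim by (intro ennreal_leI add_mono mult_mono le) auto
    qed
  qed
  also have "\<dots> < \<infinity>"
  proof -
    have "emeasure M \<Omega> < \<infinity>"
      using emeasure_bounded_finite[OF bounded_domain] open_domain
      by (simp add: emeasure_restrict_space)
    then show ?thesis by (simp add: ennreal_mult_less_top)
  qed
  finally show ?thesis using assms(1) by (simp add: L_H_def)
qed

section \<open>The Luxemburg norm as a gauge\<close>

lemma nH_set_upward:
  assumes "u \<in> borel_measurable M" "0 < \<zeta>" "\<rho> (\<lambda>x. u x / \<zeta>) \<le> 1" "\<zeta> \<le> \<xi>"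
  shows "\<rho> (\<lambda>x. u x / \<xi>) \<le> 1"
proof -
  have "(\<lambda>x. u x / \<xi>) = (\<lambda>x. (\<zeta> / \<xi>) * (u x / \<zeta>))" using assms by auto
  then have "\<rho> (\<lambda>x. u x / \<xi>) \<le> ennreal (\<zeta> / \<xi>) * \<rho> (\<lambda>x. u x / \<zeta>)"
    using rho_shrink[of "\<lambda>x. u x / \<zeta>" "\<zeta> / \<xi>"] assms by simp
  also have "\<dots> \<le> 1 * 1"
    using assms by (intro mult_mono) (auto simp: ennreal_le_1)
  finally show ?thesis by simp
qed

lemma nH_set_nonempty:
  assumes "u \<in> LH"
  shows "\<exists>\<zeta>>0. \<rho> (\<lambda>x. u x / \<zeta>) \<le> 1"
proof -
  \<comment> \<open>By convexity the modular of \<open>u / \<zeta>\<close> is at most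
    \<open>\<rho> u / \<zeta>\<close> once \<open>\<zeta> \<ge> 1\<close>, so the modular itself is
    a suitable divisor.\<close>
  define \<zeta> where "\<zeta> = max 1 (enn2real (\<rho> u))"
  have u: "u \<in> borel_measurable M" "\<rho> u < \<infinity>" using assms by (auto simp: L_H_def)
  have "\<rho> (\<lambda>x. u x / \<zeta>) \<le> ennreal (1 / \<zeta>) * \<rho> u"
    using rho_shrink[OF u(1), of "1 / \<zeta>"] by (simp add: \<zeta>_def)
  also have "\<dots> = ennreal (1 / \<zeta> * enn2real (\<rho> u))"
    using u by (subst ennreal_mult) (auto simp: \<zeta>_def)
  also have "\<dots> \<le> 1"
    by (auto simp: \<zeta>_def max_def field_simps intro!: ennreal_leI[of _ 1, simplified])
  finally show ?thesis by (intro exI[of _ \<zeta>]) (simp add: \<zeta>_def)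
qed

lemma nH_set_bdd: "bdd_below {\<zeta>. \<zeta> > 0 \<and> \<rho> (\<lambda>x. u x / \<zeta>) \<le> 1}"
  by (rule bdd_belowI[of _ 0]) auto

lemma nH_le: "0 < \<zeta> \<Longrightarrow> \<rho> (\<lambda>x. u x / \<zeta>) \<le> 1 \<Longrightarrow> nH u \<le> \<zeta>"
  unfolding norm_H_def by (rule cInf_lower[OF _ nH_set_bdd]) auto

lemma nH_nonneg: "u \<in> LH \<Longrightarrow> 0 \<le> nH u"
  unfolding norm_H_def using nH_set_nonempty[of u] by (intro cInf_greatest) auto

lemma nH_less:
  assumes "u \<in> LH" "nH u < \<zeta>"
  shows "\<rho> (\<lambda>x. u x / \<zeta>) \<le> 1"
proof -
  obtain \<xi> where "\<xi> > 0" "\<rho> (\<lambda>x. u x / \<xi>) \<le> 1" "\<xi> < \<zeta>"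
    using cInf_lessD[of "{\<zeta>. \<zeta> > 0 \<and> \<rho> (\<lambda>x. u x / \<zeta>) \<le> 1}" \<zeta>] nH_set_nonempty[OF assms(1)] assms(2)
    by (auto simp: norm_H_def)
  then show ?thesis
    using nH_set_upward[OF LH_measurable[OF assms(1)]] by simp
qed

lemma nH_mono:
  assumes "v \<in> LH" "AE x in M. \<bar>u x\<bar> \<le> \<bar>v x\<bar>"
  shows "nH u \<le> nH v"
proof (rule field_le_epsilon)
  fix e :: real assume e: "e > 0"
  have pos: "nH v + e > 0" using nH_nonneg[OF assms(1)] e by simp
  have "\<rho> (\<lambda>x. u x / (nH v + e)) \<le> \<rho> (\<lambda>x. v x / (nH v + e))"
    using assms(2) pos by (intro rho_mono) (auto simp: divide_right_mono elim!: eventually_mono)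
  also have "\<dots> \<le> 1" using nH_less[OF assms(1)] e by simp
  finally show "nH u \<le> nH v + e" by (rule nH_le[OF pos])
qed

text \<open>Minkowski's argument: \<open>(u + v) / (a + b)\<close> is a convex combination of
  \<open>u / a\<close> and \<open>v / b\<close>. The radii exceed the norms slightly, because
  strictly above the infimum the modular is known to be at most 1.\<close>

lemma nH_triangle:
  assumes "u \<in> LH" "v \<in> LH"
  shows "nH (\<lambda>x. u x + v x) \<le> nH u + nH v"
proof (rule field_le_epsilon)
  fix e :: real assume e: "e > 0"
  define a b where "a = nH u + e / 2" and "b = nH v + e / 2"
  have ab: "a > 0" "b > 0" "\<rho> (\<lambda>x. u x / a) \<le> 1" "\<rho> (\<lambda>x. v x / b) \<le> 1"
    using nH_nonneg[OF assms(1)] nH_nonneg[OF assms(2)] nH_less[OF assms(1)] nH_less[OF assms(2)] e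
    by (auto simp: a_def b_def)
  have [measurable]: "u \<in> borel_measurable M" "v \<in> borel_measurable M"
    using assms by (auto intro: LH_measurable)
  have "(\<lambda>x. (u x + v x) / (a + b)) = (\<lambda>x. a / (a + b) * (u x / a) + b / (a + b) * (v x / b))"
    using ab by (simp add: add_divide_distrib)
  then have "\<rho> (\<lambda>x. (u x + v x) / (a + b))
      \<le> ennreal (a / (a + b)) * \<rho> (\<lambda>x. u x / a) + ennreal (b / (a + b)) * \<rho> (\<lambda>x. v x / b)"
    using rho_convex[of "\<lambda>x. u x / a" "\<lambda>x. v x / b" "a / (a + b)" "b / (a + b)"] ab
    by (simp flip: add_divide_distrib)
  also have "\<dots> \<le> ennreal (a / (a + b)) * 1 + ennreal (b / (a + b)) * 1"
    using ab by (intro add_mono mult_left_mono) auto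
  also have "\<dots> = 1"
    using ab by (simp flip: ennreal_plus add_divide_distrib)
  finally have "nH (\<lambda>x. u x + v x) \<le> a + b"
    using ab by (intro nH_le) auto
  then show "nH (\<lambda>x. u x + v x) \<le> nH u + nH v + e" by (simp add: a_def b_def)
qed

lemma nH_scale_le:
  assumes "u \<in> LH"
  shows "nH (\<lambda>x. c * u x) \<le> \<bar>c\<bar> * nH u"
proof (cases "c = 0")
  case True
  have "nH (\<lambda>_. 0) \<le> e" if "e > 0" for e
    using that by (intro nH_le) (auto simp: rho_zero)
  then show ?thesis using True field_le_epsilon[of "nH (\<lambda>_. 0)" 0] by simp
next
  case False
  show ?thesis
  proof (rule field_le_epsilon)
    fix e :: real assume e: "e > 0"
    define \<zeta> where "\<zeta> = nH u + e / \<bar>c\<bar>"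
    have \<zeta>: "\<zeta> > 0" "\<rho> (\<lambda>x. u x / \<zeta>) \<le> 1"
      using nH_nonneg[OF assms] nH_less[OF assms, of \<zeta>] e False by (auto simp: \<zeta>_def intro!: add_nonneg_pos)
    have "\<rho> (\<lambda>x. c * u x / (\<bar>c\<bar> * \<zeta>)) = \<rho> (\<lambda>x. u x / \<zeta>)"
      using False by (simp add: rho_H_def abs_mult)
    then have "nH (\<lambda>x. c * u x) \<le> \<bar>c\<bar> * \<zeta>"
      using \<zeta> False by (intro nH_le) auto
    also have "\<dots> = \<bar>c\<bar> * nH u + e" using False by (simp add: \<zeta>_def algebra_simps)
    finally show "nH (\<lambda>x. c * u x) \<le> \<bar>c\<bar> * nH u + e" .
  qed
qed

lemma nH_scale:
  assumes "u \<in> LH"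
  shows "nH (\<lambda>x. c * u x) = \<bar>c\<bar> * nH u"
proof (cases "c = 0")
  case True
  then show ?thesis
    using nH_scale_le[OF assms, of 0] nH_nonneg[OF LH_scale[OF assms, of 0]] by simp
next
  case False
  \<comment> \<open>The reverse inequality is the same estimate for the factor
    \<open>1 / c\<close>.\<close>
  have "nH u \<le> \<bar>1 / c\<bar> * nH (\<lambda>x. c * u x)"
    using nH_scale_le[OF LH_scale[OF assms, of c], of "1 / c"] False by simp
  then have "\<bar>c\<bar> * nH u \<le> nH (\<lambda>x. c * u x)" using False by (simp add: field_simps)
  then show ?thesis using nH_scale_le[OF assms, of c] by simp
qed

end


section \<open>Test functions\<close>

lemma frechet_derivative_eqI: "(f has_derivative f') (at x) \<Longrightarrow> frechet_derivative f (at x) = f'"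
  using frechet_derivative_at by fastforce

lemma Ck_add: "Ck k \<phi> \<Longrightarrow> Ck k \<psi> \<Longrightarrow> Ck k (\<lambda>x. \<phi> x + \<psi> x)"
proof (induction k arbitrary: \<phi> \<psi>)
  case 0
  then show ?case by (auto intro: continuous_intros)
next
  case (Suc k)
  have "((\<lambda>x. \<phi> x + \<psi> x) has_derivative
      (\<lambda>h. frechet_derivative \<phi> (at x) h + frechet_derivative \<psi> (at x) h)) (at x)" for x
    using Suc.prems by (intro has_derivative_add) (auto simp flip: frechet_derivative_works)
  note D = frechet_derivative_eqI[OF this]
  show ?case
    using Suc by (auto simp: D)
qed

lemma Ck_scale: "Ck k \<phi> \<Longrightarrow> Ck k (\<lambda>x. c * \<phi> x)"
proof (induction k arbitrary: \<phi>)
  case 0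
  then show ?case by (auto intro: continuous_intros)
next
  case (Suc k)
  have "((\<lambda>x. c * \<phi> x) has_derivative (\<lambda>h. c * frechet_derivative \<phi> (at x) h)) (at x)" for x
    using Suc.prems by (intro has_derivative_mult_right) (auto simp flip: frechet_derivative_works)
  note D = frechet_derivative_eqI[OF this]
  show ?case
    using Suc by (auto simp: D)
qed

lemma test_functionsI:
  assumes "\<And>k. Ck k \<phi>" "compact K" "K \<subseteq> \<Omega>" "\<And>x. \<phi> x \<noteq> 0 \<Longrightarrow> x \<in> K"
  shows "\<phi> \<in> test_functions \<Omega>"
proof -
  have "closure {x. \<phi> x \<noteq> 0} \<subseteq> K"
    using assms(4) compact_imp_closed[OF assms(2)] by (intro closure_minimal) auto
  then show ?thesis
    using assms compact_Int_closed[OF assms(2) closed_closure, of "{x. \<phi> x \<noteq> 0}"]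
    by (auto simp: test_functions_def Int_absorb1)
qed

text \<open>One compact set serves both the function and its derivative, since off the closed
  support the function is locally zero.\<close>

lemma test_functions_support:
  assumes "\<phi> \<in> test_functions \<Omega>"
  obtains K where "compact K" "K \<subseteq> \<Omega>" "\<And>x. \<phi> x \<noteq> 0 \<Longrightarrow> x \<in> K"
    "\<And>x b. frechet_derivative \<phi> (at x) b \<noteq> 0 \<Longrightarrow> x \<in> K"
proof (rule that)
  show "compact (closure {x. \<phi> x \<noteq> 0})" "closure {x. \<phi> x \<noteq> 0} \<subseteq> \<Omega>"
    using assms by (auto simp: test_functions_def)
  show "x \<in> closure {x. \<phi> x \<noteq> 0}" if "\<phi> x \<noteq> 0" for x
    using that subsetD[OF closure_subset, of x "{x. \<phi> x \<noteq> 0}"] by auto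
  show "x \<in> closure {x. \<phi> x \<noteq> 0}" if "frechet_derivative \<phi> (at x) b \<noteq> 0" for x b
  proof (rule ccontr)
    assume x: "x \<notin> closure {x. \<phi> x \<noteq> 0}"
    have "(\<phi> has_derivative (\<lambda>_. 0)) (at x)"
    proof (rule has_derivative_transform_within_open)
      show "((\<lambda>_. 0) has_derivative (\<lambda>_. 0)) (at x)" by simp
      show "open (- closure {x. \<phi> x \<noteq> 0})" "x \<in> - closure {x. \<phi> x \<noteq> 0}" using x by auto
      show "0 = \<phi> y" if "y \<in> - closure {x. \<phi> x \<noteq> 0}" for y
        using that subsetD[OF closure_subset, of y "{x. \<phi> x \<noteq> 0}"] by auto
    qed
    then show False using that by (simp add: frechet_derivative_eqI)
  qed
qed

lemma test_functions_Ck: "\<phi> \<in> test_functions \<Omega> \<Longrightarrow> Ck k \<phi>"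
  by (simp add: test_functions_def)

lemma test_functions_has_derivative:
  "\<phi> \<in> test_functions \<Omega> \<Longrightarrow> (\<phi> has_derivative frechet_derivative \<phi> (at x)) (at x)"
  using test_functions_Ck[of \<phi> \<Omega> "Suc 0"] by (simp flip: frechet_derivative_works)

lemma test_functions_continuous:
  assumes "\<phi> \<in> test_functions \<Omega>"
  shows "continuous_on UNIV \<phi>" "b \<in> Basis \<Longrightarrow> continuous_on UNIV (\<lambda>x. frechet_derivative \<phi> (at x) b)"
  using test_functions_Ck[OF assms, of 0] test_functions_Ck[OF assms, of "Suc 0"] by simp_all

lemma test_functions_zero: "(\<lambda>_. 0) \<in> test_functions \<Omega>"
proof (rule test_functionsI[of _ "{}"])
  show "Ck k (\<lambda>_::'a. 0)" for k
    by (induction k) (auto simp: frechet_derivative_const)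
qed auto

lemma test_functions_add:
  assumes "\<phi> \<in> test_functions \<Omega>" "\<psi> \<in> test_functions \<Omega>"
  shows "(\<lambda>x. \<phi> x + \<psi> x) \<in> test_functions \<Omega>"
proof -
  obtain K where K: "compact K" "K \<subseteq> \<Omega>" "\<And>x. \<phi> x \<noteq> 0 \<Longrightarrow> x \<in> K"
    by (rule test_functions_support[OF assms(1)]) blast
  obtain L where L: "compact L" "L \<subseteq> \<Omega>" "\<And>x. \<psi> x \<noteq> 0 \<Longrightarrow> x \<in> L"
    by (rule test_functions_support[OF assms(2)]) blast
  show ?thesis
  proof (rule test_functionsI[of _ "K \<union> L"])
    show "Ck k (\<lambda>x. \<phi> x + \<psi> x)" for k
      using assms[THEN test_functions_Ck] by (rule Ck_add)
    show "x \<in> K \<union> L" if "\<phi> x + \<psi> x \<noteq> 0" for x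
      using that K(3)[of x] L(3)[of x] by (cases "\<phi> x = 0") auto
  qed (use K L in auto)
qed

lemma test_functions_scale:
  assumes "\<phi> \<in> test_functions \<Omega>"
  shows "(\<lambda>x. c * \<phi> x) \<in> test_functions \<Omega>"
proof -
  obtain K where K: "compact K" "K \<subseteq> \<Omega>" "\<And>x. \<phi> x \<noteq> 0 \<Longrightarrow> x \<in> K"
    by (rule test_functions_support[OF assms]) blast
  show ?thesis
    by (rule test_functionsI[of _ K]) (use K Ck_scale[OF test_functions_Ck[OF assms]] in auto)
qed

section \<open>Smooth bump functions on boxes\<close>

definition flat_exp :: "nat \<Rightarrow> real \<Rightarrow> real" where
  "flat_exp k t = (if t > 0 then exp (- 1 / t) / t ^ k else 0)"

lemma flat_exp_bounds: "0 \<le> flat_exp k t" "flat_exp 0 t \<le> 1"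
  by (auto simp: flat_exp_def)

text \<open>With \<open>s = 1 / t\<close> the right-hand limit is that of
  \<open>s ^ k / exp s\<close> at infinity; to the left the function is identically 0.\<close>

lemma flat_exp_tendsto_0: "(flat_exp k \<longlongrightarrow> 0) (at 0)"
proof -
  have "((\<lambda>t::real. inverse t ^ k / exp (inverse t)) \<longlongrightarrow> 0) (at_right 0)"
    by (rule filterlim_compose[OF tendsto_power_div_exp_0 filterlim_inverse_at_top_right])
  then have "(flat_exp k \<longlongrightarrow> 0) (at_right 0)"
    by (rule Lim_transform_eventually)
      (auto simp: eventually_at_right_field flat_exp_def exp_minus field_simps intro!: exI[of _ 1])
  moreover have "(flat_exp k \<longlongrightarrow> 0) (at_left 0)"
    by (rule Lim_transform_eventually[OF tendsto_const])
      (auto simp: eventually_at_left_field flat_exp_def intro!: exI[of _ "-1"])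
  ultimately show ?thesis by (simp add: filterlim_at_split)
qed

text \<open>The index \<open>k\<close> is there to make the span of the family closed under
  differentiation. At 0 the difference quotient of one member is the next member, whose limit is
  0.\<close>

lemma flat_exp_has_derivative:
  "(flat_exp k has_real_derivative (- real k * flat_exp (Suc k) t + flat_exp (Suc (Suc k)) t)) (at t)"
proof -
  consider "t > 0" | "t < 0" | "t = 0" by linarith
  then show ?thesis
  proof cases
    case 1
    have "((\<lambda>t. exp (- 1 / t) / t ^ k) has_real_derivative
        (- real k * flat_exp (Suc k) t + flat_exp (Suc (Suc k)) t)) (at t)"
      using 1 by (auto intro!: derivative_eq_intros simp: flat_exp_def divide_simps)
        (cases k; simp add: algebra_simps)
    then show ?thesis
      by (rule has_field_derivative_transform_within_open[where S="{0<..}"])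
        (use 1 in \<open>auto simp: flat_exp_def\<close>)
  next
    case 2
    have "((\<lambda>_. 0) has_real_derivative (- real k * flat_exp (Suc k) t + flat_exp (Suc (Suc k)) t)) (at t)"
      using 2 by (simp add: flat_exp_def)
    then show ?thesis
      by (rule has_field_derivative_transform_within_open[where S="{..<0}"])
        (use 2 in \<open>auto simp: flat_exp_def\<close>)
  next
    case 3
    have "(\<lambda>h. (flat_exp k (0 + h) - flat_exp k 0) / h) = flat_exp (Suc k)"
      by (auto simp: flat_exp_def)
    then show ?thesis
      using 3 flat_exp_tendsto_0[of "Suc k"] unfolding DERIV_def by (simp add: flat_exp_def)
  qed
qed

lemma flat_exp_0_tendsto_1:
  assumes "t > 0"
  shows "(\<lambda>n. flat_exp 0 (real n * t)) \<longlonglongrightarrow> 1"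
proof -
  have "(\<lambda>n. exp (- (inverse (real n) * inverse t))) \<longlonglongrightarrow> exp (- (0 * inverse t))"
    by (intro tendsto_intros LIMSEQ_inverse_real_of_nat lim_inverse_n)
  moreover have "eventually (\<lambda>n. exp (- (inverse (real n) * inverse t)) = flat_exp 0 (real n * t)) sequentially"
    using eventually_gt_at_top[of 0]
    by eventually_elim (use assms in \<open>auto simp: flat_exp_def field_simps\<close>)
  ultimately show ?thesis by (simp add: Lim_transform_eventually)
qed

text \<open>An algebra of functions that is closed under partial derivatives, so that its members are smooth.\<close>

inductive flat_exp_algebra :: "('a::euclidean_space \<Rightarrow> real) \<Rightarrow> bool" where
  const: "flat_exp_algebra (\<lambda>_. c)"
| flat: "flat_exp_algebra (\<lambda>x. flat_exp k (c + d * (x \<bullet> e)))"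
| add: "flat_exp_algebra \<phi> \<Longrightarrow> flat_exp_algebra \<psi> \<Longrightarrow> flat_exp_algebra (\<lambda>x. \<phi> x + \<psi> x)"
| mult: "flat_exp_algebra \<phi> \<Longrightarrow> flat_exp_algebra \<psi> \<Longrightarrow> flat_exp_algebra (\<lambda>x. \<phi> x * \<psi> x)"

text \<open>Membership of the derivative is claimed for each fixed direction, the form in which
  \<open>Ck\<close> iterates partial derivatives.\<close>

lemma flat_exp_algebra_derivative:
  "flat_exp_algebra \<phi> \<Longrightarrow>
    \<exists>\<phi>'. (\<forall>x. (\<phi> has_derivative \<phi>' x) (at x)) \<and> (\<forall>b. flat_exp_algebra (\<lambda>x. \<phi>' x b))"
proof (induction rule: flat_exp_algebra.induct)
  case (const c)
  show ?case
    by (intro exI[of _ "\<lambda>_ _. 0"]) (auto intro: flat_exp_algebra.const)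
next
  case (flat k c d e)
  define s' where "s' t = - real k * flat_exp (Suc k) t + flat_exp (Suc (Suc k)) t" for t
  have "((\<lambda>x. flat_exp k (c + d * (x \<bullet> e))) has_derivative (\<lambda>h. s' (c + d * (x \<bullet> e)) * (d * (h \<bullet> e)))) (at x)" for x
  proof -
    have "((\<lambda>x. c + d * (x \<bullet> e)) has_derivative (\<lambda>h. d * (h \<bullet> e))) (at x)"
      by (auto intro!: derivative_eq_intros)
    then show ?thesis
      using has_derivative_compose[OF _ flat_exp_has_derivative[of k, unfolded has_field_derivative_def]]
      by (simp add: s'_def)
  qed
  moreover have "flat_exp_algebra (\<lambda>x. s' (c + d * (x \<bullet> e)) * (d * (h \<bullet> e)))" for h
    unfolding s'_def by (intro flat_exp_algebra.intros)
  ultimately show ?case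
    by (intro exI[of _ "\<lambda>x h. s' (c + d * (x \<bullet> e)) * (d * (h \<bullet> e))"]) auto
next
  case (add \<phi> \<psi>)
  then obtain f g where fg: "\<And>x. (\<phi> has_derivative f x) (at x)" "\<And>b. flat_exp_algebra (\<lambda>x. f x b)"
    "\<And>x. (\<psi> has_derivative g x) (at x)" "\<And>b. flat_exp_algebra (\<lambda>x. g x b)" by blast
  show ?case
    by (intro exI[of _ "\<lambda>x h. f x h + g x h"] conjI allI has_derivative_add flat_exp_algebra.add fg)
next
  case (mult \<phi> \<psi>)
  then obtain f g where fg: "\<And>x. (\<phi> has_derivative f x) (at x)" "\<And>b. flat_exp_algebra (\<lambda>x. f x b)"
    "\<And>x. (\<psi> has_derivative g x) (at x)" "\<And>b. flat_exp_algebra (\<lambda>x. g x b)" by blast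
  show ?case
    by (intro exI[of _ "\<lambda>x h. \<phi> x * g x h + f x h * \<psi> x"] conjI allI has_derivative_mult
        flat_exp_algebra.add flat_exp_algebra.mult fg mult.hyps)
qed

lemma flat_exp_algebra_Ck: "flat_exp_algebra \<phi> \<Longrightarrow> Ck k \<phi>"
proof (induction k arbitrary: \<phi>)
  case 0
  then obtain f where "\<And>x. (\<phi> has_derivative f x) (at x)"
    using flat_exp_algebra_derivative by blast
  then show ?case
    by (auto simp: continuous_on_eq_continuous_at intro: has_derivative_continuous)
next
  case (Suc k)
  obtain f where f: "\<And>x. (\<phi> has_derivative f x) (at x)" "\<And>b. flat_exp_algebra (\<lambda>x. f x b)"
    using flat_exp_algebra_derivative[OF Suc.prems] by blast
  have "\<phi> differentiable (at x)" for x
    using f(1)[of x] unfolding differentiable_def by blast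
  then show ?case
    using Suc.IH[OF f(2)] by (simp add: frechet_derivative_eqI[OF f(1)])
qed

text \<open>Each factor tests the signed distance to one face, steepened by \<open>n\<close>, so
  that the limit is the indicator of the open box.\<close>

definition box_bump :: "'a::euclidean_space \<Rightarrow> 'a \<Rightarrow> nat \<Rightarrow> 'a \<Rightarrow> real" where
  "box_bump a b n x = (\<Prod>i\<in>Basis. flat_exp 0 (real n * (x \<bullet> i - a \<bullet> i)) * flat_exp 0 (real n * (b \<bullet> i - x \<bullet> i)))"

lemma box_bump_bounds: "0 \<le> box_bump a b n x" "box_bump a b n x \<le> 1"
proof -
  have f: "0 \<le> flat_exp 0 s * flat_exp 0 t \<and> flat_exp 0 s * flat_exp 0 t \<le> 1" for s t
    by (simp add: flat_exp_bounds mult_le_one)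
  show "0 \<le> box_bump a b n x" "box_bump a b n x \<le> 1"
    unfolding box_bump_def using f by (blast intro: prod_nonneg prod_le_1)+
qed

lemma box_bump_eq_0: "x \<notin> box a b \<Longrightarrow> box_bump a b n x = 0"
proof -
  assume "x \<notin> box a b"
  then obtain i where i: "i \<in> Basis" "x \<bullet> i - a \<bullet> i \<le> 0 \<or> b \<bullet> i - x \<bullet> i \<le> 0"
    by (auto simp: mem_box not_less)
  then have "real n * (x \<bullet> i - a \<bullet> i) \<le> 0 \<or> real n * (b \<bullet> i - x \<bullet> i) \<le> 0"
    by (auto intro: mult_nonneg_nonpos)
  then have "flat_exp 0 (real n * (x \<bullet> i - a \<bullet> i)) * flat_exp 0 (real n * (b \<bullet> i - x \<bullet> i)) = 0"
    unfolding flat_exp_def by (elim disjE) simp_all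
  then show ?thesis
    unfolding box_bump_def using i(1) by (intro prod_zero finite_Basis bexI)
qed

lemma box_bump_tendsto: "(\<lambda>n. box_bump a b n x) \<longlonglongrightarrow> indicator (box a b) x"
proof (cases "x \<in> box a b")
  case True
  then have "(\<lambda>n. box_bump a b n x) \<longlonglongrightarrow> (\<Prod>i\<in>(Basis::'a set). 1 * 1)"
    unfolding box_bump_def
    by (intro tendsto_prod tendsto_mult flat_exp_0_tendsto_1) (auto simp: mem_box)
  then show ?thesis using True by simp
qed (simp add: box_bump_eq_0)

lemma box_bump_test_function:
  assumes "cbox a b \<subseteq> \<Omega>"
  shows "box_bump a b n \<in> test_functions \<Omega>"
proof (rule test_functionsI[OF _ compact_cbox assms])
  have "flat_exp_algebra (\<lambda>x. \<Prod>i\<in>I. flat_exp 0 (real n * (x \<bullet> i - a \<bullet> i)) * flat_exp 0 (real n * (b \<bullet> i - x \<bullet> i)))"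
    if "finite I" for I
    using that
  proof induction
    case (insert i I)
    \<comment> \<open>The signed distances are first put into the affine form
      \<open>c + d * (x \<bullet> e)\<close> that generates the algebra.\<close>
    have "flat_exp_algebra (\<lambda>x. flat_exp 0 (- real n * (a \<bullet> i) + real n * (x \<bullet> i)) *
        flat_exp 0 (real n * (b \<bullet> i) + (- real n) * (x \<bullet> i)))"
      by (intro flat_exp_algebra.intros)
    also have "(\<lambda>x. flat_exp 0 (- real n * (a \<bullet> i) + real n * (x \<bullet> i)) *
        flat_exp 0 (real n * (b \<bullet> i) + (- real n) * (x \<bullet> i))) =
        (\<lambda>x. flat_exp 0 (real n * (x \<bullet> i - a \<bullet> i)) * flat_exp 0 (real n * (b \<bullet> i - x \<bullet> i)))"
      by (simp add: right_diff_distrib)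
    finally show ?case
      using flat_exp_algebra.mult[OF _ insert.IH] by (simp only: prod.insert[OF insert.hyps])
  qed (simp add: flat_exp_algebra.const)
  then show "Ck k (box_bump a b n)" for k
    unfolding box_bump_def by (intro flat_exp_algebra_Ck) simp
  show "x \<in> cbox a b" if "box_bump a b n x \<noteq> 0" for x
    using that box_bump_eq_0[of x a b n] subsetD[OF box_subset_cbox, of x a b] by blast
qed


section \<open>The fundamental lemma of the calculus of variations\<close>

text \<open>As \<open>ennreal\<close> sends negative numbers to 0, the positive and negative parts
  of \<open>g\<close> are the densities of two finite measures. These agree on open boxes, an
  intersection-stable generator of the Borel sets, hence everywhere, and densities are unique
  a.e.\<close>

lemma AE_zero_if_box_integrals_zero:
  fixes g :: "'a::euclidean_space \<Rightarrow> real"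
  assumes g: "integrable lborel g"
    and zero: "\<And>a b. (\<integral>x. indicator (box a b) x * g x \<partial>lborel) = 0"
  shows "AE x in lborel. g x = 0"
proof -
  have [measurable]: "g \<in> borel_measurable borel" using borel_measurable_integrable[OF g] by simp
  let ?P = "density lborel (\<lambda>x. ennreal (g x))" and ?Q = "density lborel (\<lambda>x. ennreal (- g x))"
  have fin: "(\<integral>\<^sup>+x. ennreal (g x) \<partial>lborel) \<noteq> \<infinity>" "(\<integral>\<^sup>+x. ennreal (- g x) \<partial>lborel) \<noteq> \<infinity>"
    using g by (auto simp: real_integrable_def)
  have P: "emeasure ?P A = (\<integral>\<^sup>+x. ennreal (indicator A x * g x) \<partial>lborel)"
    and Q: "emeasure ?Q A = (\<integral>\<^sup>+x. ennreal (- (indicator A x * g x)) \<partial>lborel)" if "A \<in> sets borel" for A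
    using that by (auto simp: emeasure_density intro!: nn_integral_cong split: split_indicator)
  have finP: "emeasure ?P A \<noteq> \<infinity>" if "A \<in> sets borel" for A
  proof -
    have "emeasure ?P A \<le> emeasure ?P UNIV" using that by (intro emeasure_mono) auto
    also have "\<dots> < \<infinity>" using fin by (simp add: emeasure_density less_top)
    finally show ?thesis by simp
  qed
  have finQ: "emeasure ?Q A \<noteq> \<infinity>" if "A \<in> sets borel" for A
  proof -
    have "emeasure ?Q A \<le> emeasure ?Q UNIV" using that by (intro emeasure_mono) auto
    also have "\<dots> < \<infinity>" using fin by (simp add: emeasure_density less_top)
    finally show ?thesis by simp
  qed
  have "?P = ?Q"
  proof (rule measure_eqI_generator_eq)
    show "Int_stable (range (\<lambda>(a, b). box a b :: 'a set))"
      by (auto simp: Int_stable_def box_Int_box)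
    fix X assume "X \<in> range (\<lambda>(a, b). box a b :: 'a set)"
    then obtain a b where X: "X = box a b" by auto
    have "integrable lborel (\<lambda>x. indicator X x * g x)"
      using integrable_mult_indicator[OF _ g, of X] X by simp
    then have "enn2real (emeasure ?P X) = enn2real (emeasure ?Q X)"
      using zero[of a b] by (simp add: real_lebesgue_integral_def X P Q)
    then show "emeasure ?P X = emeasure ?Q X"
      using finP[of X] finQ[of X] X by (metis borel_open ennreal_enn2real_if infinity_ennreal_def open_box)
  next
    show "(\<Union>i::nat. box (- (real i *\<^sub>R One)) (real i *\<^sub>R One)) = (UNIV :: 'a set)"
      by (rule UN_box_eq_UNIV)
    show "emeasure ?P (box (- (real i *\<^sub>R One)) (real i *\<^sub>R One)) \<noteq> \<infinity>" for i :: nat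
      by (rule finP) simp
  qed (auto simp: borel_eq_box)
  then have "AE x in lborel. ennreal (g x) = ennreal (- g x)"
    by (intro sigma_finite_measure.density_unique[OF sigma_finite_lborel]) auto
  \<comment> \<open>At every point one of the two sides is 0, so their equality makes both
    vanish.\<close>
  then show ?thesis
  proof eventually_elim
    case (elim x)
    show ?case
    proof (cases "g x \<le> 0")
      case True
      then have "ennreal (- g x) = 0" using elim by (simp add: ennreal_neg)
      then show ?thesis using True by (simp add: ennreal_eq_0_iff)
    next
      case False
      then have "ennreal (g x) = 0" using elim by (simp add: ennreal_neg)
      then show ?thesis using False by (simp add: ennreal_eq_0_iff)
    qed
  qed
qed

section \<open>Local integrability and the fundamental lemma\<close>

lemma borel_measurable_lebesgue_on:
  fixes f :: "'a::euclidean_space \<Rightarrow> 'b::topological_space"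
  shows "f \<in> borel_measurable borel \<Longrightarrow> f \<in> borel_measurable (lebesgue_on \<Omega>)"
  by (intro measurable_restrict_space1 measurable_completion) simp

lemma open_in_lebesgue: "open (S :: 'a::euclidean_space set) \<Longrightarrow> S \<in> sets lebesgue"
  by auto

lemma AE_lebesgue_on_iff:
  "open (\<Omega> :: 'a::euclidean_space set) \<Longrightarrow> (AE x in lebesgue_on \<Omega>. P x) \<longleftrightarrow> (AE x in lebesgue. x \<in> \<Omega> \<longrightarrow> P x)"
  by (rule AE_restrict_space_iff) (auto simp: open_in_lebesgue)

lemma locally_integrable_measurable:
  "locally_integrable \<Omega> u \<Longrightarrow> u \<in> borel_measurable (lebesgue_on \<Omega>)"
  by (simp add: locally_integrable_def)

lemma locally_integrable_integrable_on:
  assumes "open \<Omega>" "locally_integrable \<Omega> u" "compact K" "K \<subseteq> \<Omega>"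
  shows "integrable (lebesgue_on \<Omega>) (\<lambda>x. indicator K x *\<^sub>R u x)"
proof -
  have "(\<lambda>x. indicator \<Omega> x *\<^sub>R (indicator K x *\<^sub>R u x)) = (\<lambda>x. indicator K x *\<^sub>R u x)"
    using assms(4) by (auto simp: fun_eq_iff indicator_def)
  then show ?thesis
    using assms by (subst integrable_restrict_space)
      (auto simp: open_in_lebesgue locally_integrable_def set_integrable_def)
qed

lemma continuous_compact_support_bounded:
  fixes \<psi> :: "'a::euclidean_space \<Rightarrow> real"
  assumes "continuous_on UNIV \<psi>" "compact K" "\<And>x. \<psi> x \<noteq> 0 \<Longrightarrow> x \<in> K"
  obtains B where "B \<ge> 0" "\<And>x. \<bar>\<psi> x\<bar> \<le> B"
proof -
  have "bounded (\<psi> ` K)"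
    using assms by (intro compact_imp_bounded compact_continuous_image continuous_on_subset[OF assms(1)]) auto
  then obtain B where "\<And>x. x \<in> K \<Longrightarrow> \<bar>\<psi> x\<bar> \<le> B" by (auto simp: bounded_iff)
  then have "\<bar>\<psi> x\<bar> \<le> \<bar>B\<bar>" for x using assms(3)[of x] by (cases "\<psi> x = 0") fastforce+
  then show ?thesis using that[of "\<bar>B\<bar>"] by simp
qed

lemma locally_integrable_mult_continuous:
  assumes "open \<Omega>" and u: "locally_integrable \<Omega> (u :: 'a::euclidean_space \<Rightarrow> real)"
    and \<psi>: "continuous_on UNIV \<psi>" and K: "compact K" "K \<subseteq> \<Omega>" "\<And>x. \<psi> x \<noteq> 0 \<Longrightarrow> x \<in> K"
  shows "integrable (lebesgue_on \<Omega>) (\<lambda>x. u x * \<psi> x)"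
proof -
  obtain B where B: "B \<ge> 0" "\<And>x. \<bar>\<psi> x\<bar> \<le> B"
    using continuous_compact_support_bounded[OF \<psi> K(1,3)] by blast
  have [measurable]: "u \<in> borel_measurable (lebesgue_on \<Omega>)" "\<psi> \<in> borel_measurable (lebesgue_on \<Omega>)"
    using u \<psi> by (auto intro: locally_integrable_measurable borel_measurable_lebesgue_on borel_measurable_continuous_onI)
  show ?thesis
  proof (rule Bochner_Integration.integrable_bound)
    show "integrable (lebesgue_on \<Omega>) (\<lambda>x. B *\<^sub>R (indicator K x *\<^sub>R u x))"
      using locally_integrable_integrable_on[OF assms(1,2) K(1,2)] by (rule integrable_scaleR_right)
    show "AE x in lebesgue_on \<Omega>. norm (u x * \<psi> x) \<le> norm (B *\<^sub>R (indicator K x *\<^sub>R u x))"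
    proof (rule AE_I2)
      fix x
      show "norm (u x * \<psi> x) \<le> norm (B *\<^sub>R (indicator K x *\<^sub>R u x))"
      proof (cases "\<psi> x = 0")
        case False
        then show ?thesis
          using K(3)[of x] B mult_right_mono[OF B(2)[of x], of "\<bar>u x\<bar>"] by (simp add: abs_mult mult.commute)
      qed simp
    qed
  qed measurable
qed

text \<open>The smooth bumps tend boundedly to the indicator of a box, so all box integrals vanish.\<close>

lemma fundamental_lemma_calculus_of_variations:
  assumes "open \<Omega>" and w: "locally_integrable \<Omega> (w :: 'a::euclidean_space \<Rightarrow> real)"
    and zero: "\<And>\<phi>. \<phi> \<in> test_functions \<Omega> \<Longrightarrow> (\<integral>x. w x * \<phi> x \<partial>lebesgue_on \<Omega>) = 0"
  shows "AE x in lebesgue_on \<Omega>. w x = 0"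
proof -
  have [measurable]: "w \<in> borel_measurable (lebesgue_on \<Omega>)"
    using w by (rule locally_integrable_measurable)
  have box_zero: "(\<integral>x. indicator (box a b) x * w x \<partial>lebesgue) = 0" if ab: "cbox a b \<subseteq> \<Omega>" for a b
  proof -
    have sub: "box a b \<subseteq> \<Omega>" using ab box_subset_cbox by blast
    have "(\<lambda>n. \<integral>x. w x * box_bump a b n x \<partial>lebesgue_on \<Omega>) \<longlonglongrightarrow> (\<integral>x. indicator (box a b) x * w x \<partial>lebesgue_on \<Omega>)"
    proof (rule integral_dominated_convergence)
      have [measurable]: "indicat_real (box a b) \<in> borel_measurable (lebesgue_on \<Omega>)"
        by (rule borel_measurable_lebesgue_on) simp
      show "(\<lambda>x. indicator (box a b) x * w x) \<in> borel_measurable (lebesgue_on \<Omega>)"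
        by measurable
      show "(\<lambda>x. w x * box_bump a b n x) \<in> borel_measurable (lebesgue_on \<Omega>)" for n
      proof -
        have [measurable]: "box_bump a b n \<in> borel_measurable (lebesgue_on \<Omega>)"
          using test_functions_continuous(1)[OF box_bump_test_function[OF ab]]
          by (intro borel_measurable_lebesgue_on borel_measurable_continuous_onI)
        show ?thesis by measurable
      qed
      show "integrable (lebesgue_on \<Omega>) (\<lambda>x. norm (indicator (cbox a b) x *\<^sub>R w x))"
        using locally_integrable_integrable_on[OF assms(1) w compact_cbox ab] by (rule integrable_norm)
      show "AE x in lebesgue_on \<Omega>. (\<lambda>n. w x * box_bump a b n x) \<longlonglongrightarrow> indicator (box a b) x * w x"
      proof (rule AE_I2)
        fix x
        show "(\<lambda>n. w x * box_bump a b n x) \<longlonglongrightarrow> indicator (box a b) x * w x"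
          using tendsto_mult[OF tendsto_const box_bump_tendsto, of "w x" a b x] by (simp add: mult.commute)
      qed
      show "AE x in lebesgue_on \<Omega>. norm (w x * box_bump a b n x) \<le> norm (indicator (cbox a b) x *\<^sub>R w x)" for n
      proof (rule AE_I2)
        fix x
        show "norm (w x * box_bump a b n x) \<le> norm (indicator (cbox a b) x *\<^sub>R w x)"
        proof (cases "x \<in> box a b")
          case True
          then show ?thesis
            using box_bump_bounds[of a b n x] mult_left_mono[OF box_bump_bounds(2)[of a b n x], of "\<bar>w x\<bar>"]
              subsetD[OF box_subset_cbox True] by (simp add: abs_mult)
        qed (simp add: box_bump_eq_0)
      qed
    qed
    then have "(\<integral>x. indicator (box a b) x * w x \<partial>lebesgue_on \<Omega>) = 0"
      using zero[OF box_bump_test_function[OF ab]] by (simp add: LIMSEQ_const_iff)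
    moreover have "(\<lambda>x. indicator \<Omega> x *\<^sub>R (indicator (box a b) x * w x)) = (\<lambda>x. indicator (box a b) x * w x)"
      using sub by (auto simp: fun_eq_iff indicator_def)
    ultimately show ?thesis
      using integral_restrict_space[of \<Omega> lebesgue "\<lambda>x. indicator (box a b) x * w x"] assms(1)
      by (simp add: open_in_lebesgue)
  qed
  \<comment> \<open>Restricted to a box, \<open>w\<close> is integrable; it is then replaced by a
    Borel function equal to it a.e., to which the uniqueness of measures applies.\<close>
  have cbox_zero: "AE x in lebesgue. x \<in> cbox c d \<longrightarrow> w x = 0" if cd: "cbox c d \<subseteq> \<Omega>" for c d
  proof -
    define W where "W x = indicator (box c d) x * w x" for x
    have "integrable lebesgue (\<lambda>x. indicator (box c d) x *\<^sub>R (indicator (cbox c d) x *\<^sub>R w x))"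
    proof (rule integrable_mult_indicator)
      show "integrable lebesgue (\<lambda>x. indicator (cbox c d) x *\<^sub>R w x)"
        using w compact_cbox[of c d] cd unfolding locally_integrable_def set_integrable_def by blast
    qed simp
    also have "(\<lambda>x. indicator (box c d) x *\<^sub>R (indicator (cbox c d) x *\<^sub>R w x)) = W"
      using box_subset_cbox[of c d] by (auto simp: fun_eq_iff W_def indicator_def)
    finally have W: "integrable lebesgue W" .
    obtain g where g[measurable]: "g \<in> borel_measurable lborel" and Wg: "AE x in lborel. W x = g x"
      using completion_ex_borel_measurable_real[OF borel_measurable_integrable[OF W]] by blast
    have Wg': "AE x in lebesgue. W x = g x" using Wg by (rule AE_completion)
    have "integrable lebesgue g"
      using W integrable_cong_AE[OF borel_measurable_integrable[OF W] _ Wg'] g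
      by (simp add: measurable_completion)
    then have gi: "integrable lborel g" using g by (simp add: integrable_completion)
    have "AE x in lborel. g x = 0"
    proof (rule AE_zero_if_box_integrals_zero[OF gi])
      fix a b :: 'a
      \<comment> \<open>Intersections of boxes are boxes, so integrals of the localised function
        over arbitrary boxes are integrals of \<open>w\<close> over boxes inside
        \<open>box c d\<close>.\<close>
      obtain a' b' where ab': "box a b \<inter> box c d = box a' b'" by (simp add: box_Int_box)
      have "(\<integral>x. indicator (box a b) x * g x \<partial>lborel) = (\<integral>x. indicator (box a b) x * g x \<partial>lebesgue)"
        by (rule integral_completion[symmetric]) simp
      also have "\<dots> = (\<integral>x. indicator (box a b) x * W x \<partial>lebesgue)"
      proof (rule integral_cong_AE)
        show "(\<lambda>x. indicator (box a b) x * W x) \<in> borel_measurable lebesgue"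
          by (intro borel_measurable_times borel_measurable_indicator borel_measurable_integrable[OF W]) simp
        show "(\<lambda>x. indicator (box a b) x * g x) \<in> borel_measurable lebesgue"
          by (rule measurable_completion) simp
        show "AE x in lebesgue. indicator (box a b) x * g x = indicator (box a b) x * W x"
          using Wg' by eventually_elim simp
      qed
      also have "\<dots> = (\<integral>x. indicator (box a' b') x * w x \<partial>lebesgue)"
        unfolding W_def ab'[symmetric] by (intro Bochner_Integration.integral_cong) (auto split: split_indicator)
      also have "\<dots> = 0"
      proof (cases "box a' b' = {}")
        case False
        have "box a' b' \<subseteq> box c d" using ab' by blast
        moreover have "box c d \<noteq> {}" using calculation False by blast
        \<comment> \<open>Nonemptiness matters here: the closed box is the closure of the open one
          only then, and a degenerate closed box could stick out of \<open>cbox c d\<close>.\<close>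
        ultimately have "cbox a' b' \<subseteq> cbox c d"
          using closure_mono[of "box a' b'" "box c d"] False by (simp add: closure_box)
        then show ?thesis using box_zero cd by blast
      qed simp
      finally show "(\<integral>x. indicator (box a b) x * g x \<partial>lborel) = 0" .
    qed
    then have g0: "AE x in lebesgue. g x = 0" by (rule AE_completion)
    \<comment> \<open>The localisation used the open box; its boundary is a null set.\<close>
    have null: "AE x in lebesgue. x \<notin> cbox c d - box c d"
      using AE_not_in[OF null_sets_cbox_Diff_box[of c d]] by (rule AE_completion)
    show ?thesis
      using Wg' g0 null by eventually_elim (auto simp: W_def split: split_indicator_asm)
  qed
  \<comment> \<open>Countably many closed boxes fill the open set, so their exceptional sets
    together remain null.\<close>
  obtain \<D> where \<D>: "countable \<D>" "\<D> \<subseteq> Pow \<Omega>" "\<And>X. X \<in> \<D> \<Longrightarrow> \<exists>a b. X = cbox a b" "\<Union>\<D> = \<Omega>"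
    using open_countable_Union_open_cbox[OF assms(1)] by metis
  have "AE x in lebesgue. \<forall>X\<in>\<D>. x \<in> X \<longrightarrow> w x = 0"
  proof (rule AE_ball_countable'[OF _ \<D>(1)])
    fix X assume X: "X \<in> \<D>"
    then obtain a b where "X = cbox a b" using \<D>(3) by blast
    then show "AE x in lebesgue. x \<in> X \<longrightarrow> w x = 0"
      using cbox_zero[of a b] \<D>(2) X by blast
  qed
  then have "AE x in lebesgue. x \<in> \<Omega> \<longrightarrow> w x = 0"
    by eventually_elim (use \<D>(4) in blast)
  then show ?thesis using AE_lebesgue_on_iff[OF assms(1)] by blast
qed

text \<open>Difference quotients in direction \<open>b\<close> have integral 0 by translation
  invariance, and they converge to the derivative, bounded and supported in a fixed ball.\<close>

lemma integral_partial_derivative_zero: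
  fixes \<theta> :: "'a::euclidean_space \<Rightarrow> real"
  assumes D: "\<And>x. (\<theta> has_derivative \<theta>' x) (at x)" and cont: "continuous_on UNIV (\<lambda>x. \<theta>' x b)"
    and K: "compact K" "\<And>x. \<theta> x \<noteq> 0 \<Longrightarrow> x \<in> K" "\<And>x. \<theta>' x b \<noteq> 0 \<Longrightarrow> x \<in> K"
  shows "(\<integral>x. \<theta>' x b \<partial>lborel) = 0"
proof -
  have c\<theta>: "continuous_on UNIV \<theta>"
    using D by (auto simp: continuous_on_eq_continuous_at intro: has_derivative_continuous)
  obtain B where B: "B \<ge> 0" "\<And>x. \<bar>\<theta>' x b\<bar> \<le> B"
    using continuous_compact_support_bounded[OF cont K(1,3)] by blast
  obtain R where R: "\<And>x. x \<in> K \<Longrightarrow> norm x \<le> R"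
    using compact_imp_bounded[OF K(1)] by (auto simp: bounded_iff)
  define h where "h n = inverse (real (Suc n))" for n
  have h: "0 < h n" "h n \<le> 1" for n by (auto simp: h_def field_simps)
  define F where "F n x = (\<theta> (x + h n *\<^sub>R b) - \<theta> x) / h n" for n x
  have [measurable]: "\<theta> \<in> borel_measurable borel" "(\<lambda>x. \<theta>' x b) \<in> borel_measurable borel"
    using c\<theta> cont by (auto intro: borel_measurable_continuous_onI)
  have line: "((\<lambda>t. \<theta> (x + t *\<^sub>R b)) has_real_derivative \<theta>' (x + t *\<^sub>R b) b) (at t)" for x t
  proof -
    have "((\<lambda>t. x + t *\<^sub>R b) has_derivative (\<lambda>s. s *\<^sub>R b)) (at t)"
      by (auto intro!: derivative_eq_intros)
    then have "((\<lambda>t. \<theta> (x + t *\<^sub>R b)) has_derivative (\<lambda>s. \<theta>' (x + t *\<^sub>R b) (s *\<^sub>R b))) (at t)"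
      using has_derivative_compose[OF _ D] by blast
    moreover have "\<theta>' y (s *\<^sub>R b) = \<theta>' y b * s" for y s
      using linear_scale[OF has_derivative_linear[OF D[of y]], of s b] by simp
    ultimately show ?thesis by (simp add: has_field_derivative_def)
  qed
  have \<theta>i: "integrable lborel \<theta>"
  proof -
    have "integrable lborel (\<lambda>x. indicator K x *\<^sub>R \<theta> x)"
      using borel_integrable_compact[OF K(1) continuous_on_subset[OF c\<theta>]] by simp
    also have "(\<lambda>x. indicator K x *\<^sub>R \<theta> x) = \<theta>"
      using K(2) by (auto simp: fun_eq_iff indicator_def)
    finally show ?thesis .
  qed
  have shift: "integrable lborel (\<lambda>x. \<theta> (x + c)) \<and> (\<integral>x. \<theta> (x + c) \<partial>lborel) = (\<integral>x. \<theta> x \<partial>lborel)" for c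
    using \<theta>i integrable_distr_eq[of "(+) c" lborel borel \<theta>] integral_distr[of "(+) c" lborel borel \<theta>]
    by (simp add: lborel_distr_plus add.commute)
  have "(\<lambda>n. \<integral>x. F n x \<partial>lborel) \<longlonglongrightarrow> (\<integral>x. \<theta>' x b \<partial>lborel)"
  proof (rule integral_dominated_convergence)
    show "(\<lambda>x. \<theta>' x b) \<in> borel_measurable lborel" "\<And>n. F n \<in> borel_measurable lborel"
      unfolding F_def by measurable
    \<comment> \<open>With a step of at most 1 the quotient vanishes farther than
      \<open>norm b\<close> from \<open>K\<close>, and the mean value theorem bounds it by the bound
      \<open>B\<close> of the derivative.\<close>
    show "integrable lborel (\<lambda>x. indicator (cball 0 (R + norm b)) x *\<^sub>R B)"
      by (rule borel_integrable_compact) auto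
    show "AE x in lborel. (\<lambda>n. F n x) \<longlonglongrightarrow> \<theta>' x b"
    proof (rule AE_I2)
      fix x
      have "((\<lambda>s. (\<theta> (x + (0 + s) *\<^sub>R b) - \<theta> (x + 0 *\<^sub>R b)) / s) \<longlongrightarrow> \<theta>' x b) (at 0)"
        using line[of x 0] unfolding DERIV_def by simp
      moreover have "filterlim h (at 0) sequentially"
        unfolding filterlim_at h_def using LIMSEQ_inverse_real_of_nat by (auto intro: always_eventually)
      ultimately show "(\<lambda>n. F n x) \<longlonglongrightarrow> \<theta>' x b"
        unfolding F_def by (auto dest: filterlim_compose)
    qed
    show "AE x in lborel. norm (F n x) \<le> indicator (cball 0 (R + norm b)) x *\<^sub>R B" for n
    proof (rule AE_I2)
      fix x
      show "norm (F n x) \<le> indicator (cball 0 (R + norm b)) x *\<^sub>R B"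
      proof (cases "F n x = 0")
        case False
        then have "\<theta> (x + h n *\<^sub>R b) \<noteq> 0 \<or> \<theta> x \<noteq> 0" by (auto simp: F_def)
        then have "x + h n *\<^sub>R b \<in> K \<or> x \<in> K" using K(2) by blast
        then have "norm (x + h n *\<^sub>R b) \<le> R \<or> norm x \<le> R" using R by blast
        moreover have "norm (h n *\<^sub>R b) \<le> norm b"
          using h[of n] by (simp add: mult_left_le_one_le)
        moreover have "norm x \<le> norm (x + h n *\<^sub>R b) + norm (h n *\<^sub>R b)"
          using norm_triangle_ineq4[of "x + h n *\<^sub>R b" "h n *\<^sub>R b"] by simp
        ultimately have "norm x \<le> R + norm b" using norm_ge_zero[of b] by linarith
        moreover have "\<bar>F n x\<bar> \<le> B"
        proof -
          obtain z where z: "\<theta> (x + h n *\<^sub>R b) - \<theta> (x + 0 *\<^sub>R b) = (h n - 0) * \<theta>' (x + z *\<^sub>R b) b"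
            using MVT2[of 0 "h n" "\<lambda>t. \<theta> (x + t *\<^sub>R b)" "\<lambda>t. \<theta>' (x + t *\<^sub>R b) b"] line h[of n] by blast
          then have "F n x = \<theta>' (x + z *\<^sub>R b) b" using h[of n] by (simp add: F_def)
          then show ?thesis using B(2) by simp
        qed
        ultimately show ?thesis by simp
      qed (use B in simp)
    qed
  qed
  moreover have "(\<integral>x. F n x \<partial>lborel) = 0" for n
    unfolding F_def using shift[of "h n *\<^sub>R b"] \<theta>i by simp
  ultimately show ?thesis by (simp add: LIMSEQ_const_iff)
qed


section \<open>Weak gradients\<close>

lemma locally_integrable_bounded_linear:
  assumes "bounded_linear T" "locally_integrable \<Omega> u"
  shows "locally_integrable \<Omega> (\<lambda>x. T (u x))"
proof -
  have "(\<lambda>x. T (u x)) \<in> borel_measurable (lebesgue_on \<Omega>)"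
    using locally_integrable_measurable[OF assms(2)]
    by (rule borel_measurable_continuous_on[rotated])
      (simp add: linear_continuous_on assms(1) bounded_linear.linear linear_conv_bounded_linear)
  moreover have "set_integrable lebesgue K (\<lambda>x. T (u x))" if "set_integrable lebesgue K u" for K
    using integrable_bounded_linear[OF assms(1), of lebesgue "\<lambda>x. indicator K x *\<^sub>R u x"] that
    by (simp add: set_integrable_def bounded_linear.linear[OF assms(1)] linear_cmul)
  ultimately show ?thesis
    using assms(2) by (simp add: locally_integrable_def)
qed

lemma locally_integrable_add:
  assumes "locally_integrable \<Omega> u" "locally_integrable \<Omega> v"
  shows "locally_integrable \<Omega> (\<lambda>x. u x + v x)"
proof -
  have [measurable]: "u \<in> borel_measurable (lebesgue_on \<Omega>)" "v \<in> borel_measurable (lebesgue_on \<Omega>)"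
    using assms by (auto intro: locally_integrable_measurable)
  show ?thesis
    using assms set_integral_add(1)[of lebesgue _ u v] by (simp add: locally_integrable_def)
qed

lemma locally_integrable_continuous:
  fixes u :: "'a::euclidean_space \<Rightarrow> 'b::euclidean_space"
  assumes "continuous_on UNIV u"
  shows "locally_integrable \<Omega> u"
proof -
  have m: "u \<in> borel_measurable borel" using assms by (rule borel_measurable_continuous_onI)
  have "set_integrable lebesgue K u" if "compact K" for K
  proof -
    have "integrable lborel (\<lambda>x. indicator K x *\<^sub>R u x)"
      using that assms continuous_on_subset by (intro borel_integrable_compact) blast+
    then show ?thesis
      unfolding set_integrable_def
      using integrable_completion[OF borel_measurable_integrable] by blast
  qed
  then show ?thesis
    using borel_measurable_lebesgue_on[OF m] by (simp add: locally_integrable_def)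
qed

lemma weak_gradient_integrable:
  assumes "open \<Omega>" "is_weak_gradient \<Omega> u v" "\<phi> \<in> test_functions \<Omega>" "b \<in> Basis"
  shows "integrable (lebesgue_on \<Omega>) (\<lambda>x. u x * frechet_derivative \<phi> (at x) b)"
    "integrable (lebesgue_on \<Omega>) (\<lambda>x. (v x \<bullet> b) * \<phi> x)"
proof -
  obtain K where K: "compact K" "K \<subseteq> \<Omega>" "\<And>x. \<phi> x \<noteq> 0 \<Longrightarrow> x \<in> K"
    "\<And>x b. frechet_derivative \<phi> (at x) b \<noteq> 0 \<Longrightarrow> x \<in> K"
    by (rule test_functions_support[OF assms(3)]) blast
  have "locally_integrable \<Omega> u" "locally_integrable \<Omega> (\<lambda>x. v x \<bullet> b)"
    using assms(2) locally_integrable_bounded_linear[OF bounded_linear_inner_left]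
    by (auto simp: is_weak_gradient_def)
  then show "integrable (lebesgue_on \<Omega>) (\<lambda>x. u x * frechet_derivative \<phi> (at x) b)"
    "integrable (lebesgue_on \<Omega>) (\<lambda>x. (v x \<bullet> b) * \<phi> x)"
    using test_functions_continuous[OF assms(3)] assms(4) K assms(1)
    by (intro locally_integrable_mult_continuous[of _ _ _ K]; simp)+
qed

lemma weak_gradient_eq:
  "is_weak_gradient \<Omega> u v \<Longrightarrow> \<phi> \<in> test_functions \<Omega> \<Longrightarrow> b \<in> Basis \<Longrightarrow>
    (\<integral>x. u x * frechet_derivative \<phi> (at x) b \<partial>lebesgue_on \<Omega>) = - (\<integral>x. (v x \<bullet> b) * \<phi> x \<partial>lebesgue_on \<Omega>)"
  by (simp add: is_weak_gradient_def)

text \<open>Each coordinate of the difference is orthogonal to all test functions.\<close>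

lemma weak_gradient_unique:
  assumes \<Omega>: "open \<Omega>" and v: "is_weak_gradient \<Omega> u v" and v': "is_weak_gradient \<Omega> u v'"
  shows "AE x in lebesgue_on \<Omega>. v x = v' x"
proof -
  \<comment> \<open>Subtraction is written as adding a multiple, the form covered by the closure
    rules for local integrability.\<close>
  have "AE x in lebesgue_on \<Omega>. \<forall>b\<in>Basis. (v x \<bullet> b) + (- 1) *\<^sub>R (v' x \<bullet> b) = 0"
  proof (rule AE_finite_allI[OF finite_Basis])
    fix b :: 'a assume b: "b \<in> Basis"
    show "AE x in lebesgue_on \<Omega>. (v x \<bullet> b) + (- 1) *\<^sub>R (v' x \<bullet> b) = 0"
    proof (rule fundamental_lemma_calculus_of_variations[OF \<Omega>])
      have "locally_integrable \<Omega> (\<lambda>x. v x \<bullet> b)" "locally_integrable \<Omega> (\<lambda>x. v' x \<bullet> b)"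
        using v v' locally_integrable_bounded_linear[OF bounded_linear_inner_left]
        by (auto simp: is_weak_gradient_def)
      then show "locally_integrable \<Omega> (\<lambda>x. (v x \<bullet> b) + (- 1) *\<^sub>R (v' x \<bullet> b))"
        by (intro locally_integrable_add locally_integrable_bounded_linear[OF bounded_linear_scaleR_right])
      fix \<phi> assume \<phi>: "\<phi> \<in> test_functions \<Omega>"
      have "(\<integral>x. ((v x \<bullet> b) + (- 1) *\<^sub>R (v' x \<bullet> b)) * \<phi> x \<partial>lebesgue_on \<Omega>)
          = (\<integral>x. (v x \<bullet> b) * \<phi> x - (v' x \<bullet> b) * \<phi> x \<partial>lebesgue_on \<Omega>)"
        by (simp add: left_diff_distrib)
      also have "\<dots> = 0"
        using weak_gradient_integrable(2)[OF \<Omega> v \<phi> b] weak_gradient_integrable(2)[OF \<Omega> v' \<phi> b]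
          weak_gradient_eq[OF v \<phi> b] weak_gradient_eq[OF v' \<phi> b] by simp
      finally show "(\<integral>x. ((v x \<bullet> b) + (- 1) *\<^sub>R (v' x \<bullet> b)) * \<phi> x \<partial>lebesgue_on \<Omega>) = 0" .
    qed
  qed
  then show ?thesis
    by eventually_elim (auto intro: euclidean_eqI)
qed

lemma weak_gradient_add:
  assumes \<Omega>: "open \<Omega>" and u: "is_weak_gradient \<Omega> u u'" and v: "is_weak_gradient \<Omega> v v'"
  shows "is_weak_gradient \<Omega> (\<lambda>x. u x + v x) (\<lambda>x. u' x + v' x)"
  unfolding is_weak_gradient_def
proof (intro conjI ballI)
  show "locally_integrable \<Omega> (\<lambda>x. u x + v x)" "locally_integrable \<Omega> (\<lambda>x. u' x + v' x)"
    using u v by (auto simp: is_weak_gradient_def intro: locally_integrable_add)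
  fix \<phi> and b :: 'a assume \<phi>: "\<phi> \<in> test_functions \<Omega>" and b: "b \<in> Basis"
  show "(\<integral>x. (u x + v x) * frechet_derivative \<phi> (at x) b \<partial>lebesgue_on \<Omega>)
      = - (\<integral>x. ((u' x + v' x) \<bullet> b) * \<phi> x \<partial>lebesgue_on \<Omega>)"
    using weak_gradient_integrable[OF \<Omega> u \<phi> b] weak_gradient_integrable[OF \<Omega> v \<phi> b]
      weak_gradient_eq[OF u \<phi> b] weak_gradient_eq[OF v \<phi> b]
    by (simp add: distrib_right inner_add_left)
qed

lemma weak_gradient_scale:
  assumes \<Omega>: "open \<Omega>" and u: "is_weak_gradient \<Omega> u u'"
  shows "is_weak_gradient \<Omega> (\<lambda>x. c * u x) (\<lambda>x. c *\<^sub>R u' x)"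
  unfolding is_weak_gradient_def
proof (intro conjI ballI)
  show "locally_integrable \<Omega> (\<lambda>x. c * u x)" "locally_integrable \<Omega> (\<lambda>x. c *\<^sub>R u' x)"
    using u locally_integrable_bounded_linear[OF bounded_linear_mult_right, of \<Omega> u c]
      locally_integrable_bounded_linear[OF bounded_linear_scaleR_right, of \<Omega> u' c]
    by (auto simp: is_weak_gradient_def)
  fix \<phi> and b :: 'a assume \<phi>: "\<phi> \<in> test_functions \<Omega>" and b: "b \<in> Basis"
  show "(\<integral>x. c * u x * frechet_derivative \<phi> (at x) b \<partial>lebesgue_on \<Omega>)
      = - (\<integral>x. ((c *\<^sub>R u' x) \<bullet> b) * \<phi> x \<partial>lebesgue_on \<Omega>)"
    using weak_gradient_eq[OF u \<phi> b] by (simp add: mult.assoc)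
qed

definition classical_gradient :: "('a::euclidean_space \<Rightarrow> real) \<Rightarrow> 'a \<Rightarrow> 'a" where
  "classical_gradient \<phi> x = (\<Sum>b\<in>Basis. frechet_derivative \<phi> (at x) b *\<^sub>R b)"

text \<open>Integration by parts: the partial derivative of the product of \<phi> and \<psi> has
  integral 0.\<close>

lemma test_function_weak_gradient:
  assumes \<Omega>: "open \<Omega>" and \<phi>: "\<phi> \<in> test_functions \<Omega>"
  shows "is_weak_gradient \<Omega> \<phi> (classical_gradient \<phi>)"
  unfolding is_weak_gradient_def
proof (intro conjI ballI)
  show "locally_integrable \<Omega> \<phi>"
    using \<phi> by (intro locally_integrable_continuous test_functions_continuous)
  show "locally_integrable \<Omega> (classical_gradient \<phi>)"
    unfolding classical_gradient_def
    using \<phi> by (intro locally_integrable_continuous continuous_intros test_functions_continuous)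
  fix \<psi> and b :: 'a assume \<psi>: "\<psi> \<in> test_functions \<Omega>" and b: "b \<in> Basis"
  let ?D = "\<lambda>\<phi> x. frechet_derivative \<phi> (at x) b"
  obtain K where K: "compact K" "K \<subseteq> \<Omega>" "\<And>x. \<psi> x \<noteq> 0 \<Longrightarrow> x \<in> K"
    "\<And>x b. frechet_derivative \<psi> (at x) b \<noteq> 0 \<Longrightarrow> x \<in> K"
    by (rule test_functions_support[OF \<psi>]) blast
  have c: "continuous_on UNIV (?D \<phi>)" "continuous_on UNIV (?D \<psi>)" "continuous_on UNIV \<phi>" "continuous_on UNIV \<psi>"
    using \<phi> \<psi> b by (auto intro: test_functions_continuous)
  have int: "integrable (lebesgue_on \<Omega>) (\<lambda>x. \<phi> x * ?D \<psi> x)" "integrable (lebesgue_on \<Omega>) (\<lambda>x. ?D \<phi> x * \<psi> x)"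
    using K c \<Omega> by (auto intro!: locally_integrable_mult_continuous[of _ _ _ K] locally_integrable_continuous)
  have "(\<integral>x. \<phi> x * ?D \<psi> x + ?D \<phi> x * \<psi> x \<partial>lborel) = 0"
  proof (rule integral_partial_derivative_zero)
    show "((\<lambda>x. \<phi> x * \<psi> x) has_derivative
        (\<lambda>h. \<phi> x * frechet_derivative \<psi> (at x) h + frechet_derivative \<phi> (at x) h * \<psi> x)) (at x)" for x
      using \<phi> \<psi> by (intro has_derivative_mult test_functions_has_derivative)
    show "continuous_on UNIV (\<lambda>x. \<phi> x * ?D \<psi> x + ?D \<phi> x * \<psi> x)"
      using c by (intro continuous_intros)
    show "x \<in> K" if "\<phi> x * ?D \<psi> x + ?D \<phi> x * \<psi> x \<noteq> 0" for x
      using that K(3)[of x] K(4)[of x b]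
      by (cases "\<psi> x = 0"; cases "?D \<psi> x = 0") auto
    show "x \<in> K" if "\<phi> x * \<psi> x \<noteq> 0" for x
      using that K(3)[of x] by auto
  qed (use K in auto)
  \<comment> \<open>The integrand lives on the support \<open>K\<close> of \<psi>, which lies in
    \<Omega>, so it may be integrated over the whole space instead.\<close>
  moreover have "(\<integral>x. \<phi> x * ?D \<psi> x + ?D \<phi> x * \<psi> x \<partial>lebesgue_on \<Omega>)
      = (\<integral>x. \<phi> x * ?D \<psi> x + ?D \<phi> x * \<psi> x \<partial>lborel)"
  proof -
    have "(\<lambda>x. indicator \<Omega> x *\<^sub>R (\<phi> x * ?D \<psi> x + ?D \<phi> x * \<psi> x)) = (\<lambda>x. \<phi> x * ?D \<psi> x + ?D \<phi> x * \<psi> x)"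
    proof
      fix x
      show "indicator \<Omega> x *\<^sub>R (\<phi> x * ?D \<psi> x + ?D \<phi> x * \<psi> x) = \<phi> x * ?D \<psi> x + ?D \<phi> x * \<psi> x"
        using K(2) K(3)[of x] K(4)[of x b]
        by (cases "\<psi> x = 0"; cases "?D \<psi> x = 0") auto
    qed
    moreover have "(\<lambda>x. \<phi> x * ?D \<psi> x + ?D \<phi> x * \<psi> x) \<in> borel_measurable lborel"
      using c by (simp add: borel_measurable_continuous_onI continuous_intros)
    ultimately show ?thesis
      using integral_restrict_space[of \<Omega> lebesgue "\<lambda>x. \<phi> x * ?D \<psi> x + ?D \<phi> x * \<psi> x"] \<Omega>
      by (simp add: open_in_lebesgue integral_completion)
  qed
  ultimately have "(\<integral>x. \<phi> x * ?D \<psi> x \<partial>lebesgue_on \<Omega>) + (\<integral>x. ?D \<phi> x * \<psi> x \<partial>lebesgue_on \<Omega>) = 0"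
    using int by simp
  moreover have "classical_gradient \<phi> x \<bullet> b = ?D \<phi> x" for x
    using b by (simp add: classical_gradient_def inner_sum_left_Basis)
  ultimately show "(\<integral>x. \<phi> x * ?D \<psi> x \<partial>lebesgue_on \<Omega>) = - (\<integral>x. (classical_gradient \<phi> x \<bullet> b) * \<psi> x \<partial>lebesgue_on \<Omega>)"
    by simp
qed

lemma is_weak_gradient_wgrad: "is_weak_gradient \<Omega> u v \<Longrightarrow> is_weak_gradient \<Omega> u (wgrad \<Omega> u)"
  unfolding wgrad_def by (rule someI[of "is_weak_gradient \<Omega> u"])

lemma wgrad_eq:
  "open \<Omega> \<Longrightarrow> is_weak_gradient \<Omega> u v \<Longrightarrow> AE x in lebesgue_on \<Omega>. wgrad \<Omega> u x = v x"
  using weak_gradient_unique is_weak_gradient_wgrad by blast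

text \<open>All integrals against \<open>u\<close> vanish, so the zero field is a weak gradient too,
  and the chosen one agrees with it a.e.\<close>

lemma wgrad_AE_zero:
  assumes \<Omega>: "open \<Omega>" and v: "is_weak_gradient \<Omega> u v" and zero: "AE x in lebesgue_on \<Omega>. u x = 0"
  shows "AE x in lebesgue_on \<Omega>. wgrad \<Omega> u x = 0"
proof -
  have "(\<integral>x. u x * frechet_derivative \<phi> (at x) b \<partial>lebesgue_on \<Omega>) = 0" for \<phi> b
    using zero by (intro integral_eq_zero_AE) (auto elim!: eventually_mono)
  then have "is_weak_gradient \<Omega> u (\<lambda>_. 0)"
    using v by (auto simp: is_weak_gradient_def intro: locally_integrable_continuous)
  then show ?thesis by (rule wgrad_eq[OF \<Omega>])
qed


section \<open>The Sobolev spaces and the dual\<close>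

context double_phase
begin

abbreviation "grad \<equiv> wgrad \<Omega>"
abbreviation "W \<equiv> W1H \<Omega> p q \<mu>"
abbreviation "W0 \<equiv> W01H \<Omega> p q \<mu>"
abbreviation "n1 \<equiv> norm_1H \<Omega> p q \<mu>"
abbreviation "n0 \<equiv> norm_1H0 \<Omega> p q \<mu>"

lemma W_D:
  assumes "u \<in> W"
  shows "u \<in> LH" "is_weak_gradient \<Omega> u (grad u)" "(\<lambda>x. norm (grad u x)) \<in> LH"
proof -
  show "u \<in> LH" "(\<lambda>x. norm (grad u x)) \<in> LH"
    using assms by (simp_all add: W1H_def)
  obtain v where "is_weak_gradient \<Omega> u v"
    using assms by (auto simp only: W1H_def mem_Collect_eq)
  then show "is_weak_gradient \<Omega> u (grad u)" by (rule is_weak_gradient_wgrad)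
qed

lemma nH_cong: "v \<in> LH \<Longrightarrow> u \<in> LH \<Longrightarrow> AE x in M. \<bar>u x\<bar> = \<bar>v x\<bar> \<Longrightarrow> nH u = nH v"
  by (intro antisym nH_mono) (auto elim!: eventually_mono)

lemma wgrad_norm_measurable:
  assumes "is_weak_gradient \<Omega> u v"
  shows "(\<lambda>x. norm (grad u x)) \<in> borel_measurable M"
proof -
  have "locally_integrable \<Omega> (grad u)"
    using is_weak_gradient_wgrad[OF assms] by (simp add: is_weak_gradient_def)
  then show ?thesis by (rule measurable_compose[OF locally_integrable_measurable borel_measurable_norm])
qed

text \<open>\<open>wgrad\<close> is a choice and hence additive only almost everywhere; the
  seminorms do not see the difference.\<close>

lemma wgrad_add: "u \<in> W \<Longrightarrow> v \<in> W \<Longrightarrow> AE x in M. grad (\<lambda>x. u x + v x) x = grad u x + grad v x"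
  by (intro wgrad_eq[OF open_domain] weak_gradient_add[OF open_domain] W_D)

lemma wgrad_scale: "u \<in> W \<Longrightarrow> AE x in M. grad (\<lambda>x. c * u x) x = c *\<^sub>R grad u x"
  by (intro wgrad_eq[OF open_domain] weak_gradient_scale[OF open_domain] W_D)

lemma W_add:
  assumes u: "u \<in> W" and v: "v \<in> W"
  shows "(\<lambda>x. u x + v x) \<in> W"
    and "n0 (\<lambda>x. u x + v x) \<le> n0 u + n0 v"
proof -
  have wg: "is_weak_gradient \<Omega> (\<lambda>x. u x + v x) (\<lambda>x. grad u x + grad v x)"
    by (intro weak_gradient_add[OF open_domain] W_D u v)
  have L: "(\<lambda>x. norm (grad u x) + norm (grad v x)) \<in> LH"
    by (intro LH_add W_D u v)
  have le: "AE x in M. \<bar>norm (grad (\<lambda>x. u x + v x) x)\<bar> \<le> \<bar>norm (grad u x) + norm (grad v x)\<bar>"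
    using wgrad_add[OF u v] by eventually_elim (simp add: norm_triangle_ineq)
  show "(\<lambda>x. u x + v x) \<in> W"
    using wg LH_mono[OF L wgrad_norm_measurable[OF wg] le] LH_add[OF W_D(1)[OF u] W_D(1)[OF v]]
    by (auto simp: W1H_def)
  show "n0 (\<lambda>x. u x + v x) \<le> n0 u + n0 v"
    unfolding norm_1H0_def
    using nH_mono[OF L le] nH_triangle[OF W_D(3)[OF u] W_D(3)[OF v]] by simp
qed

lemma W_scale:
  assumes u: "u \<in> W"
  shows "(\<lambda>x. c * u x) \<in> W" and "n0 (\<lambda>x. c * u x) = \<bar>c\<bar> * n0 u"
proof -
  have wg: "is_weak_gradient \<Omega> (\<lambda>x. c * u x) (\<lambda>x. c *\<^sub>R grad u x)"
    by (intro weak_gradient_scale[OF open_domain] W_D u)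
  have L: "(\<lambda>x. c * norm (grad u x)) \<in> LH"
    by (intro LH_scale W_D u)
  have eq: "AE x in M. \<bar>norm (grad (\<lambda>x. c * u x) x)\<bar> = \<bar>c * norm (grad u x)\<bar>"
    using wgrad_scale[OF u, of c] by eventually_elim (simp add: abs_mult)
  have L': "(\<lambda>x. norm (grad (\<lambda>x. c * u x) x)) \<in> LH"
    using eq by (intro LH_mono[OF L wgrad_norm_measurable[OF wg]]) (auto elim!: eventually_mono)
  show "(\<lambda>x. c * u x) \<in> W"
    using wg L' LH_scale[OF W_D(1)[OF u]] by (auto simp: W1H_def)
  show "n0 (\<lambda>x. c * u x) = \<bar>c\<bar> * n0 u"
    unfolding norm_1H0_def nH_cong[OF L L' eq] by (rule nH_scale[OF W_D(3)[OF u]])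
qed

lemma LH_continuous_compact_support:
  fixes \<psi> :: "'a \<Rightarrow> real"
  assumes "continuous_on UNIV \<psi>" "compact K" "\<And>x. \<psi> x \<noteq> 0 \<Longrightarrow> x \<in> K"
  shows "\<psi> \<in> LH"
proof -
  obtain B where "\<And>x. \<bar>\<psi> x\<bar> \<le> B"
    using continuous_compact_support_bounded[OF assms] by blast
  then show ?thesis
    using assms(1) by (intro LH_bounded borel_measurable_lebesgue_on borel_measurable_continuous_onI) auto
qed

text \<open>The closure defining \<open>W0\<close> is taken inside \<open>W\<close>, so the test
  functions have to belong to it.\<close>

lemma test_functions_W:
  assumes \<phi>: "\<phi> \<in> test_functions \<Omega>"
  shows "\<phi> \<in> W"
proof -
  obtain K where K: "compact K" "K \<subseteq> \<Omega>" "\<And>x. \<phi> x \<noteq> 0 \<Longrightarrow> x \<in> K"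
    "\<And>x b. frechet_derivative \<phi> (at x) b \<noteq> 0 \<Longrightarrow> x \<in> K"
    by (rule test_functions_support[OF \<phi>]) blast
  note wg = test_function_weak_gradient[OF open_domain \<phi>]
  have "(\<lambda>x. norm (classical_gradient \<phi> x)) \<in> LH"
  proof (rule LH_continuous_compact_support[OF _ K(1)])
    show "continuous_on UNIV (\<lambda>x. norm (classical_gradient \<phi> x))"
      unfolding classical_gradient_def
      using \<phi> by (intro continuous_intros test_functions_continuous)
    fix x assume "norm (classical_gradient \<phi> x) \<noteq> 0"
    then have "\<not> (\<forall>b. frechet_derivative \<phi> (at x) b = 0)"
      unfolding classical_gradient_def by (auto simp only: scaleR_zero_left sum.neutral_const norm_zero)
    then show "x \<in> K" using K(4) by blast
  qed
  moreover have "AE x in M. \<bar>norm (grad \<phi> x)\<bar> \<le> \<bar>norm (classical_gradient \<phi> x)\<bar>"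
    using wgrad_eq[OF open_domain wg] by eventually_elim simp
  ultimately have "(\<lambda>x. norm (grad \<phi> x)) \<in> LH"
    using LH_mono wgrad_norm_measurable[OF wg] by blast
  moreover have "\<phi> \<in> LH"
    using test_functions_continuous[OF \<phi>] K by (intro LH_continuous_compact_support[of _ K])
  ultimately show ?thesis using wg by (auto simp: W1H_def)
qed

sublocale W: seminormed_functions W n1
proof
  show "(\<lambda>_. 0) \<in> W" by (intro test_functions_W test_functions_zero)
  show "(\<lambda>x. u x + v x) \<in> W" if "u \<in> W" "v \<in> W" for u v using that by (rule W_add)
  show "(\<lambda>x. c * u x) \<in> W" if "u \<in> W" for u c using that by (rule W_scale)
  show "0 \<le> n1 u" if "u \<in> W" for u
    using that unfolding norm_1H_def norm_1H0_def by (intro add_nonneg_nonneg nH_nonneg W_D)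
  show "n1 (\<lambda>x. u x + v x) \<le> n1 u + n1 v" if "u \<in> W" "v \<in> W" for u v
    using W_add(2)[OF that] nH_triangle[OF W_D(1)[OF that(1)] W_D(1)[OF that(2)]] by (simp add: norm_1H_def)
  show "n1 (\<lambda>x. c * u x) = \<bar>c\<bar> * n1 u" if "u \<in> W" for u c
    using W_scale(2)[OF that] nH_scale[OF W_D(1)[OF that]] by (simp add: norm_1H_def distrib_left)
qed

lemma W0_iff: "u \<in> W0 \<longleftrightarrow> u \<in> W \<and> (\<forall>e>0. \<exists>\<phi>\<in>test_functions \<Omega>. n1 (\<lambda>x. \<phi> x - u x) < e)"
proof
  assume "u \<in> W0"
  then have u: "u \<in> W" and cl: "\<And>T. u \<in> T \<Longrightarrow> openin (norm_topology W n1) T \<Longrightarrow> \<exists>\<phi>\<in>test_functions \<Omega>. \<phi> \<in> T"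
    by (auto simp: W01H_def in_closure_of)
  have "\<exists>\<phi>\<in>test_functions \<Omega>. \<phi> \<in> {v \<in> W. n1 (\<lambda>x. v x - u x) < e}" if "e > 0" for e
    using u that by (intro cl W.openin_ball) (simp_all add: W.zero)
  then show "u \<in> W \<and> (\<forall>e>0. \<exists>\<phi>\<in>test_functions \<Omega>. n1 (\<lambda>x. \<phi> x - u x) < e)"
    using u by blast
next
  assume R: "u \<in> W \<and> (\<forall>e>0. \<exists>\<phi>\<in>test_functions \<Omega>. n1 (\<lambda>x. \<phi> x - u x) < e)"
  show "u \<in> W0"
    unfolding W01H_def in_closure_of
  proof (intro conjI allI impI)
    show "u \<in> topspace (norm_topology W n1)" using R by simp
    fix T assume T: "u \<in> T \<and> openin (norm_topology W n1) T"
    then obtain e where "e > 0" "\<forall>v\<in>W. n1 (\<lambda>x. v x - u x) < e \<longrightarrow> v \<in> T"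
      unfolding openin_norm_topology by blast
    then show "\<exists>y. y \<in> test_functions \<Omega> \<and> y \<in> T"
      using R test_functions_W by blast
  qed
qed

lemma W0_W: "u \<in> W0 \<Longrightarrow> u \<in> W"
  by (simp add: W0_iff)

lemma test_functions_W0: "\<phi> \<in> test_functions \<Omega> \<Longrightarrow> \<phi> \<in> W0"
  using test_functions_W W.zero by (auto simp: W0_iff intro!: bexI[of _ \<phi>])

text \<open>The seminorm is now \<open>n0\<close>, while membership still refers to
  \<open>n1\<close>; closure under the vector operations passes from test functions to their
  limits.\<close>

sublocale W0: seminormed_functions W0 n0
proof
  show "(\<lambda>_. 0) \<in> W0" by (intro test_functions_W0 test_functions_zero)
  show "(\<lambda>x. u x + v x) \<in> W0" if u: "u \<in> W0" and v: "v \<in> W0" for u v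
    unfolding W0_iff
  proof (intro conjI allI impI W_add W0_W u v)
    fix e :: real assume "e > 0"
    then obtain \<phi> \<psi> where \<phi>: "\<phi> \<in> test_functions \<Omega>" "n1 (\<lambda>x. \<phi> x - u x) < e / 2"
      and \<psi>: "\<psi> \<in> test_functions \<Omega>" "n1 (\<lambda>x. \<psi> x - v x) < e / 2"
      using u v unfolding W0_iff by (meson half_gt_zero)
    have "n1 (\<lambda>x. (\<phi> x - u x) + (\<psi> x - v x)) \<le> n1 (\<lambda>x. \<phi> x - u x) + n1 (\<lambda>x. \<psi> x - v x)"
      using \<phi> \<psi> u v by (intro W.triangle W.diff_mem test_functions_W W0_W)
    then show "\<exists>\<phi>\<in>test_functions \<Omega>. n1 (\<lambda>x. \<phi> x - (u x + v x)) < e"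
      using \<phi> \<psi> by (intro bexI[OF _ test_functions_add[OF \<phi>(1) \<psi>(1)]]) (simp add: algebra_simps)
  qed
  show "(\<lambda>x. c * u x) \<in> W0" if u: "u \<in> W0" for u c
    unfolding W0_iff
  proof (intro conjI allI impI W_scale W0_W u)
    fix e :: real assume "e > 0"
    \<comment> \<open>The \<open>+ 1\<close> allows \<open>c = 0\<close> and makes the final
      inequality strict.\<close>
    then obtain \<phi> where \<phi>: "\<phi> \<in> test_functions \<Omega>" "n1 (\<lambda>x. \<phi> x - u x) < e / (\<bar>c\<bar> + 1)"
      using u unfolding W0_iff by (meson abs_ge_zero add_nonneg_pos divide_pos_pos zero_less_one)
    have "n1 (\<lambda>x. c * (\<phi> x - u x)) = \<bar>c\<bar> * n1 (\<lambda>x. \<phi> x - u x)"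
      using \<phi> u by (intro W.homogeneous W.diff_mem test_functions_W W0_W)
    also have "\<dots> \<le> \<bar>c\<bar> * (e / (\<bar>c\<bar> + 1))"
      using \<phi> by (intro mult_left_mono) auto
    also have "\<dots> < e" using \<open>e > 0\<close> by (simp add: field_simps)
    finally show "\<exists>\<phi>\<in>test_functions \<Omega>. n1 (\<lambda>x. \<phi> x - c * u x) < e"
      by (intro bexI[OF _ test_functions_scale[OF \<phi>(1)]]) (simp add: algebra_simps)
  qed
  show "0 \<le> n0 u" if "u \<in> W0" for u
    using that unfolding norm_1H0_def by (intro nH_nonneg W_D W0_W)
  show "n0 (\<lambda>x. u x + v x) \<le> n0 u + n0 v" if "u \<in> W0" "v \<in> W0" for u v
    using that by (intro W_add W0_W)
  show "n0 (\<lambda>x. c * u x) = \<bar>c\<bar> * n0 u" if "u \<in> W0" for u c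
    using that by (intro W_scale W0_W)
qed

section \<open>Functionals on the Sobolev space\<close>

abbreviation "dual \<equiv> dual_W01H \<Omega> p q \<mu>"
abbreviation "dnorm \<equiv> dual_norm \<Omega> p q \<mu>"

text \<open>A real supremum is known to bound its members only if the set is bounded above; the
  boundedness of both functionals supplies this.\<close>

lemma dual_evaluation_le:
  assumes l: "l \<in> dual" "m \<in> dual" and \<phi>: "\<phi> \<in> W0" "n0 \<phi> \<le> 1"
  shows "\<bar>l \<phi> - m \<phi>\<bar> \<le> dnorm (\<lambda>\<psi>. l \<psi> - m \<psi>)"
proof -
  obtain C where C: "\<And>\<psi>. \<psi> \<in> W0 \<Longrightarrow> \<bar>l \<psi>\<bar> \<le> C * n0 \<psi>"
    using l(1) unfolding dual_W01H_def by blast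
  obtain D where D: "\<And>\<psi>. \<psi> \<in> W0 \<Longrightarrow> \<bar>m \<psi>\<bar> \<le> D * n0 \<psi>"
    using l(2) unfolding dual_W01H_def by blast
  have "\<bar>l \<psi> - m \<psi>\<bar> \<le> \<bar>C\<bar> + \<bar>D\<bar>" if "\<psi> \<in> W0" "n0 \<psi> \<le> 1" for \<psi>
  proof -
    have "E * n0 \<psi> \<le> \<bar>E\<bar>" for E
      using mult_mono[of E "\<bar>E\<bar>" "n0 \<psi>" 1] W0.nonneg[OF that(1)] that(2) by simp
    then show ?thesis using C[OF that(1)] D[OF that(1)] by (smt (verit))
  qed
  then have "bdd_above {\<bar>l \<psi> - m \<psi>\<bar> |\<psi>. \<psi> \<in> W0 \<and> n0 \<psi> \<le> 1}"
    by (intro bdd_aboveI[of _ "\<bar>C\<bar> + \<bar>D\<bar>"]) auto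
  then show ?thesis
    unfolding dual_norm_def using \<phi> by (intro cSup_upper) auto
qed

text \<open>Points at distance zero lie in the same open sets, whereas evaluations separate functionals.\<close>

lemma continuous_map_dual_indistinguishable:
  assumes A: "continuous_map (norm_topology W0 n0) (norm_topology dual dnorm) A"
    and uv: "u \<in> W0" "v \<in> W0" "n0 (\<lambda>x. v x - u x) = 0"
  shows "A u = A v"
proof (rule ccontr)
  assume neq: "A u \<noteq> A v"
  have Ad: "A w \<in> dual" if "w \<in> W0" for w
    using A that by (auto simp: continuous_map_def)
  have "\<exists>\<phi>\<in>W0. n0 \<phi> \<le> 1 \<and> A u \<phi> \<noteq> A v \<phi>"
  proof (rule ccontr)
    assume "\<not> ?thesis"
    then have eq: "\<And>\<phi>. \<phi> \<in> W0 \<Longrightarrow> n0 \<phi> \<le> 1 \<Longrightarrow> A u \<phi> = A v \<phi>" by blast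
    have "A u \<phi> = A v \<phi>" if \<phi>: "\<phi> \<in> W0" for \<phi>
    proof -
      \<comment> \<open>The \<open>+ 1\<close> scales \<phi> into the unit ball even when its
        seminorm is 0.\<close>
      define c where "c = 1 / (n0 \<phi> + 1)"
      have c: "c > 0" "n0 (\<lambda>x. c * \<phi> x) \<le> 1"
        using W0.nonneg[OF \<phi>] W0.homogeneous[OF \<phi>, of c] by (auto simp: c_def)
      have "A u (\<lambda>x. c * \<phi> x) = A v (\<lambda>x. c * \<phi> x)"
        using W0.scale_mem[OF \<phi>] c(2) by (rule eq)
      then show ?thesis using Ad[OF uv(1)] Ad[OF uv(2)] \<phi> c(1) by (simp add: dual_W01H_def)
    qed
    then have "A u = A v"
      using Ad[OF uv(1)] Ad[OF uv(2)] by (intro extensionalityI[of _ W0]) (auto simp: dual_W01H_def)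
    then show False using neq by simp
  qed
  then obtain \<phi> where \<phi>: "\<phi> \<in> W0" "n0 \<phi> \<le> 1" "A u \<phi> \<noteq> A v \<phi>" by blast
  \<comment> \<open>This set contains \<open>A u\<close> but not \<open>A v\<close>. It is open
    because evaluation at a point of the unit ball is 1-Lipschitz for \<open>dnorm\<close>.\<close>
  let ?U = "{l \<in> dual. l \<phi> \<noteq> A v \<phi>}"
  have "openin (norm_topology dual dnorm) ?U"
    unfolding openin_norm_topology
  proof (intro conjI ballI)
    fix l assume l: "l \<in> ?U"
    show "\<exists>\<epsilon>>0. \<forall>m\<in>dual. dnorm (\<lambda>x. m x - l x) < \<epsilon> \<longrightarrow> m \<in> ?U"
    proof (intro exI conjI ballI impI)
      show "0 < \<bar>l \<phi> - A v \<phi>\<bar>" using l by simp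
      fix m assume "m \<in> dual" "dnorm (\<lambda>x. m x - l x) < \<bar>l \<phi> - A v \<phi>\<bar>"
      then show "m \<in> ?U" using dual_evaluation_le[of m l \<phi>] l \<phi> by auto
    qed
  qed auto
  then have "openin (norm_topology W0 n0) {w \<in> topspace (norm_topology W0 n0). A w \<in> ?U}"
    by (rule openin_continuous_map_preimage[OF A])
  moreover have "u \<in> {w \<in> topspace (norm_topology W0 n0). A w \<in> ?U}"
    using uv \<phi> Ad by simp
  ultimately obtain e where e: "e > 0"
    "\<And>w. w \<in> W0 \<Longrightarrow> n0 (\<lambda>x. w x - u x) < e \<Longrightarrow> w \<in> {w \<in> topspace (norm_topology W0 n0). A w \<in> ?U}"
    unfolding openin_norm_topology by blast
  have "v \<in> {w \<in> topspace (norm_topology W0 n0). A w \<in> ?U}"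
    using e(1) uv(3) by (intro e(2)[OF uv(2)]) simp
  then show False by simp
qed

end


section \<open>The operator equation\<close>

text \<open>The gain is \<open>s powr (c - 1) \<le> 1\<close>. For \<open>c < 2\<close> the power
  alone would grow as its argument shrinks; the extra factor \<open>s\<close>, which comes from the
  scaled vector in the integrand, compensates.\<close>

lemma powr_scale_le:
  fixes s n c :: real
  assumes "0 < s" "s < 1" "0 \<le> n" "1 \<le> c"
  shows "(s * n) powr (c - 2) * s \<le> n powr (c - 2)"
proof -
  have "s powr (c - 2) * s = s powr (c - 1)"
    using powr_add[of s "c - 2" 1] assms by simp
  then have "(s * n) powr (c - 2) * s = s powr (c - 1) * n powr (c - 2)"
    using assms by (simp add: powr_mult mult_ac)
  also have "\<dots> \<le> 1 * n powr (c - 2)"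
    using assms by (intro mult_right_mono) (auto intro: powr_le1)
  finally show ?thesis by simp
qed

context double_phase
begin

theorem operator_equation_solvable:
  assumes T: "homeomorphism_onto_dual \<Omega> p q \<mu> T"
    and F: "compact_into_dual \<Omega> p q \<mu> F"
    and coercive: "coercive \<Omega> p q \<mu> (\<lambda>u. \<lambda>\<phi>\<in>W0. T u \<phi> - F u \<phi>)"
    and scaling: "\<And>u s. u \<in> W0 \<Longrightarrow> 0 < s \<Longrightarrow> s < 1 \<Longrightarrow>
      T (\<lambda>x. s * u x) (\<lambda>x. s * u x) \<le> T u (\<lambda>x. s * u x)"
  shows "\<exists>u\<in>W0. T u = F u"
proof -
  let ?X = "norm_topology W0 n0" and ?Y = "norm_topology dual dnorm"
  obtain B where Tc: "continuous_map ?X ?Y T" and Bc: "continuous_map ?Y ?X B"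
    and TB: "\<And>l. l \<in> dual \<Longrightarrow> T (B l) = l"
    using T unfolding homeomorphism_onto_dual_def by blast
  have Fc: "continuous_map ?X ?Y F" using F by (simp add: compact_into_dual_def)
  have Fd: "F u \<in> dual" if "u \<in> W0" for u
    using Fc that by (auto simp: continuous_map_def)
  \<comment> \<open>The level 1 stands for any positive level: what matters is that the pairing of
    \<open>T u - F u\<close> with \<open>u\<close> is positive on a large sphere.\<close>
  obtain R0 where R0: "\<And>u. u \<in> W0 \<Longrightarrow> n0 u \<ge> R0 \<Longrightarrow> (T u u - F u u) / n0 u \<ge> 1"
    using coercive unfolding coercive_def by fastforce
  \<comment> \<open>The maximum with 1 makes the radius positive, as the retraction and the division
    by \<open>R\<close> require.\<close>
  define R where "R = max R0 1"
  have R: "R > 0" "R0 \<le> R" by (auto simp: R_def)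
  let ?P = "W0.radial_retraction R"
  define S where "S = {u \<in> W0. n0 u \<le> R}"
  have PS: "?P u \<in> S" if "u \<in> W0" for u
    using that R W0.radial_retraction_mem W0.radial_retraction_le by (simp add: S_def)
  define K where "K = B \<circ> F \<circ> ?P"
  have Kc: "continuous_map ?X ?X K"
    unfolding K_def
    by (intro continuous_map_compose[of _ ?X] W0.continuous_map_radial_retraction R
        continuous_map_compose[OF Fc Bc])
  have "\<forall>S\<subseteq>W0. (\<exists>C. \<forall>u\<in>S. n0 u \<le> C) \<longrightarrow> compactin ?Y (?Y closure_of (F ` S))"
    using F unfolding compact_into_dual_def by (rule conjunct2)
  moreover have "S \<subseteq> W0" "\<forall>u\<in>S. n0 u \<le> R" by (auto simp: S_def)
  ultimately have "compactin ?Y (?Y closure_of (F ` S))" by meson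
  \<comment> \<open>The image of the ball under \<open>F\<close> has compact closure in the dual,
    and the continuous inverse \<open>B\<close> carries this closure to a compact set in the Sobolev
    space.\<close>
  then have C: "compactin ?X (B ` (?Y closure_of (F ` S)))"
    using Bc by (rule image_compactin)
  have "K ` W0 \<subseteq> B ` (?Y closure_of (F ` S))"
  proof -
    have "F ` S \<subseteq> ?Y closure_of (F ` S)"
      using Fd by (intro closure_of_subset) (auto simp: S_def)
    then show ?thesis using PS by (auto simp: K_def)
  qed
  then obtain u where u: "u \<in> W0" "n0 (\<lambda>x. K u x - u x) = 0"
    using W0.schauder[OF Kc C] by blast
  have "K u \<in> W0" using Kc u by (auto simp: continuous_map_def)
  \<comment> \<open>Here distance zero becomes equality of functionals.\<close>
  then have "T u = T (K u)"
    using Tc u by (intro continuous_map_dual_indistinguishable)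
  also have "\<dots> = F (?P u)"
    using TB[OF Fd] PS[OF u(1)] by (simp add: K_def S_def)
  finally have Tu: "T u = F (?P u)" .
  have "n0 u \<le> R"
  proof (rule ccontr)
    assume n: "\<not> n0 u \<le> R"
    define s where "s = R / n0 u"
    have s: "0 < s" "s < 1" using n R by (auto simp: s_def field_simps)
    have P: "?P u = (\<lambda>x. s * u x)"
      using n by (simp add: W0.radial_retraction_def s_def max_def)
    have "n0 (?P u) = R"
      unfolding P W0.homogeneous[OF u(1)] using n R by (simp add: s_def)
    then have "(T (?P u) (?P u) - F (?P u) (?P u)) / R \<ge> 1"
      using R0[OF W0.radial_retraction_mem[OF u(1)], of R] R by simp
    moreover have "T (?P u) (?P u) \<le> F (?P u) (?P u)"
      using scaling[OF u(1) s] Tu by (simp add: P)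
    ultimately show False using R by (simp add: field_simps)
  qed
  then have "?P u = u"
    using R by (simp add: W0.radial_retraction_def max_def)
  then show ?thesis using Tu u by auto
qed

text \<open>The comparison is pointwise. Paired with \<open>s * u\<close>, each term is a
  nonnegative weight times \<open>n powr (c - 2) * (s * n\<^sup>2)\<close>, with \<open>n\<close>
  the length of the gradient or the absolute value of \<open>u\<close>; scaling the first argument
  brings in the factor estimated by \<open>powr_scale_le\<close>. Existence of the integrals carries
  the inequality over to them.\<close>

lemma T_form_scaling:
  assumes u: "u \<in> W0" and s: "0 < s" "s < 1"
    and ex: "T_integrals_exist \<Omega> p q \<mu> (\<lambda>x. s * u x) (\<lambda>x. s * u x)"
      "T_integrals_exist \<Omega> p q \<mu> u (\<lambda>x. s * u x)"
  shows "T_form \<Omega> p q \<mu> (\<lambda>x. s * u x) (\<lambda>x. s * u x) \<le> T_form \<Omega> p q \<mu> u (\<lambda>x. s * u x)"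
  unfolding T_form_def
proof (intro add_mono integral_mono_AE)
  show "AE x in M. T_grad_integrand \<Omega> p q \<mu> (\<lambda>x. s * u x) (\<lambda>x. s * u x) x
      \<le> T_grad_integrand \<Omega> p q \<mu> u (\<lambda>x. s * u x) x"
    using weight_nonneg exponents_bounds_AE wgrad_scale[OF W0_W[OF u], of s]
  proof eventually_elim
    case (elim x)
    let ?n = "norm (grad u x)"
    have le: "(s * ?n) powr (c - 2) * (s * (s * ?n\<^sup>2)) \<le> ?n powr (c - 2) * (s * ?n\<^sup>2)" if "1 < c" for c
      using mult_right_mono[OF powr_scale_le[OF s, of ?n c], of "s * ?n\<^sup>2"] that s
      by (simp add: mult.assoc)
    have "T_grad_integrand \<Omega> p q \<mu> (\<lambda>x. s * u x) (\<lambda>x. s * u x) x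
        = (s * ?n) powr (p x - 2) * (s * (s * ?n\<^sup>2)) + \<mu> x * ((s * ?n) powr (q x - 2) * (s * (s * ?n\<^sup>2)))"
      using s elim by (simp add: T_grad_integrand_def inner_add_left power2_norm_eq_inner algebra_simps)
    also have "\<dots> \<le> ?n powr (p x - 2) * (s * ?n\<^sup>2) + \<mu> x * (?n powr (q x - 2) * (s * ?n\<^sup>2))"
      using elim by (intro add_mono mult_left_mono le) auto
    also have "\<dots> = T_grad_integrand \<Omega> p q \<mu> u (\<lambda>x. s * u x) x"
      using s elim by (simp add: T_grad_integrand_def inner_add_left power2_norm_eq_inner algebra_simps)
    finally show ?case .
  qed
  show "AE x in M. T_pot_integrand p q \<mu> (\<lambda>x. s * u x) (\<lambda>x. s * u x) x
      \<le> T_pot_integrand p q \<mu> u (\<lambda>x. s * u x) x"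
    using weight_nonneg exponents_bounds_AE
  proof eventually_elim
    case (elim x)
    let ?n = "\<bar>u x\<bar>"
    have le: "(s * ?n) powr (c - 2) * (s * (s * ?n\<^sup>2)) \<le> ?n powr (c - 2) * (s * ?n\<^sup>2)" if "1 < c" for c
      using mult_right_mono[OF powr_scale_le[OF s, of ?n c], of "s * ?n\<^sup>2"] that s
      by (simp add: mult.assoc)
    have "T_pot_integrand p q \<mu> (\<lambda>x. s * u x) (\<lambda>x. s * u x) x
        = norm x powr (- p x) * ((s * ?n) powr (p x - 2) * (s * (s * ?n\<^sup>2)))
          + norm x powr (- q x) * \<mu> x * ((s * ?n) powr (q x - 2) * (s * (s * ?n\<^sup>2)))"
      using s by (simp add: T_pot_integrand_def abs_mult power2_eq_square algebra_simps)
    also have "\<dots> \<le> norm x powr (- p x) * (?n powr (p x - 2) * (s * ?n\<^sup>2))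
          + norm x powr (- q x) * \<mu> x * (?n powr (q x - 2) * (s * ?n\<^sup>2))"
      using elim by (intro add_mono mult_left_mono le) auto
    also have "\<dots> = T_pot_integrand p q \<mu> u (\<lambda>x. s * u x) x"
      using s by (simp add: T_pot_integrand_def abs_mult power2_eq_square algebra_simps)
    finally show ?case .
  qed
qed (use ex in \<open>auto simp: T_integrals_exist_def\<close>)

lemma T_form_zero:
  assumes u: "u \<in> W0" and zero: "AE x in M. u x = 0"
  shows "T_form \<Omega> p q \<mu> u \<phi> = 0"
proof -
  have "AE x in M. T_grad_integrand \<Omega> p q \<mu> u \<phi> x = 0"
    using wgrad_AE_zero[OF open_domain W_D(2)[OF W0_W[OF u]] zero]
    by eventually_elim (simp add: T_grad_integrand_def)
  moreover have "AE x in M. T_pot_integrand p q \<mu> u \<phi> x = 0"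
    using zero by eventually_elim (simp add: T_pot_integrand_def)
  ultimately show ?thesis
    by (simp add: T_form_def integral_eq_zero_AE)
qed

text \<open>The weak gradient vanishes a.e. along with \<open>u\<close>, so \<open>f\<close> is
  evaluated at zero arguments. Measurability of the composed integrand comes from the existence of
  its integral.\<close>

lemma F_form_zero:
  assumes u: "u \<in> W0" and zero: "AE x in M. u x = 0"
    and f: "(\<lambda>x. f x 0 0) \<in> borel_measurable M" and \<phi>: "\<phi> \<in> borel_measurable M"
    and ex: "F_integral_exists \<Omega> f u \<phi>"
  shows "F_form \<Omega> f u \<phi> = (\<integral>x. f x 0 0 * \<phi> x \<partial>M)"
  unfolding F_form_def
proof (rule integral_cong_AE)
  show "F_integrand \<Omega> f u \<phi> \<in> borel_measurable M"
    using ex unfolding F_integral_exists_def by (rule borel_measurable_integrable)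
  show "(\<lambda>x. f x 0 0 * \<phi> x) \<in> borel_measurable M" using f \<phi> by simp
  show "AE x in M. F_integrand \<Omega> f u \<phi> x = f x 0 0 * \<phi> x"
    using wgrad_AE_zero[OF open_domain W_D(2)[OF W0_W[OF u]] zero] zero
    by eventually_elim (simp add: F_integrand_def)
qed

text \<open>On a domain of finite measure the bound
  \<open>\<bar>g x\<bar> \<le> \<bar>g x\<bar> powr e x + 1\<close> is enough.\<close>

lemma L_var_integrable:
  assumes g: "g \<in> L_var \<Omega> e" and [measurable]: "e \<in> borel_measurable M"
    and e: "\<And>x. x \<in> \<Omega> \<Longrightarrow> 1 \<le> e x"
  shows "integrable M g"
proof (rule integrableI_bounded)
  show "g \<in> borel_measurable M" using g by (simp add: L_var_def)
  then have [measurable]: "g \<in> borel_measurable M" .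
  have "emeasure M \<Omega> < \<infinity>"
    using emeasure_bounded_finite[OF bounded_domain] open_domain
    by (simp add: emeasure_restrict_space)
  have "(\<integral>\<^sup>+x. ennreal (norm (g x)) \<partial>M) \<le> (\<integral>\<^sup>+x. ennreal (\<bar>g x\<bar> powr e x) + 1 \<partial>M)"
  proof (rule nn_integral_mono)
    fix x assume "x \<in> space M"
    then have "1 \<le> e x" using e by simp
    have "\<bar>g x\<bar> \<le> \<bar>g x\<bar> powr e x + 1"
    proof (cases "\<bar>g x\<bar> \<le> 1")
      case False
      then show ?thesis using powr_mono[OF \<open>1 \<le> e x\<close>, of "\<bar>g x\<bar>"] by simp
    qed (simp add: add_increasing)
    then show "ennreal (norm (g x)) \<le> ennreal (\<bar>g x\<bar> powr e x) + 1"
      by (metis abs_ge_zero ennreal_1 ennreal_leI ennreal_plus powr_ge_zero real_norm_def zero_le_one)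
  qed
  also have "\<dots> = (\<integral>\<^sup>+x. ennreal (\<bar>g x\<bar> powr e x) \<partial>M) + (\<integral>\<^sup>+x. 1 \<partial>M)"
    by (rule nn_integral_add) measurable
  also have "\<dots> < \<infinity>"
    using g \<open>emeasure M \<Omega> < \<infinity>\<close> by (simp add: L_var_def)
  finally show "(\<integral>\<^sup>+x. ennreal (norm (g x)) \<partial>M) < \<infinity>" .
qed

lemma integrable_imp_locally_integrable:
  assumes "integrable M w"
  shows "locally_integrable \<Omega> w"
proof -
  have w: "integrable lebesgue (\<lambda>x. indicator \<Omega> x *\<^sub>R w x)"
    using assms open_domain by (subst (asm) integrable_restrict_space) (auto simp: open_in_lebesgue)
  have "set_integrable lebesgue K w" if K: "compact K" "K \<subseteq> \<Omega>" for K
  proof -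
    have "K \<in> sets lebesgue"
      using borel_closed[OF compact_imp_closed[OF K(1)]] by (simp add: sets_completionI_sets)
    then have "integrable lebesgue (\<lambda>x. indicator K x *\<^sub>R (indicator \<Omega> x *\<^sub>R w x))"
      using w by (rule integrable_mult_indicator)
    also have "(\<lambda>x. indicator K x *\<^sub>R (indicator \<Omega> x *\<^sub>R w x)) = (\<lambda>x. indicator K x *\<^sub>R w x)"
      using K(2) by (auto simp: fun_eq_iff indicator_def)
    finally show ?thesis by (simp add: set_integrable_def)
  qed
  then show ?thesis
    using borel_measurable_integrable[OF assms] by (simp add: locally_integrable_def)
qed

end

theorem theorem3p2:
  fixes \<Omega> :: "'a::euclidean_space set"
    and p q \<mu> r g \<alpha> h \<beta>\<^sub>1 \<beta>\<^sub>2 :: "'a \<Rightarrow> real"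
    and f :: "'a \<Rightarrow> real \<Rightarrow> 'a \<Rightarrow> real"
    and a\<^sub>1 a\<^sub>2 lam :: real
  assumes dim: "DIM('a) \<ge> 3"
    and domain: "lipschitz_domain \<Omega>"
    and cont_p: "continuous_on (closure \<Omega>) p"
    and cont_q: "continuous_on (closure \<Omega>) q"
    and exponents: "\<And>x. x \<in> closure \<Omega> \<Longrightarrow>
          1 < p x \<and> p x < real DIM('a) \<and> 1 < q x \<and> q x < real DIM('a) \<and>
          p x < q x \<and> q x < critical_exp p x"
    and mu: "\<mu> \<in> L_infty_nonneg \<Omega>"
    \<comment> \<open>hypothesis 1\<close>
    and f_caratheodory: "caratheodory \<Omega> f"
    and f_nonzero: "\<not> (AE x in lebesgue_on \<Omega>. f x 0 0 = 0)"
    \<comment> \<open>hypothesis 2\<close>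
    and r: "r \<in> C_plus \<Omega>" "\<And>x. x \<in> closure \<Omega> \<Longrightarrow> r x < critical_exp p x"
    and g: "g \<in> L_var \<Omega> (conjugate_exp r)"
    and a_pos: "a\<^sub>1 > 0" "a\<^sub>2 > 0"
    and growth: "\<And>t \<eta>. AE x in lebesgue_on \<Omega>.
          \<bar>f x t \<eta>\<bar> \<le> g x + a\<^sub>1 * \<bar>t\<bar> powr (r x - 1) + a\<^sub>2 * norm \<eta> powr (p x / conjugate_exp r x)"
    \<comment> \<open>hypothesis 3\<close>
    and alpha: "\<alpha> \<in> C_plus \<Omega>" "exp_max \<Omega> \<alpha> < exp_min \<Omega> p"
    and h: "h \<in> L_var \<Omega> (conjugate_exp p)"
    and beta1: "\<beta>\<^sub>1 \<in> L_var \<Omega> (\<lambda>x. q x / (q x - exp_min \<Omega> \<alpha>))"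
    and beta2: "\<beta>\<^sub>2 \<in> L_var \<Omega> (\<lambda>x. q x / (q x - \<alpha> x))"
    and lam_pos: "lam > 0"
    and limsup: "\<And>t. AE x in lebesgue_on \<Omega>.
          Limsup at_infinity (\<lambda>\<eta>. ereal (f x t \<eta> /
            (h x + \<beta>\<^sub>1 x * \<bar>t\<bar> powr (exp_min \<Omega> \<alpha> - 1) + \<beta>\<^sub>2 x * norm \<eta> powr (\<alpha> x - 1)))) \<le> ereal lam"
    \<comment> \<open>the integrals defining the two operators exist\<close>
    and T_defined: "\<And>u \<phi>. u \<in> W01H \<Omega> p q \<mu> \<Longrightarrow> \<phi> \<in> W01H \<Omega> p q \<mu> \<Longrightarrow> T_integrals_exist \<Omega> p q \<mu> u \<phi>"
    and F_defined: "\<And>u \<phi>. u \<in> W01H \<Omega> p q \<mu> \<Longrightarrow> \<phi> \<in> W01H \<Omega> p q \<mu> \<Longrightarrow> F_integral_exists \<Omega> f u \<phi>"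
    \<comment> \<open>assumptions (i), (ii), (iii)\<close>
    and T_homeomorphism: "homeomorphism_onto_dual \<Omega> p q \<mu> (T_op \<Omega> p q \<mu>)"
    and F_compact: "compact_into_dual \<Omega> p q \<mu> (F_op \<Omega> p q \<mu> f)"
    and T_minus_F_coercive:
      "coercive \<Omega> p q \<mu> (\<lambda>u. \<lambda>\<phi>\<in>W01H \<Omega> p q \<mu>. T_op \<Omega> p q \<mu> u \<phi> - F_op \<Omega> p q \<mu> f u \<phi>)"
  shows "\<exists>u\<in>W01H \<Omega> p q \<mu>. T_op \<Omega> p q \<mu> u = F_op \<Omega> p q \<mu> f u \<and>
           \<not> (AE x in lebesgue_on \<Omega>. u x = 0) \<and> weak_solution \<Omega> p q \<mu> f u"
proof -
  have \<Omega>: "open \<Omega>" "bounded \<Omega>" using domain by (auto simp: lipschitz_domain_def)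
  have cl: "x \<in> closure \<Omega>" if "x \<in> \<Omega>" for x using that closure_subset by blast
  have cm: "h \<in> borel_measurable (lebesgue_on \<Omega>)" if "continuous_on (closure \<Omega>) h" for h :: "'a \<Rightarrow> real"
    using continuous_on_subset[OF that closure_subset] \<Omega>(1)
    by (intro continuous_imp_measurable_on_sets_lebesgue) (auto simp: open_in_lebesgue)
  interpret double_phase \<Omega> p q \<mu> "real DIM('a)"
  proof
    show "1 < p x \<and> p x \<le> real DIM('a) \<and> 1 < q x \<and> q x \<le> real DIM('a)" if "x \<in> \<Omega>" for x
      using exponents[OF cl[OF that]] by simp
  qed (use \<Omega> cm cont_p cont_q mu in auto)
  obtain u where u: "u \<in> W0" "T_op \<Omega> p q \<mu> u = F_op \<Omega> p q \<mu> f u"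
  proof -
    have "T_op \<Omega> p q \<mu> (\<lambda>x. s * u x) (\<lambda>x. s * u x) \<le> T_op \<Omega> p q \<mu> u (\<lambda>x. s * u x)"
      if "u \<in> W0" "0 < s" "s < 1" for u s
      using T_form_scaling[OF that T_defined T_defined] W0.scale_mem[OF that(1), of s] that(1)
      by (simp add: T_op_def)
    then show ?thesis
      using operator_equation_solvable[OF T_homeomorphism F_compact T_minus_F_coercive] that by blast
  qed
  have eq: "T_form \<Omega> p q \<mu> u \<phi> = F_form \<Omega> f u \<phi>" if "\<phi> \<in> W0" for \<phi>
    using fun_cong[OF u(2), of \<phi>] that by (simp add: T_op_def F_op_def)
  have "\<not> (AE x in lebesgue_on \<Omega>. u x = 0)"
  proof
    assume zero: "AE x in lebesgue_on \<Omega>. u x = 0"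
    have f0: "(\<lambda>x. f x 0 0) \<in> borel_measurable (lebesgue_on \<Omega>)"
      using f_caratheodory by (simp add: caratheodory_def)
    \<comment> \<open>At \<open>t = 0\<close> and \<open>\<eta> = 0\<close> both powers in the
      growth bound are 0, by the convention \<open>0 powr a = 0\<close>, which leaves
      \<open>\<bar>f x 0 0\<bar> \<le> g x\<close>. So integrability of \<open>g\<close> is what is
      needed.\<close>
    have "integrable (lebesgue_on \<Omega>) g"
    proof (rule L_var_integrable[OF g])
      have "r \<in> borel_measurable (lebesgue_on \<Omega>)" using r(1) by (intro cm) (simp add: C_plus_def)
      then show "conjugate_exp r \<in> borel_measurable (lebesgue_on \<Omega>)"
        unfolding conjugate_exp_def[abs_def] by measurable
      show "1 \<le> conjugate_exp r x" if "x \<in> \<Omega>" for x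
        using r(1) cl[OF that] by (auto simp: C_plus_def conjugate_exp_def)
    qed
    then have "integrable (lebesgue_on \<Omega>) (\<lambda>x. f x 0 0)"
      using f0 by (rule Bochner_Integration.integrable_bound)
        (use growth[of 0 0] in \<open>auto elim!: eventually_mono\<close>)
    then have "AE x in lebesgue_on \<Omega>. f x 0 0 = 0"
    proof (intro fundamental_lemma_calculus_of_variations[OF \<Omega>(1)] integrable_imp_locally_integrable)
      fix \<phi> assume \<phi>: "\<phi> \<in> test_functions \<Omega>"
      have "\<phi> \<in> borel_measurable (lebesgue_on \<Omega>)"
        using test_functions_continuous(1)[OF \<phi>]
        by (intro borel_measurable_lebesgue_on borel_measurable_continuous_onI)
      \<comment> \<open>This integral is the form of \<open>F\<close> at \<open>u\<close>, equal by
        the operator equation to the form of \<open>T\<close>, which vanishes at a function that is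
        0 a.e.\<close>
      then show "(\<integral>x. f x 0 0 * \<phi> x \<partial>lebesgue_on \<Omega>) = 0"
        using F_form_zero[OF u(1) zero f0 _ F_defined[OF u(1) test_functions_W0[OF \<phi>]]]
          T_form_zero[OF u(1) zero] eq[OF test_functions_W0[OF \<phi>]] by simp
    qed
    then show False using f_nonzero by simp
  qed
  moreover have "weak_solution \<Omega> p q \<mu> f u"
    using u(1) eq T_defined F_defined by (simp add: weak_solution_def)
  ultimately show ?thesis using u by blast
qed

end
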